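(* Let $m\ge 2$, $0<\rho<1$ and $a_1,\dots,a_m\in\mathbb{R}$, and let $E\subset\mathbb{R}$ be the self-similar set generated by the homogeneous iterated function system $\Phi=\{\phi_i(x)=\rho x+a_i\}_{i=1}^m$. Assume that $\Phi$ satisfies the open set condition, that $\dim_{\rm H}E<1$, and that $\rho^{-1}$ is a prime number. Let $\gamma\in\mathbb{Q}$ with $\gamma>0$. Then $$\overline{\dim}_{\rm M}\big((\gamma E+\alpha)\cap E\big)<\dim_{\rm H}E\quad\text{for every }\alpha\in\mathbb{R}$$ if and only if $\gamma\notin\{\rho^k:k\in\mathbb{Z}\}$.
   Context: The self-similar set generated by $\Phi=\{\phi_i\}_{i=1}^m$ is the unique non-empty compact set $E\subset\mathbb{R}$ with $E=\bigcup_{i=1}^m\phi_i(E)$. $\Phi$ satisfies the open set condition (OSC) if there is a non-empty bounded open set $V\subset\mathbb{R}$ such that $\phi_1(V),\dots,\phi_m(V)$ are pairwise disjoint and contained in $V$. $\gamma E+\alpha=\{\gamma x+\alpha:x\in E\}$. $\dim_{\rm H}$ denotes Hausdorff dimension. For a non-empty bounded $A\subset\mathbb{R}$, the upper Minkowski dimension is $\overline{\dim}_{\rm M}A=\limsup_{\delta\to0}\frac{\log N_\delta(A)}{-\log\delta}$, where $N_\delta(A)$ is the smallest number of closed intervals of length $\delta$ needed to cover $A$. Convention: $\overline{\dim}_{\rm M}\emptyset=\dim_{\rm H}\emptyset=0$. *)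

theory Defs
  imports "HOL-Analysis.Analysis" "HOL-Computational_Algebra.Primes"
begin

section \<open>Dimensions of subsets of the real line\<close>

text \<open>Boundedness of the covering sets is explicit because the diameter of an unbounded set
  is unspecified.\<close>

definition hausdorff_premeasure :: "real \<Rightarrow> real \<Rightarrow> real set \<Rightarrow> ennreal" where
  "hausdorff_premeasure s \<delta> A =
     (INF U \<in> {U :: nat \<Rightarrow> real set.
                 (\<forall>i. bounded (U i) \<and> diameter (U i) \<le> \<delta>) \<and> A \<subseteq> (\<Union>i. U i)}.
        \<Sum>i. ennreal (diameter (U i) powr s))"

definition hausdorff_outer :: "real \<Rightarrow> real set \<Rightarrow> ennreal" where
  "hausdorff_outer s A = (SUP \<delta> \<in> {0<..}. hausdorff_premeasure s \<delta> A)"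

text \<open>The infimum runs over \<open>s > 0\<close> only: this does not change its value, and it avoids
  the exponent \<open>s = 0\<close>, where \<open>0 powr 0 = 0\<close> makes \<open>hausdorff_outer 0\<close> differ
  from counting measure. In particular the empty set has dimension 0.\<close>

definition hausdorff_dim :: "real set \<Rightarrow> ereal" where
  "hausdorff_dim A = Inf {ereal s | s. 0 < s \<and> hausdorff_outer s A = 0}"

text \<open>The covering intervals are encoded by the finite set of their left endpoints. For an
  unbounded set there is no such cover and the number is unspecified.\<close>

definition covering_number :: "real \<Rightarrow> real set \<Rightarrow> nat" where
  "covering_number \<delta> A =
     (LEAST n. \<exists>T. finite T \<and> card T = n \<and> A \<subseteq> (\<Union>t\<in>T. {t..t + \<delta>}))"

definition upper_minkowski_dim :: "real set \<Rightarrow> ereal" where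
  "upper_minkowski_dim A =
     (if A = {} then 0
      else Limsup (at_right 0) (\<lambda>\<delta>. ereal (ln (real (covering_number \<delta> A)) / (- ln \<delta>))))"

section \<open>Iterated function systems on the real line\<close>

text \<open>For a non-empty finite system of contractions exactly one set satisfies this predicate
  (Hutchinson).\<close>

definition self_similar_set :: "'i set \<Rightarrow> ('i \<Rightarrow> real \<Rightarrow> real) \<Rightarrow> real set \<Rightarrow> bool" where
  "self_similar_set I \<phi> E \<longleftrightarrow> E \<noteq> {} \<and> compact E \<and> E = (\<Union>i\<in>I. \<phi> i ` E)"

definition open_set_condition :: "'i set \<Rightarrow> ('i \<Rightarrow> real \<Rightarrow> real) \<Rightarrow> bool" where
  "open_set_condition I \<phi> \<longleftrightarrow>
     (\<exists>V. V \<noteq> {} \<and> bounded V \<and> open V \<and>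
          disjoint_family_on (\<lambda>i. \<phi> i ` V) I \<and> (\<forall>i\<in>I. \<phi> i ` V \<subseteq> V))"

end

theory Submission
  imports Defs "HOL-Number_Theory.Residues"
begin

text \<open>
  Separation of the cylinders gives \<open>dim\<^sub>H E = s\<close> with \<open>s = log m / log p\<close>, so \<open>m < p\<close>. If \<open>\<gamma>\<close> is a power
  of \<open>\<rho>\<close>, some intersection contains a similar copy of \<open>E\<close>. Conversely, if the dimension of some
  intersection does not drop, then there are cylinders of \<open>E\<close> all of whose descendants, down to
  any prescribed depth, meet \<open>\<gamma> E + \<alpha>\<close>; rescaling them, passing to a limit and using Baire, first
  for \<open>E\<close> and then for the copy, one finds that \<open>E\<close> and some \<open>c E + t\<close>, \<open>c = \<rho> ^ k / \<gamma>\<close>, coincide and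
  are non-empty on an open set. Since \<open>E\<close> has gaps, only finitely many relative positions \<open>\<theta>\<close> of
  cylinders occur there: every word \<open>w\<close> extending a fixed one is paired with a word \<open>w'\<close> such that
  \<open>c \<phi>\<^bsub>w'\<^esub>(0) + t = \<phi>\<^bsub>w\<^esub>(0) + \<rho> ^ n \<theta>\<close>. A \<open>\<rat>\<close>-linear functional turns the digits into integers and
  preserves these relations, as \<open>c\<close> and \<open>\<rho>\<close> are rational. Write \<open>c = p ^ i u / v\<close> with \<open>u\<close>, \<open>v\<close> coprime
  and prime to \<open>p\<close>, and let \<open>\<mu>\<close> be the law of the random integer digit expansion. The averages of
  \<open>x \<mapsto> exp (2 \<pi> i r p ^ j x)\<close> over \<open>j\<close> have small variance, which together with the pairing of words
  forces \<open>|\<mu>^(u r)| = |\<mu>^(v r)|\<close> for all integers \<open>r\<close>. Say \<open>u > 1\<close>, and replace \<open>u\<close>, \<open>v\<close> by large powers.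
  For \<open>r\<close> of the form \<open>r0 (p ^ M - 1) / u\<close> with \<open>\<mu>^(r0) \<noteq> 0\<close>, the left side tends to \<open>|\<mu>^(r0)| ^ 2\<close>, while
  the right side tends to 0 because the base \<open>p\<close> digits of \<open>v r\<close> are periodic and non-trivial.
\<close>

section \<open>Words and addresses\<close>

definition words :: "nat \<Rightarrow> nat \<Rightarrow> nat list set" where
  "words m n = {w. length w = n \<and> set w \<subseteq> {1..m}}"

text \<open>\<open>addr \<rho> a w\<close> is \<open>\<phi>\<^bsub>w\<^esub>(0)\<close>, where the first letter of \<open>w\<close> is the outermost map.\<close>

fun addr :: "real \<Rightarrow> (nat \<Rightarrow> real) \<Rightarrow> nat list \<Rightarrow> real" where
  "addr \<rho> a [] = 0"
| "addr \<rho> a (i # w) = a i + \<rho> * addr \<rho> a w"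

lemma finite_words [simp]: "finite (words m n)"
proof -
  have "finite {w. set w \<subseteq> {1..m} \<and> length w = n}"
    by (rule finite_lists_length_eq) simp
  then show ?thesis by (simp add: words_def conj_commute)
qed

lemma card_words: "card (words m n) = m ^ n"
  using card_lists_length_eq[of "{1..m}" n] by (simp add: words_def conj_commute)

lemma length_words: "w \<in> words m n \<Longrightarrow> length w = n"
  by (simp add: words_def)

lemma words_0 [simp]: "words m 0 = {[]}"
  by (auto simp: words_def)

lemma words_append: "v \<in> words m k \<Longrightarrow> w \<in> words m n \<Longrightarrow> v @ w \<in> words m (k + n)"
  by (auto simp: words_def)

lemma words_take: "w \<in> words m n \<Longrightarrow> k \<le> n \<Longrightarrow> take k w \<in> words m k"
  using set_take_subset[of k w] by (auto simp: words_def)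

lemma words_drop: "w \<in> words m (k + n) \<Longrightarrow> drop k w \<in> words m n"
  using set_drop_subset[of k w] by (auto simp: words_def)

lemma words_Suc: "words m (Suc n) = (\<lambda>(i, w). i # w) ` ({1..m} \<times> words m n)"
proof (intro subset_antisym subsetI)
  fix w assume "w \<in> words m (Suc n)"
  then show "w \<in> (\<lambda>(i, w). i # w) ` ({1..m} \<times> words m n)"
    by (cases w) (auto simp: words_def)
qed (auto simp: words_def)

lemma bij_betw_words_append:
  "bij_betw (\<lambda>(v, w). v @ w) (words m k \<times> words m n) (words m (k + n))"
proof (rule bij_betwI[where g = "\<lambda>w. (take k w, drop k w)"])
  show "(\<lambda>w. (take k w, drop k w)) \<in> words m (k + n) \<rightarrow> words m k \<times> words m n"
    using words_take[of _ m "k + n" k] words_drop[of _ m k n] by auto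
qed (auto simp: words_append length_words)

lemma sum_words_append:
  "(\<Sum>w\<in>words m (k + n). f w) = (\<Sum>v\<in>words m k. \<Sum>w\<in>words m n. f (v @ w))"
  using sum.reindex_bij_betw[OF bij_betw_words_append[of m k n], of f]
  by (simp add: sum.cartesian_product split_def)

lemma sum_words_Suc:
  "(\<Sum>w\<in>words m (Suc n). f w) = (\<Sum>i\<in>{1..m}. \<Sum>w\<in>words m n. f (i # w))"
proof -
  have "inj_on (\<lambda>(i, w). i # w) ({1..m} \<times> words m n)"
    by (auto simp: inj_on_def)
  then show ?thesis
    unfolding words_Suc by (simp add: sum.reindex sum.cartesian_product split_def)
qed

lemma card_words_prefix_le:
  assumes "k \<le> n" "finite P"
  shows "card {w \<in> words m n. take k w \<in> P} \<le> card P * m ^ (n - k)"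
proof -
  have "{w \<in> words m n. take k w \<in> P} \<subseteq> (\<lambda>(v, w). v @ w) ` (P \<times> words m (n - k))"
  proof
    fix w assume "w \<in> {w \<in> words m n. take k w \<in> P}"
    then have "take k w \<in> P" "drop k w \<in> words m (n - k)"
      using words_drop[of w m k "n - k"] assms by auto
    moreover have "w = take k w @ drop k w" by simp
    ultimately show "w \<in> (\<lambda>(v, w). v @ w) ` (P \<times> words m (n - k))"
      by (metis (mono_tags, lifting) SigmaI image_eqI old.prod.case)
  qed
  then have "card {w \<in> words m n. take k w \<in> P} \<le> card ((\<lambda>(v, w). v @ w) ` (P \<times> words m (n - k)))"
    using assms by (intro card_mono) auto
  also have "\<dots> \<le> card (P \<times> words m (n - k))"
    using assms by (intro card_image_le) auto
  finally show ?thesis by (simp add: card_cartesian_product card_words)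
qed

lemma addr_append: "addr \<rho> a (v @ w) = addr \<rho> a v + \<rho> ^ length v * addr \<rho> a w"
  by (induction v) (auto simp: algebra_simps)

text \<open>Half-open cells of length \<open>d\<close> hold at most one point of \<open>X\<close>
  each, and \<open>g\<close> numbers the cells that are met.\<close>

lemma card_separated:
  fixes X :: "real set"
  assumes "\<And>x. x \<in> X \<Longrightarrow> \<bar>x - c\<bar> \<le> R" and "0 < d"
    and "\<And>x y. x \<in> X \<Longrightarrow> y \<in> X \<Longrightarrow> x \<noteq> y \<Longrightarrow> d \<le> \<bar>x - y\<bar>"
  shows "finite X \<and> card X \<le> nat \<lfloor>2 * R / d\<rfloor> + 1"
proof -
  define g where "g x = \<lfloor>(x - (c - R)) / d\<rfloor>" for x
  have inj: "inj_on g X"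
  proof (rule inj_onI, rule ccontr)
    fix x y assume xy: "x \<in> X" "y \<in> X" "g x = g y" "x \<noteq> y"
    have "\<bar>(x - (c - R)) / d - (y - (c - R)) / d\<bar> < 1"
      using xy(3) unfolding g_def by linarith
    moreover have "(x - (c - R)) / d - (y - (c - R)) / d = (x - y) / d"
      by (simp add: diff_divide_distrib)
    ultimately have "\<bar>x - y\<bar> < d"
      using assms(2) by (simp add: abs_divide)
    then show False using assms(3)[OF xy(1,2,4)] by simp
  qed
  have sub: "g ` X \<subseteq> {0..\<lfloor>2 * R / d\<rfloor>}"
  proof
    fix z assume "z \<in> g ` X"
    then obtain x where x: "x \<in> X" "z = g x" by auto
    have "0 \<le> x - (c - R)" "x - (c - R) \<le> 2 * R" using assms(1)[OF x(1)] by auto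
    then show "z \<in> {0..\<lfloor>2 * R / d\<rfloor>}"
      using assms(2) by (auto simp: x(2) g_def intro!: floor_mono divide_right_mono)
  qed
  have fin: "finite X"
    using inj sub finite_subset[OF sub] finite_imageD by blast
  have "card X = card (g ` X)" by (simp add: card_image inj)
  also have "\<dots> \<le> card {0..\<lfloor>2 * R / d\<rfloor>}" using sub by (intro card_mono) auto
  also have "\<dots> \<le> nat \<lfloor>2 * R / d\<rfloor> + 1" by simp
  finally show ?thesis using fin by simp
qed

text \<open>The open set condition enters only through \<open>separated\<close>: the images of 0
  under different cylinder maps of level \<open>n\<close> are at least \<open>l * \<rho> ^ n\<close>
  apart. Speaking of these points instead of the cylinders allows neighbouring cylinders of
  \<open>E\<close> to touch.\<close>

locale separated_ifs =
  fixes m p :: nat and \<rho> :: real and a :: "nat \<Rightarrow> real" and E :: "real set" and l :: real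
  assumes m_ge_2: "m \<ge> 2" and p_ge_2: "p \<ge> 2" and rho_eq: "\<rho> = 1 / real p"
    and E_nonempty: "E \<noteq> {}" and E_compact: "compact E"
    and E_eq: "E = (\<Union>i\<in>{1..m}. (\<lambda>x. \<rho> * x + a i) ` E)"
    and l_pos: "l > 0"
    and separated: "\<And>n v w. v \<in> words m n \<Longrightarrow> w \<in> words m n \<Longrightarrow> v \<noteq> w \<Longrightarrow>
        l * \<rho> ^ n \<le> \<bar>addr \<rho> a v - addr \<rho> a w\<bar>"
begin

lemma rho_pos: "0 < \<rho>" and rho_less_1: "\<rho> < 1"
  using p_ge_2 by (auto simp: rho_eq field_simps)

abbreviation pt :: "nat list \<Rightarrow> real" where "pt w \<equiv> addr \<rho> a w"

lemma address_mem:
  assumes "x \<in> E" "w \<in> words m n"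
  shows "\<rho> ^ n * x + pt w \<in> E"
  using assms(2)
proof (induction n arbitrary: w)
  case 0
  then show ?case using assms(1) by simp
next
  case (Suc n)
  then obtain i v where w: "w = i # v" "i \<in> {1..m}" "v \<in> words m n"
    unfolding words_Suc by auto
  have "\<rho> * (\<rho> ^ n * x + pt v) + a i \<in> E"
    using Suc.IH[OF w(3)] w(2) by (subst E_eq) auto
  then show ?case by (simp add: w algebra_simps)
qed

lemma address_exists:
  assumes "x \<in> E"
  shows "\<exists>w\<in>words m n. \<exists>y\<in>E. x = \<rho> ^ n * y + pt w"
  using assms
proof (induction n arbitrary: x)
  case 0
  then show ?case by auto
next
  case (Suc n)
  then obtain i y where y: "i \<in> {1..m}" "y \<in> E" "x = \<rho> * y + a i"
    using E_eq by blast
  obtain w z where w: "w \<in> words m n" "z \<in> E" "y = \<rho> ^ n * z + pt w"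
    using Suc.IH[OF y(2)] by auto
  have "i # w \<in> words m (Suc n)" using w y by (auto simp: words_Suc)
  moreover have "x = \<rho> ^ Suc n * z + pt (i # w)" by (simp add: y w algebra_simps)
  ultimately show ?case using w by blast
qed

text \<open>A radius for \<open>E\<close> about the origin; the lower bound 1 makes the logarithm of
  \<open>2 * D\<close> positive.\<close>

definition D :: real where "D = (SOME D. 1 \<le> D \<and> (\<forall>x\<in>E. \<bar>x\<bar> \<le> D))"

lemma D_ge_1: "1 \<le> D" and E_le_D: "x \<in> E \<Longrightarrow> \<bar>x\<bar> \<le> D"
proof -
  obtain B where B: "\<forall>x\<in>E. norm x \<le> B"
    using compact_imp_bounded[OF E_compact] by (auto simp: bounded_iff)
  then have "\<exists>D. 1 \<le> D \<and> (\<forall>x\<in>E. \<bar>x\<bar> \<le> D)"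
    by (intro exI[of _ "max 1 B"]) force
  from someI_ex[OF this] show "1 \<le> D" "x \<in> E \<Longrightarrow> \<bar>x\<bar> \<le> D"
    unfolding D_def by auto
qed

lemma inj_on_pt: "inj_on pt (words m n)"
  using separated[of _ n] l_pos rho_pos
  by (intro inj_onI) (metis abs_zero diff_self linorder_not_less mult_pos_pos zero_less_power)

lemma E_closed: "closed E" using E_compact by (rule compact_imp_closed)

text \<open>A bound, uniform in \<open>n\<close>, for the number of words of length \<open>n\<close>
  whose addresses lie in an interval of radius \<open>R * \<rho> ^ n\<close>.\<close>

definition near :: "real \<Rightarrow> nat" where "near R = nat \<lfloor>2 * R / l\<rfloor> + 1"

lemma card_near:
  assumes "\<And>w. w \<in> P \<Longrightarrow> w \<in> words m n \<and> \<bar>pt w - c\<bar> \<le> R * \<rho> ^ n"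
  shows "card P \<le> near R"
proof -
  have sub: "P \<subseteq> words m n" using assms by auto
  have r: "0 < \<rho> ^ n" using rho_pos by simp
  have "finite (pt ` P) \<and> card (pt ` P) \<le> nat \<lfloor>2 * (R * \<rho> ^ n) / (l * \<rho> ^ n)\<rfloor> + 1"
  proof (rule card_separated[where c = c])
    show "0 < l * \<rho> ^ n" using l_pos r by simp
  next
    fix x y assume "x \<in> pt ` P" "y \<in> pt ` P" "x \<noteq> y"
    then show "l * \<rho> ^ n \<le> \<bar>x - y\<bar>" using separated[of _ n] sub by auto
  qed (use assms in auto)
  moreover have "2 * (R * \<rho> ^ n) / (l * \<rho> ^ n) = 2 * R / l" using rho_pos by simp
  moreover have "card (pt ` P) = card P"
    using inj_on_subset[OF inj_on_pt sub] by (rule card_image)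
  ultimately show ?thesis by (simp add: near_def)
qed

end

section \<open>Isolation and full sets\<close>

lemma card_le_fibres:
  assumes "finite A" "finite B" "F ` A \<subseteq> B" and "\<And>b. b \<in> B \<Longrightarrow> card {x \<in> A. F x = b} \<le> C"
  shows "card A \<le> C * card B"
proof -
  have "A = (\<Union>b\<in>B. {x \<in> A. F x = b})" using assms(3) by auto
  then have "card A \<le> (\<Sum>b\<in>B. card {x \<in> A. F x = b})"
    using card_UN_le[OF assms(2), of "\<lambda>b. {x \<in> A. F x = b}"] by simp
  also have "\<dots> \<le> card B * C"
    using sum_bounded_above[of B "\<lambda>b. card {x \<in> A. F x = b}" C] assms(4) by simp
  finally show ?thesis by (simp add: mult.commute)
qed

text \<open>Bolzano-Weierstrass for one coordinate after the other, each time along a subsequence of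
  the previous one.\<close>

lemma finite_family_convergent_subseq:
  fixes \<sigma> :: "nat \<Rightarrow> nat \<Rightarrow> real"
  assumes "\<And>n i. i < C \<Longrightarrow> \<bar>\<sigma> n i\<bar> \<le> R"
  shows "\<exists>r t. strict_mono r \<and> (\<forall>i<C. (\<lambda>n. \<sigma> (r n) i) \<longlonglongrightarrow> t i)"
  using assms
proof (induction C)
  case 0
  show ?case by (rule exI[of _ id]) (auto simp: strict_mono_def)
next
  case (Suc C)
  then obtain r t where r: "strict_mono r" "\<forall>i<C. (\<lambda>n. \<sigma> (r n) i) \<longlonglongrightarrow> t i"
    by (metis less_Suc_eq)
  have "\<sigma> (r n) C \<in> {-R..R}" for n using Suc.prems[of C "r n"] by auto
  with compact_imp_seq_compact[OF compact_Icc[of "-R" R]] obtain z r' where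
    z: "strict_mono r'" "((\<lambda>n. \<sigma> (r n) C) \<circ> r') \<longlonglongrightarrow> z"
    unfolding seq_compact_def by metis
  have "(\<lambda>n. \<sigma> ((r \<circ> r') n) i) \<longlonglongrightarrow> (t(C := z)) i" if "i < Suc C" for i
  proof (cases "i = C")
    case True
    then show ?thesis using z(2) by (simp add: o_def)
  next
    case False
    then have "(\<lambda>n. \<sigma> (r n) i) \<longlonglongrightarrow> t i" using r(2) that by auto
    from LIMSEQ_subseq_LIMSEQ[OF this z(1)] show ?thesis using False by (simp add: o_def)
  qed
  then show ?case using strict_mono_o[OF r(1) z(1)] by blast
qed

text \<open>The Baire argument for finitely many closed sets: if \<open>K s\<close> misses a point
  of \<open>X \<inter> W\<close>, replace \<open>W\<close> by \<open>W - K s\<close> and continue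
  with the remaining sets.\<close>

lemma finite_closed_cover_local:
  fixes X :: "'a::topological_space set"
  assumes "finite S" "\<And>s. s \<in> S \<Longrightarrow> closed (K s)" "open W" "X \<inter> W \<noteq> {}"
    "X \<inter> W \<subseteq> (\<Union>s\<in>S. K s)"
  shows "\<exists>s\<in>S. \<exists>W'. open W' \<and> W' \<subseteq> W \<and> X \<inter> W' \<noteq> {} \<and> X \<inter> W' \<subseteq> K s"
  using assms
proof (induction S arbitrary: W rule: finite_induct)
  case empty
  then show ?case by auto
next
  case (insert s S)
  show ?case
  proof (cases "X \<inter> W \<subseteq> K s")
    case True
    then show ?thesis using insert.prems by blast
  next
    case False
    have "\<exists>s'\<in>S. \<exists>W'. open W' \<and> W' \<subseteq> W - K s \<and> X \<inter> W' \<noteq> {} \<and> X \<inter> W' \<subseteq> K s'"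
      by (rule insert.IH) (use insert.prems False in \<open>auto intro: open_Diff\<close>)
    then show ?thesis by blast
  qed
qed

context separated_ifs
begin

text \<open>Near \<open>e\<close>, the set \<open>E\<close> seen through any cylinder map looks like \<open>E\<close> itself.\<close>

definition isolating :: "real \<Rightarrow> real \<Rightarrow> bool" where
  "isolating e \<eta> \<longleftrightarrow> (\<forall>n. \<forall>w\<in>words m n. \<forall>z. \<bar>z - e\<bar> < \<eta> \<longrightarrow> \<rho> ^ n * z + pt w \<in> E \<longrightarrow> z \<in> E)"

text \<open>Schief's argument: prefixing a word with a maximal number of neighbours by any word
  creates no new neighbours.\<close>

lemma isolating_exists: "\<exists>e\<in>E. \<exists>\<eta>>0. isolating e \<eta>"
proof -
  \<comment> \<open>In units of the cylinder size, 1 pays for the distance from \<open>z\<close> to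
    \<open>e\<close> and \<open>2 * D\<close> for replacing \<open>x0\<close> by another point of
    \<open>E\<close>.\<close>
  define R where "R = 1 + 2 * D"
  define Nb where "Nb u = {v \<in> words m (length u). \<bar>pt v - pt u\<bar> \<le> R * \<rho> ^ length u}" for u
  obtain x0 where x0: "x0 \<in> E" using E_nonempty by auto
  \<comment> \<open>Neighbour counts are bounded by \<open>near R\<close>, so some word attains the
    maximum.\<close>
  have "\<exists>u. (\<exists>n. u \<in> words m n) \<and> (\<forall>v. (\<exists>n. v \<in> words m n) \<longrightarrow> card (Nb v) \<le> card (Nb u))"
  proof -
    have 1: "\<forall>y. (\<exists>n. y \<in> words m n) \<longrightarrow> card (Nb y) < Suc (near R)"
      unfolding Nb_def less_Suc_eq_le
      by (intro allI impI, rule card_near) (auto simp: words_def)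
    have 2: "\<exists>n. [] \<in> words m n" by (rule exI[of _ 0]) simp
    show ?thesis
      by (rule ex_has_greatest_nat[where P = "\<lambda>u. \<exists>n. u \<in> words m n" and
            f = "\<lambda>u. card (Nb u)", OF 2 1])
  qed
  then obtain u k where u: "u \<in> words m k"
    and mx: "\<And>v n. v \<in> words m n \<Longrightarrow> card (Nb v) \<le> card (Nb u)"
    by (elim exE conjE) metis
  define e where "e = \<rho> ^ k * x0 + pt u"
  have "isolating e (\<rho> ^ k)"
    unfolding isolating_def
  proof (intro allI ballI impI)
    fix n w z
    assume w: "w \<in> words m n" and z: "\<bar>z - e\<bar> < \<rho> ^ k" and "\<rho> ^ n * z + pt w \<in> E"
    then obtain v x where v: "v \<in> words m (n + k)" "x \<in> E"
      "\<rho> ^ n * z + pt w = \<rho> ^ (n + k) * x + pt v"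
      using address_exists by blast
    have len: "length w = n" "length u = k" "length v = n + k"
      using w u v by (auto simp: words_def)
    have wu: "w @ u \<in> words m (n + k)" using words_append w u by blast
    have "pt v - pt (w @ u) = \<rho> ^ n * ((z - e) + \<rho> ^ k * (x0 - x))"
      using v(3) by (simp add: addr_append len e_def power_add algebra_simps)
    moreover have "\<bar>(z - e) + \<rho> ^ k * (x0 - x)\<bar> \<le> \<rho> ^ k * R"
    proof -
      have "\<bar>\<rho> ^ k * (x0 - x)\<bar> \<le> \<rho> ^ k * (2 * D)"
        using E_le_D[OF x0] E_le_D[OF v(2)] rho_pos
        by (simp add: abs_mult)
      then show ?thesis using z by (simp add: R_def algebra_simps)
    qed
    ultimately have "\<bar>pt v - pt (w @ u)\<bar> \<le> \<rho> ^ n * (\<rho> ^ k * R)"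
      using rho_pos by (simp add: abs_mult)
    then have vN: "v \<in> Nb (w @ u)"
      using v(1) by (simp add: Nb_def len power_add algebra_simps)
    have sub: "(\<lambda>v. w @ v) ` Nb u \<subseteq> Nb (w @ u)"
    proof
      fix y assume "y \<in> (\<lambda>v. w @ v) ` Nb u"
      then obtain v where v: "v \<in> words m k" "\<bar>pt v - pt u\<bar> \<le> R * \<rho> ^ k" "y = w @ v"
        by (auto simp: Nb_def len)
      have "pt (w @ v) - pt (w @ u) = \<rho> ^ n * (pt v - pt u)"
        by (simp add: addr_append len algebra_simps)
      then have "\<bar>pt (w @ v) - pt (w @ u)\<bar> \<le> \<rho> ^ n * (R * \<rho> ^ k)"
        using v(2) rho_pos by (simp add: abs_mult)
      then show "y \<in> Nb (w @ u)"
        using v words_append[OF w v(1)] by (simp add: Nb_def len power_add algebra_simps)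
    qed
    have fin: "finite (Nb (w @ u))" by (simp add: Nb_def)
    \<comment> \<open>By maximality the neighbours of \<open>w @ u\<close> are exactly the words
      \<open>w @ v\<close> with \<open>v\<close> a neighbour of \<open>u\<close>. So the word found
      for the given point of \<open>E\<close> begins with \<open>w\<close>, and the outer map can be
      cancelled.\<close>
    have "card (Nb (w @ u)) \<le> card ((\<lambda>v. w @ v) ` Nb u)"
      using mx[OF wu] by (simp add: card_image inj_on_def)
    then have "(\<lambda>v. w @ v) ` Nb u = Nb (w @ u)"
      using sub fin card_seteq by blast
    then obtain v' where v': "v' \<in> words m k" "v = w @ v'" using vN by (auto simp: Nb_def len)
    have "\<rho> ^ n * z = \<rho> ^ n * (\<rho> ^ k * x + pt v')"
      using v(3) by (simp add: v' addr_append len power_add algebra_simps)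
    then have "z = \<rho> ^ k * x + pt v'" using rho_pos by simp
    then show "z \<in> E" using address_mem[OF v(2) v'(1)] by simp
  qed
  moreover have "e \<in> E" using address_mem[OF x0 u] by (simp add: e_def)
  ultimately show ?thesis using rho_pos by (metis zero_less_power)
qed

text \<open>The opposite of a uniform loss of branches: for every depth some cylinder keeps all its
  descendants. The word \<open>w\<close> may depend on \<open>n\<close>, hence the later passage to
  a limit.\<close>

definition full :: "real set \<Rightarrow> bool" where
  "full A \<longleftrightarrow> (\<forall>n\<ge>1. \<exists>k. \<exists>w\<in>words m k. \<forall>v\<in>words m n. \<exists>x\<in>E. \<rho> ^ (k + n) * x + pt (w @ v) \<in> A)"

lemma full_mono: "full A \<Longrightarrow> A \<subseteq> B \<Longrightarrow> full B"
  unfolding full_def by blast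

definition hits :: "nat \<Rightarrow> real set \<Rightarrow> nat list set" where
  "hits n A = {w \<in> words m n. \<exists>x\<in>E. \<rho> ^ n * x + pt w \<in> A}"

lemma finite_hits [simp]: "finite (hits n A)"
  by (simp add: hits_def)

text \<open>Below every word one extension of length \<open>n\<close> is missing, so each group of
  \<open>n\<close> levels multiplies the count by at most \<open>m ^ n - 1\<close>.\<close>

lemma not_full_card_hits:
  assumes "\<not> full A"
  shows "\<exists>n\<ge>1. \<forall>k. card (hits (n * k) A) \<le> (m ^ n - 1) ^ k"
proof -
  obtain n where n: "n \<ge> 1"
    and "\<forall>k. \<forall>w\<in>words m k. \<exists>v\<in>words m n. \<forall>x\<in>E. \<rho> ^ (k + n) * x + pt (w @ v) \<notin> A"
    using assms unfolding full_def by blast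
  then obtain bad where bad: "\<And>k w. w \<in> words m k \<Longrightarrow> bad k w \<in> words m n"
    "\<And>k w x. w \<in> words m k \<Longrightarrow> x \<in> E \<Longrightarrow> \<rho> ^ (k + n) * x + pt (w @ bad k w) \<notin> A"
    by metis
  have "card (hits (n * k) A) \<le> (m ^ n - 1) ^ k" for k
  proof (induction k)
    case 0
    have "hits 0 A \<subseteq> {[]}" by (auto simp: hits_def)
    from card_mono[OF _ this] show ?case by simp
  next
    case (Suc k)
    let ?N = "n * k"
    let ?S = "SIGMA v:hits ?N A. words m n - {bad ?N v}"
    have "hits (n * Suc k) A \<subseteq> (\<lambda>(v, u). v @ u) ` ?S"
    proof
      fix w assume "w \<in> hits (n * Suc k) A"
      then obtain x where w: "w \<in> words m (?N + n)" "x \<in> E" "\<rho> ^ (?N + n) * x + pt w \<in> A"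
        by (auto simp: hits_def add.commute)
      define v u where "v = take ?N w" and "u = drop ?N w"
      have vu: "v \<in> words m ?N" "u \<in> words m n" "w = v @ u" "length v = ?N"
        using words_take[OF w(1)] words_drop[OF w(1)] by (auto simp: v_def u_def words_def)
      have "\<rho> ^ ?N * (\<rho> ^ n * x + pt u) + pt v \<in> A"
        using w(3) by (simp add: vu addr_append power_add algebra_simps)
      then have "v \<in> hits ?N A"
        using vu address_mem[OF w(2) vu(2)] by (auto simp: hits_def)
      moreover have "u \<noteq> bad ?N v" using bad(2)[OF vu(1) w(2)] w(3) vu by auto
      ultimately show "w \<in> (\<lambda>(v, u). v @ u) ` ?S" using vu by auto
    qed
    then have "card (hits (n * Suc k) A) \<le> card ((\<lambda>(v, u). v @ u) ` ?S)"
      by (intro card_mono) auto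
    also have "\<dots> \<le> card ?S" by (intro card_image_le) auto
    also have "\<dots> = (\<Sum>v\<in>hits ?N A. card (words m n - {bad ?N v}))"
      by (simp add: card_SigmaI)
    also have "\<dots> = (\<Sum>v\<in>hits ?N A. m ^ n - 1)"
      using bad(1) by (intro sum.cong) (auto simp: hits_def card_words)
    also have "\<dots> \<le> (m ^ n - 1) ^ k * (m ^ n - 1)" using Suc.IH by simp
    finally show ?case by (simp add: mult.commute)
  qed
  then show ?thesis using n by blast
qed

text \<open>Sending a cylinder of \<open>E\<close> to one containing the image of a chosen point is
  boundedly many to one. So the copy meets at least a fixed fraction of all cylinders at each level,
  which excludes a geometric loss.\<close>

lemma full_copy:
  assumes "c > 0" "(\<lambda>x. c * x + b) ` E \<subseteq> E"
  shows "full ((\<lambda>x. c * x + b) ` E)"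
proof (rule ccontr)
  let ?A = "(\<lambda>x. c * x + b) ` E"
  assume "\<not> full ?A"
  then obtain n where n: "n \<ge> 1" and cnt: "\<And>k. card (hits (n * k) ?A) \<le> (m ^ n - 1) ^ k"
    using not_full_card_hits by blast
  define C where "C = near (D / c + D)"
  obtain x0 where x0: "x0 \<in> E" using E_nonempty by auto
  have main: "m ^ (n * k) \<le> C * card (hits (n * k) ?A)" for k
  proof -
    let ?N = "n * k"
    have "\<exists>w\<in>words m ?N. \<exists>y\<in>E. c * (\<rho> ^ ?N * x0 + pt u) + b = \<rho> ^ ?N * y + pt w"
      if "u \<in> words m ?N" for u
      using address_mem[OF x0 that] assms(2) by (intro address_exists) auto
    then obtain F Y where F: "\<And>u. u \<in> words m ?N \<Longrightarrow> F u \<in> words m ?N \<and> Y u \<in> E \<and>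
        c * (\<rho> ^ ?N * x0 + pt u) + b = \<rho> ^ ?N * Y u + pt (F u)"
      by metis
    have "card (words m ?N) \<le> C * card (hits ?N ?A)"
    proof (rule card_le_fibres)
      show "F ` words m ?N \<subseteq> hits ?N ?A"
      proof
        fix w assume "w \<in> F ` words m ?N"
        then obtain u where u: "u \<in> words m ?N" "w = F u" by auto
        have "\<rho> ^ ?N * Y u + pt w = c * (\<rho> ^ ?N * x0 + pt u) + b" using F u by simp
        then have "\<rho> ^ ?N * Y u + pt w \<in> ?A" using address_mem[OF x0 u(1)] by auto
        then show "w \<in> hits ?N ?A" using F u by (auto simp: hits_def)
      qed
    next
      fix w
      show "card {u \<in> words m ?N. F u = w} \<le> C"
        unfolding C_def
      proof (rule card_near[where c = "(pt w - b) / c" and n = ?N])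
        fix u assume u: "u \<in> {u \<in> words m ?N. F u = w}"
        then have Fu: "Y u \<in> E" "c * (\<rho> ^ ?N * x0 + pt u) + b = \<rho> ^ ?N * Y u + pt w"
          using F by auto
        have "pt u - (pt w - b) / c = \<rho> ^ ?N * (Y u / c - x0)"
          using Fu(2) assms(1) by (simp add: field_simps)
        moreover have "\<bar>Y u / c - x0\<bar> \<le> D / c + D"
        proof -
          have "\<bar>Y u / c\<bar> \<le> D / c" using E_le_D[OF Fu(1)] assms(1) by (simp add: divide_right_mono)
          then show ?thesis using E_le_D[OF x0] by linarith
        qed
        ultimately have "\<bar>pt u - (pt w - b) / c\<bar> \<le> \<rho> ^ ?N * (D / c + D)"
          using rho_pos by (simp only: abs_mult) (simp add: mult_left_mono)
        then show "u \<in> words m ?N \<and> \<bar>pt u - (pt w - b) / c\<bar> \<le> (D / c + D) * \<rho> ^ ?N"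
          using u by (simp add: mult.commute)
      qed
    qed auto
    then show ?thesis by (simp add: card_words)
  qed
  define q where "q = m ^ n"
  have "m ^ 1 \<le> m ^ n" using m_ge_2 n by (intro power_increasing) auto
  then have q: "q \<ge> 2" using m_ge_2 by (simp add: q_def)
  have le: "q ^ k \<le> C * (q - 1) ^ k" for k
    using order_trans[OF main mult_left_mono[OF cnt]] by (simp add: q_def power_mult)
  have "1 < real q / real (q - 1)" using q by (simp add: field_simps)
  then obtain k where "real C < (real q / real (q - 1)) ^ k" using real_arch_pow by blast
  then have "real C * real (q - 1) ^ k < real q ^ k"
    using q by (simp add: power_divide field_simps)
  moreover have "real q ^ k \<le> real C * real (q - 1) ^ k"
    using le[of k] by (metis of_nat_le_iff of_nat_mult of_nat_power)
  ultimately show False by simp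
qed

end

section \<open>Blow-ups and local coincidence of copies\<close>

text \<open>Repetitions are allowed, so that sets of varying size become families over one index
  set, ready for a limit.\<close>

lemma finite_enumeration:
  assumes "finite X" "X \<noteq> {}" "card X \<le> C"
  shows "\<exists>f. f ` {..<C} = X"
proof -
  obtain h where h: "bij_betw h {0..<card X} X" using ex_bij_betw_nat_finite[OF assms(1)] by blast
  have pos: "0 < card X" using assms by (simp add: card_gt_0_iff)
  define f where "f i = h (if i < card X then i else 0)" for i
  have "f ` {..<C} = h ` {0..<card X}"
  proof (intro subset_antisym subsetI)
    fix x assume "x \<in> h ` {0..<card X}"
    then obtain i where "i < card X" "x = h i" by auto
    then show "x \<in> f ` {..<C}" using assms(3) by (intro image_eqI[of _ _ i]) (auto simp: f_def)
  qed (use pos in \<open>auto simp: f_def\<close>)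
  then show ?thesis using bij_betw_imp_surj_on[OF h] by auto
qed

context separated_ifs
begin

lemma rho_power_small:
  assumes "\<epsilon> > 0" shows "\<exists>n. K * \<rho> ^ n < \<epsilon>"
proof -
  have "(\<lambda>n. K * \<rho> ^ n) \<longlonglongrightarrow> K * 0"
    using rho_pos rho_less_1 by (intro tendsto_mult tendsto_const LIMSEQ_realpow_zero) auto
  then have "eventually (\<lambda>n. K * \<rho> ^ n < \<epsilon>) sequentially"
    using assms by (simp add: order_tendsto_iff)
  then show ?thesis by (meson eventually_sequentially order_refl)
qed

lemma closed_affine_image: "closed ((\<lambda>x. c * x + s) ` E)"
  by (intro compact_imp_closed compact_continuous_image continuous_intros E_compact)

text \<open>Pull the copy back through the cylinder maps of the words \<open>w n\<close> given by
  fullness. What can meet \<open>E\<close> is then a union of boundedly many sets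
  \<open>c E + s\<close>, and it hits every cylinder of level \<open>Suc n\<close>; the limits of
  the shifts along a subsequence therefore give a cover of \<open>E\<close>. If the copy lies in
  \<open>E\<close>, isolation makes this inclusion survive near \<open>e\<close> in the
  limit.\<close>

lemma blow_up:
  assumes c: "c > 0" and full: "full ((\<lambda>x. c * x + b) ` E)"
  shows "\<exists>S. finite S \<and> E \<subseteq> (\<Union>s\<in>S. (\<lambda>x. c * x + s) ` E) \<and>
    (\<forall>e \<eta>. isolating e \<eta> \<longrightarrow> (\<lambda>x. c * x + b) ` E \<subseteq> E \<longrightarrow>
      (\<forall>s\<in>S. \<forall>x\<in>E. \<bar>c * x + s - e\<bar> < \<eta> \<longrightarrow> c * x + s \<in> E))"
proof -
  define R where "R = D + c * D"
  define C where "C = near (R / c)"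
  have "\<forall>n. \<exists>k. \<exists>w\<in>words m k. \<forall>v\<in>words m (Suc n). \<exists>x\<in>E.
      \<rho> ^ (k + Suc n) * x + pt (w @ v) \<in> (\<lambda>x. c * x + b) ` E"
    using full unfolding full_def by (metis le_add1 plus_1_eq_Suc)
  then obtain k w where w: "\<And>n. w n \<in> words m (k n)"
    and hit: "\<And>n v. v \<in> words m (Suc n) \<Longrightarrow> \<exists>x\<in>E. 
        \<rho> ^ (k n + Suc n) * x + pt (w n @ v) \<in> (\<lambda>x. c * x + b) ` E"
    by metis
  have lenw: "length (w n) = k n" for n using w by (rule length_words)
  \<comment> \<open>In the coordinates of the cylinder \<open>w n\<close>, the part of the copy that
    comes from the cylinder \<open>u\<close> is \<open>c E + shift n u\<close>; taking
    \<open>u\<close> of the same length \<open>k n\<close> keeps the ratio \<open>c\<close>.\<close>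
  define shift where "shift n u = (c * pt u + b - pt (w n)) / \<rho> ^ k n" for n u
  have rk: "0 < \<rho> ^ k n" for n using rho_pos by simp
  have shift_mult: "\<rho> ^ k n * shift n u = c * pt u + b - pt (w n)" for n u
    using rho_pos by (simp add: shift_def)
  have shift: "c * (\<rho> ^ k n * x + pt u) + b = \<rho> ^ k n * (c * x + shift n u) + pt (w n)" for n x u
    using shift_mult[of n u] by (simp add: algebra_simps)
  \<comment> \<open>Other shifts are irrelevant: a point of \<open>c E + s\<close> lying in
    \<open>E\<close> forces \<open>\<bar>s\<bar> \<le> D + c * D\<close>.\<close>
  define P where "P n = {u \<in> words m (k n). \<bar>shift n u\<bar> \<le> R}" for n
  have cover: "\<exists>x\<in>E. \<exists>s\<in>shift n ` P n. \<exists>x'\<in>E. \<rho> ^ Suc n * x + pt v = c * x' + s"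
    if v: "v \<in> words m (Suc n)" for n v
  proof -
    obtain x y where x: "x \<in> E" and y: "y \<in> E"
      "\<rho> ^ (k n + Suc n) * x + pt (w n @ v) = c * y + b"
      using hit[OF v] by auto
    obtain u x' where u: "u \<in> words m (k n)" "x' \<in> E" "y = \<rho> ^ k n * x' + pt u"
      using address_exists[OF y(1)] by blast
    have "\<rho> ^ k n * (\<rho> ^ Suc n * x + pt v) = \<rho> ^ k n * (c * x' + shift n u)"
      using y(2) unfolding u(3) shift by (simp add: addr_append lenw power_add algebra_simps)
    then have eq: "\<rho> ^ Suc n * x + pt v = c * x' + shift n u" using rho_pos by simp
    have "\<bar>c * x' + shift n u\<bar> \<le> D" using E_le_D[OF address_mem[OF x v]] eq by simp
    moreover have "\<bar>c * x'\<bar> \<le> c * D" using E_le_D[OF u(2)] c by (simp add: abs_mult)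
    ultimately have "u \<in> P n" using u by (simp add: P_def R_def)
    then show ?thesis using eq x u by blast
  qed
  have card: "card (shift n ` P n) \<le> C" for n
  proof -
    have "card (P n) \<le> C"
      unfolding C_def
    proof (rule card_near[where c = "(pt (w n) - b) / c" and n = "k n"])
      fix u assume u: "u \<in> P n"
      have "pt u - (pt (w n) - b) / c = \<rho> ^ k n * shift n u / c"
        using c by (simp add: shift_mult diff_divide_distrib add_divide_distrib)
      moreover have "\<bar>\<rho> ^ k n * shift n u / c\<bar> \<le> \<rho> ^ k n * R / c"
        using u rho_pos c by (simp add: abs_mult P_def divide_right_mono)
      ultimately show "u \<in> words m (k n) \<and> \<bar>pt u - (pt (w n) - b) / c\<bar> \<le> (R / c) * \<rho> ^ k n"
        using u by (simp add: P_def mult.commute)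
    qed
    moreover have "card (shift n ` P n) \<le> card (P n)" by (rule card_image_le) (simp add: P_def)
    ultimately show ?thesis by simp
  qed
  have "shift n ` P n \<noteq> {}" for n
  proof -
    have "card (words m (Suc n)) > 0" using m_ge_2 by (simp add: card_words)
    then obtain v where "v \<in> words m (Suc n)" by fastforce
    then show ?thesis using cover by blast
  qed
  then have "\<exists>f. f ` {..<C} = shift n ` P n" for n
    using card by (intro finite_enumeration) (auto simp: P_def)
  then obtain \<sigma> where \<sigma>: "\<And>n. \<sigma> n ` {..<C} = shift n ` P n" by metis
  have "\<bar>\<sigma> n i\<bar> \<le> R" if "i < C" for n i
    using \<sigma>[of n] that by (force simp: P_def)
  then obtain r t where r: "strict_mono r" and t: "\<And>i. i < C \<Longrightarrow> (\<lambda>n. \<sigma> (r n) i) \<longlonglongrightarrow> t i"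
    using finite_family_convergent_subseq[of C \<sigma> R] by blast
  let ?S = "t ` {..<C}"
  have "E \<subseteq> (\<Union>s\<in>?S. (\<lambda>x. c * x + s) ` E)"
  proof (rule subsetI, rule ccontr)
    fix x assume x: "x \<in> E" "x \<notin> (\<Union>s\<in>?S. (\<lambda>x. c * x + s) ` E)"
    have "closed (\<Union>s\<in>?S. (\<lambda>x. c * x + s) ` E)"
      using closed_affine_image by (intro closed_UN) auto
    from separate_point_closed[OF this x(2)] obtain \<epsilon> where eps: "\<epsilon> > 0"
      "\<And>y. y \<in> (\<Union>s\<in>?S. (\<lambda>x. c * x + s) ` E) \<Longrightarrow> \<epsilon> \<le> dist x y"
      by blast
    \<comment> \<open>The point \<open>x\<close> shares a cylinder of diameter below
      \<open>\<epsilon> / 2\<close> with a point of some \<open>c E + s\<close>, and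
      \<open>s\<close> is within \<open>\<epsilon> / 2\<close> of its limit, so \<open>x\<close> is
      too close to the limit union.\<close>
    have "eventually (\<lambda>n. \<forall>i\<in>{..<C}. dist (\<sigma> (r n) i) (t i) < \<epsilon> / 2) sequentially"
      using t eps(1) by (intro eventually_ball_finite ballI tendstoD) auto
    moreover obtain n1 where n1: "2 * D * \<rho> ^ n1 < \<epsilon> / 2"
      using rho_power_small[of "\<epsilon> / 2" "2 * D"] eps(1) half_gt_zero by blast
    ultimately obtain n where n: "n \<ge> n1" "\<And>i. i < C \<Longrightarrow> dist (\<sigma> (r n) i) (t i) < \<epsilon> / 2"
      unfolding eventually_sequentially by (metis lessThan_iff nat_le_linear order_refl)
    let ?n = "r n"
    obtain v y where v: "v \<in> words m (Suc ?n)" "y \<in> E" "x = \<rho> ^ Suc ?n * y + pt v"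
      using address_exists[OF x(1)] by blast
    obtain x1 s x2 where s: "x1 \<in> E" "s \<in> shift ?n ` P ?n" "x2 \<in> E"
      "\<rho> ^ Suc ?n * x1 + pt v = c * x2 + s"
      using cover[OF v(1)] by blast
    obtain i where i: "i < C" "s = \<sigma> ?n i" using s(2) \<sigma>[of ?n] by force
    have "n1 \<le> Suc ?n" using n(1) seq_suble[OF r, of n] by simp
    then have "\<rho> ^ Suc ?n \<le> \<rho> ^ n1" using rho_pos rho_less_1 by (intro power_decreasing) auto
    then have "2 * D * \<rho> ^ Suc ?n \<le> 2 * D * \<rho> ^ n1" using D_ge_1 by (intro mult_left_mono) auto
    then have small: "2 * D * \<rho> ^ Suc ?n < \<epsilon> / 2" using n1 by linarith
    have "x - (c * x2 + t i) = \<rho> ^ Suc ?n * (y - x1) + (\<sigma> ?n i - t i)"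
      using v(3) s(4) i(2) by (simp add: algebra_simps)
    moreover have "\<bar>\<rho> ^ Suc ?n * (y - x1)\<bar> \<le> 2 * D * \<rho> ^ Suc ?n"
    proof -
      have "\<bar>y - x1\<bar> \<le> 2 * D" using E_le_D[OF v(2)] E_le_D[OF s(1)] by linarith
      then show ?thesis using rho_pos by (simp only: abs_mult) (simp add: mult.commute mult_left_mono)
    qed
    moreover have "\<bar>\<sigma> ?n i - t i\<bar> < \<epsilon> / 2" using n(2)[OF i(1)] by (simp add: dist_real_def)
    ultimately have "\<bar>x - (c * x2 + t i)\<bar> < \<epsilon>" using small by linarith
    moreover have "\<epsilon> \<le> dist x (c * x2 + t i)" using eps(2) i(1) s(3) by auto
    ultimately show False by (simp add: dist_real_def)
  qed
  moreover have "c * x + s \<in> E"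
    if iso: "isolating e \<eta>" and sub: "(\<lambda>x. c * x + b) ` E \<subseteq> E" and s: "s \<in> ?S" and x: "x \<in> E"
      and near: "\<bar>c * x + s - e\<bar> < \<eta>" for e \<eta> s x
  proof -
    obtain i where i: "i < C" "s = t i" using s by auto
    have lim: "(\<lambda>n. c * x + \<sigma> (r n) i) \<longlonglongrightarrow> c * x + s"
      unfolding i(2) by (intro tendsto_intros t i)
    have "(\<lambda>n. \<bar>c * x + \<sigma> (r n) i - e\<bar>) \<longlonglongrightarrow> \<bar>c * x + s - e\<bar>"
      by (intro tendsto_intros lim)
    then have "eventually (\<lambda>n. \<bar>c * x + \<sigma> (r n) i - e\<bar> < \<eta>) sequentially"
      using near by (rule order_tendstoD)
    \<comment> \<open>Before the limit, the cylinder map of \<open>w (r n)\<close> carries the point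
      into the copy and hence into \<open>E\<close>; isolation puts the point itself in
      \<open>E\<close>, which is closed.\<close>
    then have ev: "eventually (\<lambda>n. c * x + \<sigma> (r n) i \<in> E) sequentially"
    proof eventually_elim
      case (elim n)
      have "\<sigma> (r n) i \<in> shift (r n) ` P (r n)" using \<sigma>[of "r n"] i(1) by blast
      then obtain u where u: "u \<in> words m (k (r n))" "\<sigma> (r n) i = shift (r n) u"
        by (auto simp: P_def)
      have "c * (\<rho> ^ k (r n) * x + pt u) + b \<in> E" using sub address_mem[OF x u(1)] by auto
      then have "\<rho> ^ k (r n) * (c * x + shift (r n) u) + pt (w (r n)) \<in> E" by (simp only: shift)
      then show ?case using iso elim w[of "r n"] unfolding isolating_def u(2) by blast
    qed
    show ?thesis by (rule Lim_in_closed_set[OF E_closed ev _ lim]) simp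
  qed
  ultimately show ?thesis by (intro exI[of _ ?S]) auto
qed

text \<open>By Baire a single limit copy covers \<open>E\<close> on an open set, in particular a
  small cylinder of \<open>E\<close>; undoing its cylinder map changes the ratio to
  \<open>c / \<rho> ^ k\<close>.\<close>

lemma full_imp_embedding:
  assumes c: "c > 0" and full: "full ((\<lambda>x. c * x + b) ` E)"
  shows "\<exists>k t. E \<subseteq> (\<lambda>x. c / \<rho> ^ k * x + t) ` E"
proof -
  obtain S where S: "finite S" "E \<subseteq> (\<Union>s\<in>S. (\<lambda>x. c * x + s) ` E)"
    using blow_up[OF assms] by blast
  have "\<exists>s\<in>S. \<exists>W'. open W' \<and> W' \<subseteq> UNIV \<and> E \<inter> W' \<noteq> {} \<and> E \<inter> W' \<subseteq> (\<lambda>x. c * x + s) ` E"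
    using S E_nonempty closed_affine_image by (intro finite_closed_cover_local) auto
  then obtain s W where W: "open W" "E \<inter> W \<noteq> {}" "E \<inter> W \<subseteq> (\<lambda>x. c * x + s) ` E"
    by blast
  obtain x where x: "x \<in> E" "x \<in> W" using W(2) by blast
  obtain \<epsilon> where eps: "\<epsilon> > 0" "\<And>y. dist y x < \<epsilon> \<Longrightarrow> y \<in> W"
    using W(1) x(2) unfolding open_dist by blast
  obtain k where k: "2 * D * \<rho> ^ k < \<epsilon>" using rho_power_small[OF eps(1)] by blast
  obtain w y where w: "w \<in> words m k" "y \<in> E" "x = \<rho> ^ k * y + pt w"
    using address_exists[OF x(1)] by blast
  have rk: "0 < \<rho> ^ k" using rho_pos by simp
  have "z \<in> (\<lambda>x. c / \<rho> ^ k * x + (s - pt w) / \<rho> ^ k) ` E" if z: "z \<in> E" for z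
  proof -
    have "\<bar>z - y\<bar> \<le> 2 * D" using E_le_D[OF z] E_le_D[OF w(2)] by linarith
    then have "\<rho> ^ k * \<bar>z - y\<bar> < \<epsilon>"
      using k rk mult_left_mono[of "\<bar>z - y\<bar>" "2 * D" "\<rho> ^ k"]
      by (metis less_imp_le mult.commute order.strict_trans1)
    moreover have "dist (\<rho> ^ k * z + pt w) x = \<rho> ^ k * \<bar>z - y\<bar>"
      using rho_pos by (simp add: w(3) dist_real_def abs_mult flip: right_diff_distrib)
    ultimately have "\<rho> ^ k * z + pt w \<in> E \<inter> W"
      using eps(2) address_mem[OF z w(1)] by simp
    then obtain x' where x': "x' \<in> E" "\<rho> ^ k * z + pt w = c * x' + s" using W(3) by blast
    then have "z * \<rho> ^ k = c * x' + (s - pt w)" by (simp add: algebra_simps)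
    then have "z = (c * x' + (s - pt w)) / \<rho> ^ k" using rho_pos by (simp add: eq_divide_eq)
    then have "z = c / \<rho> ^ k * x' + (s - pt w) / \<rho> ^ k" by (simp add: add_divide_distrib)
    then show ?thesis using x'(1) by blast
  qed
  then show ?thesis by blast
qed

text \<open>Inverting the embedding puts a copy inside \<open>E\<close>, which is full by counting.
  Blowing up this copy and localising near an isolating point gives both inclusions at once.\<close>

lemma full_imp_local_equality:
  assumes c: "c > 0" and full: "full ((\<lambda>x. c * x + b) ` E)"
  shows "\<exists>k t W. open W \<and> E \<inter> W \<noteq> {} \<and> (\<forall>z\<in>W. z \<in> E \<longleftrightarrow> z \<in> (\<lambda>x. \<rho> ^ k / c * x + t) ` E)"
proof -
  obtain k t where kt: "E \<subseteq> (\<lambda>x. c / \<rho> ^ k * x + t) ` E"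
    using full_imp_embedding[OF assms] by blast
  define c' b' where "c' = \<rho> ^ k / c" and "b' = - t * c'"
  have c': "c' > 0" using c rho_pos by (simp add: c'_def)
  have sub: "(\<lambda>x. c' * x + b') ` E \<subseteq> E"
  proof
    fix y assume "y \<in> (\<lambda>x. c' * x + b') ` E"
    then obtain x z where "x \<in> E" "y = c' * x + b'" "z \<in> E" "x = c / \<rho> ^ k * z + t"
      using kt by blast
    moreover from this have "y = z"
      using c rho_pos by (simp add: c'_def b'_def field_simps)
    ultimately show "y \<in> E" by simp
  qed
  obtain e \<eta> where e: "e \<in> E" "\<eta> > 0" "isolating e \<eta>" using isolating_exists by blast
  obtain S where S: "finite S" "E \<subseteq> (\<Union>s\<in>S. (\<lambda>x. c' * x + s) ` E)"
    and loc: "\<And>s x. s \<in> S \<Longrightarrow> x \<in> E \<Longrightarrow> \<bar>c' * x + s - e\<bar> < \<eta> \<Longrightarrow> c' * x + s \<in> E"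
    using blow_up[OF c' full_copy[OF c' sub]] e(3) sub by metis
  \<comment> \<open>Searching for the open set inside \<open>ball e \<eta>\<close> is what makes
    \<open>loc\<close> applicable, and with it the inclusion of the copy in
    \<open>E\<close>.\<close>
  have "\<exists>s\<in>S. \<exists>W'. open W' \<and> W' \<subseteq> ball e \<eta> \<and> E \<inter> W' \<noteq> {} \<and> E \<inter> W' \<subseteq> (\<lambda>x. c' * x + s) ` E"
    using S e closed_affine_image by (intro finite_closed_cover_local) auto
  then obtain s W where W: "s \<in> S" "open W" "W \<subseteq> ball e \<eta>" "E \<inter> W \<noteq> {}"
    "E \<inter> W \<subseteq> (\<lambda>x. c' * x + s) ` E"
    by blast
  have "z \<in> E \<longleftrightarrow> z \<in> (\<lambda>x. c' * x + s) ` E" if "z \<in> W" for z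
  proof
    assume "z \<in> (\<lambda>x. c' * x + s) ` E"
    then obtain x where x: "x \<in> E" "z = c' * x + s" by blast
    have "\<bar>z - e\<bar> < \<eta>" using that W(3) by (auto simp: dist_real_def)
    then show "z \<in> E" using loc[OF W(1) x(1)] x(2) by simp
  qed (use W(5) that in blast)
  then show ?thesis using W(2,4) unfolding c'_def by blast
qed

text \<open>The cylinders of level \<open>n\<close> lie in intervals of total length
  \<open>2 * D * (m * \<rho>) ^ n\<close>, which tends to 0 because \<open>m < p\<close>.\<close>

lemma no_interval:
  assumes "m < p" "u < v"
  shows "\<exists>x. u < x \<and> x < v \<and> x \<notin> E"
proof (rule ccontr)
  assume "\<not> ?thesis"
  then have sub: "{u<..<v} \<subseteq> E" by auto
  have bound: "v - u \<le> 2 * D * (m * \<rho>) ^ n" for n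
  proof -
    have "{u<..<v} \<subseteq> (\<Union>w\<in>words m n. {pt w - D * \<rho> ^ n..pt w + D * \<rho> ^ n})"
    proof
      fix x assume "x \<in> {u<..<v}"
      then obtain w y where w: "w \<in> words m n" "y \<in> E" "x = \<rho> ^ n * y + pt w"
        using sub address_exists by blast
      have "\<bar>\<rho> ^ n * y\<bar> \<le> \<rho> ^ n * D" using E_le_D[OF w(2)] rho_pos by (simp add: abs_mult)
      then have "x \<in> {pt w - D * \<rho> ^ n..pt w + D * \<rho> ^ n}" using w(3) by (auto simp: abs_le_iff algebra_simps)
      then show "x \<in> (\<Union>w\<in>words m n. {pt w - D * \<rho> ^ n..pt w + D * \<rho> ^ n})" using w(1) by blast
    qed
    then have "emeasure lborel {u<..<v} \<le> emeasure lborel (\<Union>w\<in>words m n. {pt w - D * \<rho> ^ n..pt w + D * \<rho> ^ n})"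
      by (intro emeasure_mono) auto
    also have "\<dots> \<le> (\<Sum>w\<in>words m n. emeasure lborel {pt w - D * \<rho> ^ n..pt w + D * \<rho> ^ n})"
      by (intro emeasure_subadditive_finite) auto
    also have "\<dots> = (\<Sum>w\<in>words m n. ennreal (2 * D * \<rho> ^ n))"
      using D_ge_1 rho_pos by (intro sum.cong) (auto simp: algebra_simps)
    also have "\<dots> = ennreal (2 * D * (m * \<rho>) ^ n)"
      using D_ge_1 rho_pos
      by (simp add: card_words power_mult_distrib ennreal_mult' ennreal_of_nat_eq_real_of_nat
          flip: ennreal_power) (simp flip: ennreal_mult' add: algebra_simps)
    finally show ?thesis
      using assms(2) D_ge_1 rho_pos by (simp add: ennreal_le_iff)
  qed
  have "real m * \<rho> < 1" using assms(1) p_ge_2 by (simp add: rho_eq)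
  then have "(\<lambda>n. 2 * D * (m * \<rho>) ^ n) \<longlonglongrightarrow> 2 * D * 0"
    using rho_pos by (intro tendsto_mult tendsto_const LIMSEQ_realpow_zero) auto
  then have "v - u \<le> 2 * D * 0" by (rule LIMSEQ_le_const) (use bound in auto)
  then show False using assms(2) by simp
qed

text \<open>The elements of \<open>\<Theta>\<close> are separated, because a gap of \<open>E\<close> cannot be translated by a small
  amount.\<close>

lemma finitely_many_relative_positions:
  assumes mp: "m < p" and c: "c > 0" and W: "open W" "E \<inter> W \<noteq> {}"
    and eq: "\<And>z. z \<in> W \<Longrightarrow> z \<in> E \<longleftrightarrow> z \<in> (\<lambda>x. c * x + t) ` E"
  shows "\<exists>\<Theta> L n0 w0. finite \<Theta> \<and> w0 \<in> words m n0 \<and>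
    (\<forall>n. \<forall>v\<in>words m n. \<exists>w'\<in>words m (n0 + n + L). \<exists>\<theta>\<in>\<Theta>.
        c * pt w' + t = pt (w0 @ v) + \<rho> ^ (n0 + n) * \<theta>)"
proof -
  obtain e \<eta> where e: "e \<in> E" "\<eta> > 0" and iso: "isolating e \<eta>" using isolating_exists by blast
  obtain x where x: "x \<in> E" "x \<in> W" using W(2) by blast
  obtain \<epsilon> where eps: "\<epsilon> > 0" "\<And>y. dist y x < \<epsilon> \<Longrightarrow> y \<in> W"
    using W(1) x(2) unfolding open_dist by blast
  \<comment> \<open>Below depth \<open>n0\<close>, all points within relative distance
    \<open>\<eta>\<close> of the image of \<open>e\<close> stay in \<open>W\<close>. The
    \<open>L\<close> further letters make the matching cylinder of the copy fit into the isolating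
    neighbourhood.\<close>
  obtain n0 where n0: "(2 * D + \<eta>) * \<rho> ^ n0 < \<epsilon>" using rho_power_small[OF eps(1)] by blast
  obtain L where L: "c * (2 * D + \<eta>) * \<rho> ^ L < \<eta>" using rho_power_small[OF e(2)] by blast
  obtain w0 x0 where w0: "w0 \<in> words m n0" "x0 \<in> E" "x = \<rho> ^ n0 * x0 + pt w0"
    using address_exists[OF x(1)] by blast
  define c' where "c' = c * \<rho> ^ L"
  have c': "c' > 0" using c rho_pos by (simp add: c'_def)
  \<comment> \<open>In the coordinates of the cylinder \<open>w0 @ v\<close>, the matching cylinder
    of the copy is \<open>c' E + \<theta>\<close>, and membership in \<open>\<Theta>\<close> says
    that near the image of \<open>e\<close> it agrees with \<open>E\<close>.\<close>
  define \<Theta> where "\<Theta> = {\<theta>. \<forall>z. \<bar>z - e\<bar> < \<eta> \<longrightarrow> (c' * z + \<theta> \<in> E \<longleftrightarrow> z \<in> E)}"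
  have "finite \<Theta>"
  proof -
    obtain b where b: "e < b" "b < e + \<eta>" "b \<notin> E" using no_interval[OF mp, of e "e + \<eta>"] e by auto
    have 1: "compact (E \<inter> {e..b})" using E_compact by (intro compact_Int_closed) auto
    have 2: "E \<inter> {e..b} \<noteq> {}" using e b by auto
    obtain k where k: "k \<in> E \<inter> {e..b}" "\<forall>y\<in>E \<inter> {e..b}. y \<le> k"
      using compact_attains_sup[OF 1 2] by blast
    have "k \<noteq> b" "k \<le> b" using k(1) b(3) by auto
    then have kb: "k < b" by simp
    have gap: "y \<notin> E" if "k < y" "y < b" for y
    proof
      assume "y \<in> E"
      then have "y \<in> E \<inter> {e..b}" using that k(1) by auto
      then show False using k(2) that by force
    qed
    define d where "d = c' * (b - k)"
    \<comment> \<open>A smaller difference would carry the endpoint \<open>k\<close> into the gap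
      between \<open>k\<close> and \<open>b\<close>: \<open>c' * k + \<theta>'\<close> would be the
      image, for the position \<open>\<theta>\<close>, of a point \<open>z\<close> strictly inside
      the gap.\<close>
    have apart: "d \<le> \<theta>' - \<theta>" if "\<theta> \<in> \<Theta>" "\<theta>' \<in> \<Theta>" "\<theta> < \<theta>'" for \<theta> \<theta>'
    proof (rule ccontr)
      assume less: "\<not> d \<le> \<theta>' - \<theta>"
      define z where "z = k + (\<theta>' - \<theta>) / c'"
      have "c' * k + \<theta>' \<in> E" using that(2) k(1) b e by (auto simp: \<Theta>_def)
      moreover have "c' * k + \<theta>' = c' * z + \<theta>" using c' by (simp add: z_def field_simps)
      moreover have z: "k < z" "z < b"
        using less that(3) c' by (auto simp: z_def d_def field_simps)
      moreover have "\<bar>z - e\<bar> < \<eta>" using z k(1) b by auto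
      ultimately have "z \<in> E" using that(1) by (auto simp: \<Theta>_def)
      then show False using gap z by blast
    qed
    have "finite \<Theta> \<and> card \<Theta> \<le> nat \<lfloor>2 * (D + c' * D) / d\<rfloor> + 1"
    proof (rule card_separated[where c = 0])
      show "0 < d" using kb c' by (simp add: d_def)
    next
      fix \<theta> assume "\<theta> \<in> \<Theta>"
      then have "c' * e + \<theta> \<in> E" using e by (auto simp: \<Theta>_def)
      then have "\<bar>c' * e + \<theta>\<bar> \<le> D" by (rule E_le_D)
      moreover have "\<bar>c' * e\<bar> \<le> c' * D" using E_le_D[OF e(1)] c' by (simp add: abs_mult)
      ultimately show "\<bar>\<theta> - 0\<bar> \<le> D + c' * D" by linarith
    next
      fix \<theta> \<theta>' assume *: "\<theta> \<in> \<Theta>" "\<theta>' \<in> \<Theta>" "\<theta> \<noteq> \<theta>'"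
      show "d \<le> \<bar>\<theta> - \<theta>'\<bar>"
      proof (cases "\<theta> < \<theta>'")
        case True
        then show ?thesis using apart[OF *(1,2)] by linarith
      next
        case False
        then show ?thesis using apart[OF *(2,1)] *(3) by linarith
      qed
    qed
    then show ?thesis by simp
  qed
  moreover have "\<exists>w'\<in>words m (n0 + n + L). \<exists>\<theta>\<in>\<Theta>.
        c * pt w' + t = pt (w0 @ v) + \<rho> ^ (n0 + n) * \<theta>" if v: "v \<in> words m n" for n v
  proof -
    let ?n = "n0 + n" and ?w = "w0 @ v"
    have w: "?w \<in> words m ?n" using words_append w0 v by blast
    have len: "length w0 = n0" using w0 by (rule_tac length_words)
    have r: "0 < \<rho> ^ ?n" "0 < \<rho> ^ n0" "0 < \<rho> ^ n" "\<rho> ^ n \<le> 1"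
      using rho_pos rho_less_1 by (auto intro: power_le_one)
    define P where "P = \<rho> ^ ?n * e + pt ?w"
    have PE: "P \<in> E" using address_mem[OF e(1) w] by (simp add: P_def)
    have inW: "q \<in> W" if "\<bar>q - P\<bar> < \<rho> ^ ?n * \<eta>" for q
    proof -
      have P: "P - x = \<rho> ^ n0 * ((\<rho> ^ n * e + pt v) - x0)"
        by (simp add: P_def w0(3) addr_append len power_add algebra_simps)
      have "\<bar>(\<rho> ^ n * e + pt v) - x0\<bar> \<le> 2 * D"
        using E_le_D[OF address_mem[OF e(1) v]] E_le_D[OF w0(2)] by linarith
      then have "\<bar>P - x\<bar> \<le> \<rho> ^ n0 * (2 * D)"
        unfolding P abs_mult using r by (simp add: mult_left_mono)
      moreover have "\<rho> ^ ?n * \<eta> \<le> \<rho> ^ n0 * \<eta>"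
        using r e(2) by (simp add: power_add mult_left_le)
      ultimately have "\<bar>q - x\<bar> < \<epsilon>" using that n0 by (simp add: algebra_simps)
      then show ?thesis using eps(2) by (simp add: dist_real_def)
    qed
    have "P \<in> W" using inW[of P] r e by simp
    then obtain y where y: "y \<in> E" "P = c * y + t" using eq PE by blast
    obtain w' y' where w': "w' \<in> words m (?n + L)" "y' \<in> E" "y = \<rho> ^ (?n + L) * y' + pt w'"
      using address_exists[OF y(1)] by blast
    define \<theta> where "\<theta> = (c * pt w' + t - pt ?w) / \<rho> ^ ?n"
    have \<theta>: "\<rho> ^ ?n * \<theta> = c * pt w' + t - pt ?w"
      using rho_pos by (simp add: \<theta>_def)
    \<comment> \<open>The chain uses isolation for \<open>?w\<close> at \<open>z'\<close>, the local
      coincidence at \<open>q\<close>, and isolation for \<open>w'\<close> at \<open>z\<close>; the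
      estimates keep these points in range.\<close>
    have "\<theta> \<in> \<Theta>"
      unfolding \<Theta>_def
    proof (intro CollectI allI impI)
      fix z assume z: "\<bar>z - e\<bar> < \<eta>"
      define q where "q = c * (\<rho> ^ (?n + L) * z + pt w') + t"
      define z' where "z' = c' * z + \<theta>"
      have q: "q = \<rho> ^ ?n * z' + pt ?w"
        using \<theta> by (simp add: q_def z'_def c'_def power_add algebra_simps)
      have "q - P = \<rho> ^ ?n * (c * \<rho> ^ L * (z - y'))"
        by (simp add: q_def y(2) w'(3) power_add algebra_simps)
      moreover have "\<bar>c * \<rho> ^ L * (z - y')\<bar> < \<eta>"
      proof -
        have "\<bar>z - y'\<bar> \<le> 2 * D + \<eta>" using z E_le_D[OF e(1)] E_le_D[OF w'(2)] by linarith
        then have "c * \<rho> ^ L * \<bar>z - y'\<bar> \<le> c * \<rho> ^ L * (2 * D + \<eta>)"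
          using c rho_pos by (intro mult_left_mono) auto
        moreover have "c * \<rho> ^ L * (2 * D + \<eta>) = c * (2 * D + \<eta>) * \<rho> ^ L" by simp
        moreover have "\<bar>c * \<rho> ^ L * (z - y')\<bar> = c * \<rho> ^ L * \<bar>z - y'\<bar>"
          using c rho_pos by (simp add: abs_mult)
        ultimately show ?thesis using L by linarith
      qed
      ultimately have qP: "\<bar>q - P\<bar> < \<rho> ^ ?n * \<eta>" using rho_pos by (simp add: abs_mult)
      have "q - P = \<rho> ^ ?n * (z' - e)" by (simp add: q P_def algebra_simps)
      then have z': "\<bar>z' - e\<bar> < \<eta>" using qP rho_pos by (simp add: abs_mult)
      have "z' \<in> E \<longleftrightarrow> q \<in> E"
        using address_mem[OF _ w] iso z' w unfolding isolating_def q by blast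
      also have "\<dots> \<longleftrightarrow> q \<in> (\<lambda>x. c * x + t) ` E" using eq[OF inW[OF qP]] .
      also have "\<dots> \<longleftrightarrow> \<rho> ^ (?n + L) * z + pt w' \<in> E" using c by (auto simp: q_def)
      also have "\<dots> \<longleftrightarrow> z \<in> E"
        using address_mem[OF _ w'(1)] iso z w'(1) unfolding isolating_def by blast
      finally show "c' * z + \<theta> \<in> E \<longleftrightarrow> z \<in> E" by (simp add: z'_def)
    qed
    moreover have "c * pt w' + t = pt ?w + \<rho> ^ ?n * \<theta>"
      using \<theta> by simp
    ultimately show ?thesis using w'(1) by blast
  qed
  ultimately show ?thesis using w0(1) by blast
qed

end

section \<open>Dimensions\<close>

lemma powr_add_le:
  fixes x y s :: real
  assumes "0 \<le> x" "0 \<le> y" "0 \<le> s"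
  shows "(x + y) powr s \<le> 2 powr s * (x powr s + y powr s)"
proof -
  have "(x + y) powr s \<le> (2 * max x y) powr s" using assms by (intro powr_mono2) auto
  also have "\<dots> = 2 powr s * max x y powr s" using assms by (simp add: powr_mult)
  also have "\<dots> \<le> 2 powr s * (x powr s + y powr s)"
    by (intro mult_left_mono) (auto simp: max_def)
  finally show ?thesis .
qed

lemma finite_cover_by_intervals_exists:
  fixes A :: "real set"
  assumes "bounded A" "\<delta> > 0"
  shows "\<exists>T. finite T \<and> A \<subseteq> (\<Union>t\<in>T. {t..t + \<delta>})"
proof -
  obtain B where B: "\<forall>x\<in>A. norm x \<le> B" using assms(1) by (auto simp: bounded_iff)
  define T where "T = (\<lambda>i::int. i * \<delta>) ` {\<lfloor>- B / \<delta>\<rfloor>..\<lfloor>B / \<delta>\<rfloor>}"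
  have "A \<subseteq> (\<Union>t\<in>T. {t..t + \<delta>})"
  proof
    fix x assume x: "x \<in> A"
    have "of_int \<lfloor>x / \<delta>\<rfloor> * \<delta> \<le> x" "x \<le> of_int \<lfloor>x / \<delta>\<rfloor> * \<delta> + \<delta>"
    proof -
      have "of_int \<lfloor>x / \<delta>\<rfloor> \<le> x / \<delta>" by simp
      then show "of_int \<lfloor>x / \<delta>\<rfloor> * \<delta> \<le> x" using assms(2) by (simp add: le_divide_eq)
      have "x / \<delta> \<le> of_int \<lfloor>x / \<delta>\<rfloor> + 1" by linarith
      then have "x \<le> (of_int \<lfloor>x / \<delta>\<rfloor> + 1) * \<delta>"
        using pos_divide_le_eq[OF assms(2)] by blast
      then show "x \<le> of_int \<lfloor>x / \<delta>\<rfloor> * \<delta> + \<delta>" by (simp only: distrib_right mult_1_left)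
    qed
    moreover have "- B \<le> x" "x \<le> B" using B x by auto
    then have "\<lfloor>x / \<delta>\<rfloor> \<in> {\<lfloor>- B / \<delta>\<rfloor>..\<lfloor>B / \<delta>\<rfloor>}"
      using assms(2) by (auto intro!: floor_mono divide_right_mono simp del: divide_minus_left minus_divide_left)
    ultimately show "x \<in> (\<Union>t\<in>T. {t..t + \<delta>})" by (auto simp: T_def)
  qed
  moreover have "finite T" by (simp add: T_def)
  ultimately show ?thesis by blast
qed

lemma covering_number_attained:
  assumes "bounded A" "\<delta> > 0"
  shows "\<exists>T. finite T \<and> card T = covering_number \<delta> A \<and> A \<subseteq> (\<Union>t\<in>T. {t..t + \<delta>})"
  unfolding covering_number_def
  by (rule LeastI_ex) (use finite_cover_by_intervals_exists[OF assms] in blast)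

lemma covering_number_le:
  assumes "finite T" "A \<subseteq> (\<Union>t\<in>T. {t..t + \<delta>})"
  shows "covering_number \<delta> A \<le> card T"
  unfolding covering_number_def by (rule Least_le) (use assms in blast)

section \<open>Hausdorff dimension of \<open>E\<close> by counting cylinders\<close>

context separated_ifs
begin

text \<open>The similarity dimension, determined by \<open>real p powr dm = real m\<close>.\<close>

definition dm :: real where "dm = ln (real m) / ln (real p)"

lemma ln_p_pos: "0 < ln (real p)" and ln_m_pos: "0 < ln (real m)"
  using p_ge_2 m_ge_2 by auto

lemma dm_pos: "0 < dm" using ln_p_pos ln_m_pos by (simp add: dm_def)

lemma powr_dm: "real p powr dm = real m"
  using ln_p_pos ln_m_pos p_ge_2 m_ge_2 by (simp add: dm_def powr_def)

lemma rho_power_powr_dm: "(\<rho> ^ n) powr dm = (1 / real m) ^ n"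
proof -
  have "(\<rho> ^ n) powr dm = (\<rho> powr dm) ^ n"
    using rho_pos by (simp add: powr_power powr_realpow[symmetric] powr_powr mult.commute)
  also have "\<rho> powr dm = 1 / real m"
    by (simp add: rho_eq powr_divide powr_dm)
  finally show ?thesis .
qed

lemma scale_exists:
  assumes "0 < r" "r < 1"
  shows "\<exists>k. \<rho> ^ Suc k \<le> r \<and> r < \<rho> ^ k"
proof -
  have ex: "\<exists>n. \<rho> ^ n \<le> r" using rho_power_small[OF assms(1), of 1] by (auto intro: less_imp_le)
  define n where "n = (LEAST n. \<rho> ^ n \<le> r)"
  have n: "\<rho> ^ n \<le> r" unfolding n_def by (rule LeastI_ex[OF ex])
  have "n \<noteq> 0" using n assms(2) by (cases n) auto
  then obtain k where k: "n = Suc k" by (cases n) auto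
  have "\<not> \<rho> ^ k \<le> r" using not_less_Least[of k "\<lambda>n. \<rho> ^ n \<le> r"] k unfolding n_def by simp
  then show ?thesis using n k by (auto simp: not_le)
qed

text \<open>The mass distribution argument in counting form. A ball of radius \<open>r i\<close>
  meets boundedly many cylinders of comparable size, each accounting for a proportion
  \<open>(1 / m) ^ \<kappa> i\<close> of all long words. Since all words must be covered, the total
  weight of a cover is bounded below.\<close>

lemma hausdorff_outer_nonzero:
  assumes s: "0 < s" "s \<le> dm"
  shows "hausdorff_outer s E \<noteq> 0"
proof
  assume H: "hausdorff_outer s E = 0"
  define C where "C = near (1 + D)"
  \<comment> \<open>The losses are \<open>C\<close> cylinders per ball, a factor \<open>m\<close>
    from rounding radii to powers of \<open>\<rho>\<close>, and \<open>2 powr s * 2\<close> from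
    enlarging the sets; \<open>\<epsilon>\<close> is chosen so that the final estimate reads
    \<open>1 \<le> 1 / 2\<close>.\<close>
  define M where "M = real C * real m * (2 powr s * 2)"
  define \<epsilon> where "\<epsilon> = 1 / (2 * M)"
  have C: "C \<ge> 1" by (simp add: C_def near_def)
  have p2: "0 < 2 powr s" by simp
  have "1 * 1 \<le> C * m" using C m_ge_2 by (intro mult_le_mono) auto
  then have CM: "1 \<le> real C * real m" by (simp flip: of_nat_mult)
  have "0 < real C * real m" using CM by linarith
  then have "0 < real C * real m * (2 powr s * 2)" using p2 by (intro mult_pos_pos[of "real C * real m"]) simp_all
  then have M: "M > 0" by (simp only: M_def)
  have eps: "\<epsilon> > 0" using M by (simp add: \<epsilon>_def)
  have small: "2 powr s * (\<epsilon> + \<epsilon>) \<le> 1 / 2"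
  proof -
    have "2 powr s * 2 \<le> M" using CM p2 mult_right_mono[OF CM, of "2 powr s * 2"] by (simp add: M_def)
    then have "2 powr s * 2 * \<epsilon> \<le> M * \<epsilon>" using eps by (intro mult_right_mono) auto
    also have "M * \<epsilon> = 1 / 2" using M by (simp add: \<epsilon>_def)
    finally show ?thesis by simp
  qed
  have "hausdorff_premeasure s 1 E \<le> hausdorff_outer s E"
    unfolding hausdorff_outer_def by (rule SUP_upper) simp
  then have "hausdorff_premeasure s 1 E < ennreal \<epsilon>" using H eps by simp
  then obtain U where U: "\<And>i. bounded (U i)" "E \<subseteq> (\<Union>i. U i)"
    "(\<Sum>i. ennreal (diameter (U i) powr s)) < ennreal \<epsilon>"
    unfolding hausdorff_premeasure_def INF_less_iff by blast
  define d where "d i = diameter (U i)" for i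
  have d0: "0 \<le> d i" for i unfolding d_def by (rule diameter_ge_0[OF U(1)])
  have sum_d: "(\<Sum>i\<in>I. d i powr s) \<le> \<epsilon>" if "finite I" for I
  proof -
    have "ennreal (\<Sum>i\<in>I. d i powr s) = (\<Sum>i\<in>I. ennreal (d i powr s))"
      by (simp add: sum_ennreal)
    also have "\<dots> \<le> (\<Sum>i. ennreal (d i powr s))"
      by (rule sum_le_suminf) (use that in auto)
    also have "\<dots> \<le> ennreal \<epsilon>" using U(3) by (simp add: d_def)
    finally show ?thesis using eps by (simp add: ennreal_le_iff)
  qed
  \<comment> \<open>Positive increments turn the covering sets into open balls, as compactness
    requires, at an additional weight of at most \<open>\<epsilon>\<close>.\<close>
  define \<eta> where "\<eta> i = (\<epsilon> * (1 / 2) ^ Suc i) powr (1 / s)" for i :: nat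
  have eta: "\<eta> i > 0" "\<eta> i powr s = \<epsilon> * (1 / 2) ^ Suc i" for i
    using eps s by (auto simp: \<eta>_def powr_powr)
  have sum_eta: "(\<Sum>i\<in>I. \<eta> i powr s) \<le> \<epsilon>" if "finite I" for I
  proof -
    have "(\<Sum>i\<in>I. (1 / 2 :: real) ^ Suc i) \<le> (\<Sum>i. (1 / 2) ^ Suc i)"
      by (rule sum_le_suminf) (use that power_half_series in \<open>auto simp: sums_iff\<close>)
    also have "\<dots> = 1" using power_half_series by (simp add: sums_iff)
    finally have "(\<Sum>i\<in>I. (1 / 2 :: real) ^ Suc i) \<le> 1" .
    then have "\<epsilon> * (\<Sum>i\<in>I. (1 / 2 :: real) ^ Suc i) \<le> \<epsilon> * 1" using eps by (intro mult_left_mono) auto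
    then show ?thesis unfolding eta by (simp only: sum_distrib_left mult_1_right)
  qed
  define r where "r i = d i + \<eta> i" for i
  have r_pos: "0 < r i" for i using d0[of i] eta(1)[of i] by (simp add: r_def)
  have r_powr: "r i powr s \<le> 2 powr s * (d i powr s + \<eta> i powr s)" for i
    unfolding r_def using d0[of i] eta(1)[of i] s by (intro powr_add_le) auto
  have r_less: "r i < 1" for i
  proof (rule ccontr)
    assume "\<not> r i < 1"
    then have "1 \<le> r i powr s" using s by (intro ge_one_powr_ge_zero) auto
    also have "\<dots> \<le> 2 powr s * (\<epsilon> + \<epsilon>)"
      using r_powr[of i] sum_d[of "{i}"] sum_eta[of "{i}"] p2
      by (intro order_trans[OF r_powr] mult_left_mono add_mono) auto
    finally show False using small by simp
  qed
  \<comment> \<open>For an empty \<open>U i\<close> the centre is arbitrary; an additional ball does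
    no harm.\<close>
  define c where "c i = (SOME x. x \<in> U i)" for i
  have "E \<subseteq> (\<Union>i\<in>UNIV. ball (c i) (r i))"
  proof
    fix y assume "y \<in> E"
    then obtain i where i: "y \<in> U i" using U(2) by blast
    then have "c i \<in> U i" unfolding c_def by (rule someI)
    then have "dist (c i) y \<le> d i"
      unfolding d_def using diameter_bounded_bound[OF U(1) _ i] by blast
    then have "y \<in> ball (c i) (r i)" using eta(1)[of i] by (simp add: r_def)
    then show "y \<in> (\<Union>i\<in>UNIV. ball (c i) (r i))" by blast
  qed
  then obtain I where I: "finite I" "E \<subseteq> (\<Union>i\<in>I. ball (c i) (r i))"
    using compactE_image[OF E_compact, of UNIV "\<lambda>i. ball (c i) (r i)"] by auto
  have "\<exists>\<kappa>. \<forall>i. \<rho> ^ Suc (\<kappa> i) \<le> r i \<and> r i < \<rho> ^ \<kappa> i"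
    using scale_exists[OF r_pos r_less] by metis
  then obtain \<kappa> where \<kappa>: "\<And>i. \<rho> ^ Suc (\<kappa> i) \<le> r i" "\<And>i. r i < \<rho> ^ \<kappa> i" by blast
  define n where "n = (\<Sum>i\<in>I. \<kappa> i)"
  have n: "\<kappa> i \<le> n" if "i \<in> I" for i unfolding n_def using I(1) that by (intro member_le_sum) auto
  define P where "P i = {v \<in> words m (\<kappa> i). \<bar>pt v - c i\<bar> \<le> (1 + D) * \<rho> ^ \<kappa> i}" for i
  have cardP: "card (P i) \<le> C" for i unfolding C_def by (rule card_near) (auto simp: P_def)
  obtain x0 where x0: "x0 \<in> E" using E_nonempty by auto
  have "words m n \<subseteq> (\<Union>i\<in>I. {w \<in> words m n. take (\<kappa> i) w \<in> P i})"
  proof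
    fix w assume w: "w \<in> words m n"
    obtain i where i: "i \<in> I" "\<rho> ^ n * x0 + pt w \<in> ball (c i) (r i)"
      using I(2) address_mem[OF x0 w] by blast
    define v u where "v = take (\<kappa> i) w" and "u = drop (\<kappa> i) w"
    have vu: "v \<in> words m (\<kappa> i)" "u \<in> words m (n - \<kappa> i)" "w = v @ u" "length v = \<kappa> i"
      using words_take[OF w n[OF i(1)]] words_drop[of w m "\<kappa> i" "n - \<kappa> i"] w n[OF i(1)]
      by (auto simp: v_def u_def words_def)
    define y where "y = \<rho> ^ (n - \<kappa> i) * x0 + pt u"
    have y: "\<bar>y\<bar> \<le> D" unfolding y_def by (rule E_le_D[OF address_mem[OF x0 vu(2)]])
    have "\<rho> ^ n = \<rho> ^ \<kappa> i * \<rho> ^ (n - \<kappa> i)" using n[OF i(1)] by (simp flip: power_add)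
    then have "\<rho> ^ n * x0 + pt w = \<rho> ^ \<kappa> i * y + pt v"
      by (simp add: y_def vu(3,4) addr_append algebra_simps)
    then have "\<bar>\<rho> ^ \<kappa> i * y + pt v - c i\<bar> < \<rho> ^ \<kappa> i"
      using i(2) \<kappa>(2)[of i] by (simp add: dist_real_def)
    moreover have "\<bar>\<rho> ^ \<kappa> i * y\<bar> \<le> \<rho> ^ \<kappa> i * D" using y rho_pos by (simp add: abs_mult)
    ultimately have "\<bar>pt v - c i\<bar> \<le> \<rho> ^ \<kappa> i + \<rho> ^ \<kappa> i * D" by linarith
    then have "v \<in> P i" using vu(1) by (simp add: P_def algebra_simps)
    then show "w \<in> (\<Union>i\<in>I. {w \<in> words m n. take (\<kappa> i) w \<in> P i})" using w i(1) by (auto simp: v_def)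
  qed
  then have "card (words m n) \<le> card (\<Union>i\<in>I. {w \<in> words m n. take (\<kappa> i) w \<in> P i})"
    using I(1) by (intro card_mono) auto
  also have "\<dots> \<le> (\<Sum>i\<in>I. card {w \<in> words m n. take (\<kappa> i) w \<in> P i})"
    using I(1) by (rule card_UN_le)
  also have "\<dots> \<le> (\<Sum>i\<in>I. C * m ^ (n - \<kappa> i))"
  proof (rule sum_mono)
    fix i assume "i \<in> I"
    then have "card {w \<in> words m n. take (\<kappa> i) w \<in> P i} \<le> card (P i) * m ^ (n - \<kappa> i)"
      using n by (intro card_words_prefix_le) (auto simp: P_def)
    also have "\<dots> \<le> C * m ^ (n - \<kappa> i)" using cardP by (intro mult_right_mono) auto
    finally show "card {w \<in> words m n. take (\<kappa> i) w \<in> P i} \<le> C * m ^ (n - \<kappa> i)" .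
  qed
  finally have "real (m ^ n) \<le> real (\<Sum>i\<in>I. C * m ^ (n - \<kappa> i))"
    unfolding card_words by (simp only: of_nat_le_iff)
  also have "\<dots> = (\<Sum>i\<in>I. real m ^ n * (real C * (1 / real m) ^ \<kappa> i))"
    unfolding of_nat_sum
  proof (rule sum.cong[OF refl])
    fix i assume "i \<in> I"
    then have "real m ^ n = real m ^ (n - \<kappa> i) * real m ^ \<kappa> i" using n by (simp flip: power_add)
    then show "real (C * m ^ (n - \<kappa> i)) = real m ^ n * (real C * (1 / real m) ^ \<kappa> i)"
      using m_ge_2 by (simp add: power_divide)
  qed
  also have "\<dots> = real m ^ n * (\<Sum>i\<in>I. real C * (1 / real m) ^ \<kappa> i)"
    by (simp only: sum_distrib_left)
  finally have "real m ^ n * 1 \<le> real m ^ n * (\<Sum>i\<in>I. real C * (1 / real m) ^ \<kappa> i)" by simp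
  then have "1 \<le> (\<Sum>i\<in>I. real C * (1 / real m) ^ \<kappa> i)"
    using m_ge_2 by (subst (asm) mult_le_cancel_left_pos) auto
  also have "\<dots> \<le> (\<Sum>i\<in>I. real C * (real m * r i powr s))"
  proof (intro sum_mono mult_left_mono)
    fix i
    have "\<rho> ^ \<kappa> i = real p * \<rho> ^ Suc (\<kappa> i)" using p_ge_2 by (simp add: rho_eq)
    also have "\<dots> \<le> real p * r i" using \<kappa>(1)[of i] by (intro mult_left_mono) auto
    finally have "(\<rho> ^ \<kappa> i) powr dm \<le> (real p * r i) powr dm"
      using dm_pos rho_pos by (intro powr_mono2) auto
    also have "\<dots> = real m * r i powr dm" by (simp add: powr_mult powr_dm)
    \<comment> \<open>A radius below 1 has a larger power for the smaller exponent
      \<open>s\<close>.\<close>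
    also have "\<dots> \<le> real m * r i powr s"
      using s r_pos[of i] r_less[of i] by (intro mult_left_mono powr_mono') auto
    finally show "(1 / real m) ^ \<kappa> i \<le> real m * r i powr s" by (simp only: rho_power_powr_dm)
  qed auto
  also have "\<dots> \<le> (\<Sum>i\<in>I. real C * (real m * (2 powr s * (d i powr s + \<eta> i powr s))))"
    by (intro sum_mono mult_left_mono r_powr) auto
  also have "\<dots> = real C * real m * 2 powr s * ((\<Sum>i\<in>I. d i powr s) + (\<Sum>i\<in>I. \<eta> i powr s))"
    by (simp add: sum_distrib_left sum.distrib algebra_simps)
  also have "\<dots> \<le> real C * real m * 2 powr s * (\<epsilon> + \<epsilon>)"
    using sum_d[OF I(1)] sum_eta[OF I(1)] by (intro mult_left_mono add_mono) auto
  also have "\<dots> = M * \<epsilon>" by (simp add: M_def)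
  also have "\<dots> = 1 / 2" using M by (simp add: \<epsilon>_def)
  finally show False by simp
qed

lemma dm_le_hausdorff_dim: "ereal dm \<le> hausdorff_dim E"
  unfolding hausdorff_dim_def
proof (rule Inf_greatest)
  fix x assume "x \<in> {ereal s |s. 0 < s \<and> hausdorff_outer s E = 0}"
  then obtain s where s: "x = ereal s" "0 < s" "hausdorff_outer s E = 0" by auto
  then have "\<not> s \<le> dm" using hausdorff_outer_nonzero by blast
  then show "ereal dm \<le> x" using s by simp
qed

text \<open>The cover by cylinders of level \<open>n\<close> has weight at most \<open>X n\<close>,
  a geometric sequence whose ratio \<open>m * \<rho> powr s\<close> is below 1.\<close>

lemma hausdorff_outer_eq_0:
  assumes s: "dm < s"
  shows "hausdorff_outer s E = 0"
proof -
  have s0: "0 < s" using s dm_pos by linarith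
  define X where "X n = (2 * D) powr s * (real m * \<rho> powr s) ^ n" for n
  have "real m * \<rho> powr s < 1"
  proof -
    have "real p powr dm < real p powr s" using s p_ge_2 by (intro powr_less_mono) auto
    then show ?thesis using p_ge_2 by (simp add: powr_dm rho_eq powr_divide)
  qed
  then have "(\<lambda>n. X n) \<longlonglongrightarrow> (2 * D) powr s * 0"
    unfolding X_def using rho_pos
    by (intro tendsto_mult tendsto_const LIMSEQ_realpow_zero) auto
  then have X: "X \<longlonglongrightarrow> 0" by simp
  have "hausdorff_premeasure s \<delta> E \<le> 0" if \<delta>: "\<delta> > 0" for \<delta>
  proof (rule ennreal_le_epsilon)
    fix e :: real assume e: "0 < e"
    have "eventually (\<lambda>n. X n < e) sequentially" using order_tendstoD(2)[OF X e] .
    moreover have "(\<lambda>n. 2 * D * \<rho> ^ n) \<longlonglongrightarrow> 2 * D * 0"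
      using rho_pos rho_less_1 by (intro tendsto_mult tendsto_const LIMSEQ_realpow_zero) auto
    then have "eventually (\<lambda>n. 2 * D * \<rho> ^ n < \<delta>) sequentially"
      using \<delta> by (simp add: order_tendsto_iff)
    ultimately have "eventually (\<lambda>n. X n < e \<and> 2 * D * \<rho> ^ n < \<delta>) sequentially"
      by (rule eventually_conj)
    then obtain n where n: "X n < e" "2 * D * \<rho> ^ n < \<delta>"
      using eventually_happens'[OF sequentially_bot] by blast
    obtain f where f: "bij_betw f {0..<m ^ n} (words m n)"
      using ex_bij_betw_nat_finite[of "words m n"] by (auto simp: card_words)
    \<comment> \<open>The finite cover is padded to a sequence by empty sets, whose weight is
      \<open>0 powr s = 0\<close>.\<close>
    define U where "U i = (if i < m ^ n then (\<lambda>x. \<rho> ^ n * x + pt (f i)) ` E else {})" for i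
    have dU: "diameter (U i) \<le> 2 * D * \<rho> ^ n" and bU: "bounded (U i)" for i
    proof -
      have "dist x y \<le> 2 * D * \<rho> ^ n" if xy: "x \<in> U i" "y \<in> U i" for x y
      proof -
        obtain x' y' where "x' \<in> E" "y' \<in> E" "x = \<rho> ^ n * x' + pt (f i)" "y = \<rho> ^ n * y' + pt (f i)"
          using xy by (auto simp: U_def split: if_splits)
        then have "dist x y = \<rho> ^ n * \<bar>x' - y'\<bar>" "\<bar>x' - y'\<bar> \<le> 2 * D"
          using rho_pos E_le_D[of x'] E_le_D[of y']
          by (auto simp: dist_real_def abs_mult simp flip: right_diff_distrib)
        then show ?thesis using rho_pos by (simp add: mult.commute mult_right_mono)
      qed
      then show "diameter (U i) \<le> 2 * D * \<rho> ^ n"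
        using D_ge_1 rho_pos by (intro diameter_le) (auto simp: dist_norm)
      have "compact (U i)"
        unfolding U_def by (auto intro!: compact_continuous_image continuous_intros E_compact)
      then show "bounded (U i)" by (rule compact_imp_bounded)
    qed
    have dU': "diameter (U i) \<le> \<delta>" for i using dU[of i] n(2) by linarith
    have "E \<subseteq> (\<Union>i. U i)"
    proof
      fix x assume "x \<in> E"
      then obtain w y where w: "w \<in> words m n" "y \<in> E" "x = \<rho> ^ n * y + pt w"
        using address_exists by blast
      then obtain i where "i < m ^ n" "f i = w"
        using bij_betw_imp_surj_on[OF f] by (metis atLeastLessThan_iff imageE)
      then show "x \<in> (\<Union>i. U i)" using w by (auto simp: U_def intro!: exI[of _ i])
    qed
    then have "hausdorff_premeasure s \<delta> E \<le> (\<Sum>i. ennreal (diameter (U i) powr s))"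
      unfolding hausdorff_premeasure_def using dU' bU by (intro INF_lower) auto
    also have "\<dots> = (\<Sum>i<m ^ n. ennreal (diameter (U i) powr s))"
      by (rule suminf_finite) (auto simp: U_def)
    also have "\<dots> \<le> (\<Sum>i<m ^ n. ennreal ((2 * D * \<rho> ^ n) powr s))"
      using dU bU s0 by (intro sum_mono ennreal_leI powr_mono2) (auto intro: diameter_ge_0)
    also have "\<dots> = ennreal (X n)"
    proof -
      have "(\<rho> ^ n) powr s = (\<rho> powr s) ^ n"
        using rho_pos by (simp add: powr_power powr_realpow[symmetric] powr_powr mult.commute)
      then have "real (m ^ n) * (2 * D * \<rho> ^ n) powr s = X n"
        by (simp add: X_def powr_mult power_mult_distrib)
      then show ?thesis
        by (simp add: ennreal_of_nat_eq_real_of_nat flip: ennreal_mult')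
    qed
    also have "\<dots> \<le> ennreal e" using n(1) by (intro ennreal_leI) simp
    finally show "hausdorff_premeasure s \<delta> E \<le> 0 + ennreal e" by simp
  qed
  then have "hausdorff_outer s E \<le> 0" unfolding hausdorff_outer_def by (intro SUP_least) auto
  then show ?thesis by simp
qed

lemma hausdorff_dim_le_dm: "hausdorff_dim E \<le> ereal dm"
proof (rule ereal_le_epsilon2)
  fix e :: real assume "0 < e"
  then show "hausdorff_dim E \<le> ereal dm + ereal e"
    unfolding hausdorff_dim_def using dm_pos hausdorff_outer_eq_0[of "dm + e"]
    by (intro Inf_lower) (auto intro!: exI[of _ "dm + e"])
qed

lemma hausdorff_dim_eq: "hausdorff_dim E = ereal dm"
  using dm_le_hausdorff_dim hausdorff_dim_le_dm by (rule order_antisym[rotated])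

section \<open>Upper Minkowski dimension of subsets of \<open>E\<close>\<close>

lemma dm_le_upper_minkowski_dim:
  assumes c: "c > 0" and sub: "(\<lambda>x. c * x + b) ` E \<subseteq> B" "B \<subseteq> E"
  shows "ereal dm \<le> upper_minkowski_dim B"
proof -
  define C where "C = near (1 / c + D)"
  have C: "C \<ge> 1" by (simp add: C_def near_def)
  have bdB: "bounded B" using compact_imp_bounded[OF E_compact] sub(2) by (rule bounded_subset)
  obtain x0 where x0: "x0 \<in> E" using E_nonempty by auto
  \<comment> \<open>Choose one point in each cylinder of level \<open>n\<close>. An interval of
    length \<open>\<rho> ^ n\<close> contains the images of boundedly many of them, so the copy
    inside \<open>B\<close> alone needs about \<open>m ^ n\<close> intervals.\<close>
  have cov: "m ^ n \<le> C * covering_number (\<rho> ^ n) B" for n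
  proof -
    have r: "0 < \<rho> ^ n" using rho_pos by simp
    obtain T where T: "finite T" "card T = covering_number (\<rho> ^ n) B" "B \<subseteq> (\<Union>t\<in>T. {t..t + \<rho> ^ n})"
      using covering_number_attained[OF bdB r] by blast
    have "\<exists>t\<in>T. c * (\<rho> ^ n * x0 + pt u) + b \<in> {t..t + \<rho> ^ n}" if "u \<in> words m n" for u
      using T(3) sub(1) address_mem[OF x0 that] by blast
    then obtain F where F: "\<And>u. u \<in> words m n \<Longrightarrow> F u \<in> T"
      "\<And>u. u \<in> words m n \<Longrightarrow> c * (\<rho> ^ n * x0 + pt u) + b \<in> {F u..F u + \<rho> ^ n}"
      by metis
    have "card (words m n) \<le> C * card T"
    proof (rule card_le_fibres)
      fix t
      show "card {u \<in> words m n. F u = t} \<le> C"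
        unfolding C_def
      proof (rule card_near[where c = "(t - b) / c" and n = n])
        fix u assume u: "u \<in> {u \<in> words m n. F u = t}"
        define h where "h = c * (\<rho> ^ n * x0 + pt u) + b - t"
        have h: "0 \<le> h" "h \<le> \<rho> ^ n" using F(2)[of u] u by (auto simp: h_def)
        have "c * ((t - b) / c) = t - b" "c * (h / c) = h" using c by simp_all
        then have "c * (pt u - (t - b) / c) = c * (h / c - \<rho> ^ n * x0)"
          unfolding right_diff_distrib by (simp add: h_def algebra_simps)
        then have "pt u - (t - b) / c = h / c - \<rho> ^ n * x0" using c by simp
        moreover have "\<bar>h / c\<bar> \<le> \<rho> ^ n / c" using h c by (simp add: divide_right_mono)
        moreover have "\<bar>\<rho> ^ n * x0\<bar> \<le> \<rho> ^ n * D" using E_le_D[OF x0] r by (simp add: abs_mult)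
        ultimately have "\<bar>pt u - (t - b) / c\<bar> \<le> \<rho> ^ n / c + \<rho> ^ n * D" by linarith
        then show "u \<in> words m n \<and> \<bar>pt u - (t - b) / c\<bar> \<le> (1 / c + D) * \<rho> ^ n"
          using u by (simp add: algebra_simps)
      qed
    qed (use T F in auto)
    then show ?thesis using T by (simp add: card_words)
  qed
  define f where "f = (\<lambda>\<delta>. ereal (ln (real (covering_number \<delta> B)) / (- ln \<delta>)))"
  define g where "g n = dm - ln (real C) / (real n * ln (real p))" for n
  have fg: "ereal (g n) \<le> f (\<rho> ^ n)" if n: "n \<ge> 1" for n
  proof -
    let ?N = "covering_number (\<rho> ^ n) B"
    have "0 < m ^ n" using m_ge_2 by simp
    with cov[of n] have N: "?N \<ge> 1" by (cases ?N) auto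
    have "real (m ^ n) \<le> real (C * ?N)" using cov[of n] by (simp only: of_nat_le_iff)
    then have "ln (real m ^ n) \<le> ln (real C * real ?N)" using m_ge_2 by (intro ln_mono) auto
    then have le: "n * ln (real m) - ln (real C) \<le> ln (real ?N)"
      using m_ge_2 C N by (simp add: ln_realpow ln_mult)
    have ln: "- ln (\<rho> ^ n) = n * ln (real p)"
      using rho_pos p_ge_2 by (simp add: ln_realpow rho_eq ln_div)
    have "g n = (n * ln (real m) - ln (real C)) / (n * ln (real p))"
      using n ln_p_pos by (simp add: g_def dm_def diff_divide_distrib)
    also have "\<dots> \<le> ln (real ?N) / (n * ln (real p))"
      using le n ln_p_pos by (intro divide_right_mono) auto
    finally show ?thesis by (simp only: f_def ln ereal_less_eq)
  qed
  have "g \<longlonglongrightarrow> dm - 0"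
    unfolding g_def
  proof (intro tendsto_intros)
    have "(\<lambda>n. ln (real C) / ln (real p) * (1 / real n)) \<longlonglongrightarrow> ln (real C) / ln (real p) * 0"
      by (intro tendsto_intros lim_1_over_n)
    then show "(\<lambda>n. ln (real C) / (real n * ln (real p))) \<longlonglongrightarrow> 0" by (simp add: mult.commute)
  qed
  then have g: "(\<lambda>n. ereal (g n)) \<longlonglongrightarrow> ereal dm" by simp
  \<comment> \<open>For a lower bound on the upper limit the scales \<open>\<rho> ^ n\<close>
    suffice.\<close>
  have "filterlim (\<lambda>n. \<rho> ^ n) (at_right 0) sequentially"
    unfolding filterlim_at using rho_pos rho_less_1
    by (auto intro!: LIMSEQ_realpow_zero always_eventually)
  note lim = this
  have "ereal dm \<le> Limsup (at_right 0) f"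
  proof (rule ccontr)
    assume "\<not> ?thesis"
    then obtain y where y: "Limsup (at_right 0) f < y" "y < ereal dm"
      using dense[of "Limsup (at_right 0) f" "ereal dm"] by (auto simp: not_le)
    have "\<forall>\<^sub>F x in at_right 0. f x < y" using y(1) by (rule Limsup_lessD)
    then have "\<forall>\<^sub>F n in sequentially. f (\<rho> ^ n) < y" using lim by (rule eventually_compose_filterlim)
    moreover have "\<forall>\<^sub>F n in sequentially. y < ereal (g n)" using order_tendstoD(1)[OF g y(2)] .
    moreover have "\<forall>\<^sub>F n in sequentially. ereal (g n) \<le> f (\<rho> ^ n)"
      using fg eventually_sequentially by blast
    ultimately have "\<forall>\<^sub>F n::nat in sequentially. False"
      by eventually_elim (metis less_asym less_le_trans)
    then show False by simp
  qed
  moreover have "B \<noteq> {}" using sub(1) x0 by auto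
  ultimately show ?thesis by (simp add: upper_minkowski_dim_def f_def)
qed

text \<open>Only \<open>(m ^ n - 1) ^ k\<close> cylinders of level \<open>n * k\<close> are needed
  to cover \<open>A\<close>, and their growth exponent \<open>s0\<close> is strictly below
  \<open>dm\<close>.\<close>

lemma not_full_imp_upper_minkowski_dim_less:
  assumes A: "A \<subseteq> E" and nf: "\<not> full A"
  shows "upper_minkowski_dim A < ereal dm"
proof (cases "A = {}")
  case True
  then show ?thesis using dm_pos by (simp add: upper_minkowski_dim_def)
next
  case False
  obtain n where n: "n \<ge> 1" and cnt: "\<And>k. card (hits (n * k) A) \<le> (m ^ n - 1) ^ k"
    using not_full_card_hits[OF nf] by blast
  define q where "q = m ^ n - 1"
  have "m ^ 1 \<le> m ^ n" using m_ge_2 n by (intro power_increasing) auto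
  then have q: "q \<ge> 1" "q < m ^ n" using m_ge_2 by (auto simp: q_def)
  define N where "N = real n * ln (real p)"
  have N: "N > 0" using n ln_p_pos by (simp add: N_def)
  define s0 where "s0 = ln (real q) / N"
  have lnq: "0 \<le> ln (real q)" using q by simp
  have "ln (real q) < ln (real (m ^ n))" using q m_ge_2 by (subst ln_less_cancel_iff) auto
  then have "ln (real q) < n * ln (real m)" using m_ge_2 by (simp add: ln_realpow)
  then have s0: "s0 < dm" using N ln_p_pos n by (simp add: s0_def N_def dm_def field_simps)
  then obtain s1 where s1: "s0 < s1" "s1 < dm" using dense by blast
  \<comment> \<open>The bounded error caused by the factor \<open>2 * D\<close> in the interval
    lengths and by rounding \<open>k\<close> up; once \<open>- ln \<delta>\<close> exceeds
    \<open>M\<close>, the gap between \<open>s0\<close> and \<open>s1\<close> absorbs it.\<close>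
  define K where "K = ln (real q) * (1 + ln (2 * D) / N)"
  define M where "M = max 1 (K / (s1 - s0))"
  have le: "ereal (ln (real (covering_number \<delta> A)) / (- ln \<delta>)) \<le> ereal s1"
    if \<delta>: "0 < \<delta>" "\<delta> < exp (- M)" for \<delta>
  proof -
    define l where "l = - ln \<delta>"
    have "ln \<delta> < - M" using \<delta> by (metis exp_less_cancel_iff exp_ln)
    then have l: "l > M" by (simp add: l_def)
    then have l1: "l > 0" by (simp add: M_def)
    have "K / (s1 - s0) \<le> l" using l by (simp add: M_def)
    then have Kl: "K \<le> (s1 - s0) * l" using s1 by (simp add: divide_le_eq mult.commute)
    define k where "k = nat \<lceil>(l + ln (2 * D)) / N\<rceil>"
    have D2: "0 < ln (2 * D)" using D_ge_1 by simp
    have nn: "0 \<le> (l + ln (2 * D)) / N" using l1 D2 N by simp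
    have k: "(l + ln (2 * D)) / N \<le> k" "k \<le> (l + ln (2 * D)) / N + 1"
      using nn unfolding k_def by linarith+
    have small: "2 * D * \<rho> ^ (n * k) \<le> \<delta>"
    proof -
      have "l + ln (2 * D) \<le> k * N" using k(1) N by (simp add: divide_le_eq)
      moreover have "ln (2 * D * \<rho> ^ (n * k)) = ln (2 * D) - k * N"
        using D_ge_1 rho_pos p_ge_2
        by (simp add: ln_mult ln_realpow rho_eq ln_div N_def)
      ultimately have "ln (2 * D * \<rho> ^ (n * k)) \<le> ln \<delta>" by (simp add: l_def)
      then show ?thesis using D_ge_1 rho_pos \<delta> by (subst (asm) ln_le_cancel_iff) auto
    qed
    define T where "T = (\<lambda>w. pt w - D * \<rho> ^ (n * k)) ` hits (n * k) A"
    have "A \<subseteq> (\<Union>t\<in>T. {t..t + \<delta>})"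
    proof
      fix x assume x: "x \<in> A"
      then obtain w y where w: "w \<in> words m (n * k)" "y \<in> E" "x = \<rho> ^ (n * k) * y + pt w"
        using A address_exists by blast
      have "\<bar>\<rho> ^ (n * k) * y\<bar> \<le> \<rho> ^ (n * k) * D" using E_le_D[OF w(2)] rho_pos by (simp add: abs_mult)
      then have "x \<in> {(pt w - D * \<rho> ^ (n * k))..(pt w - D * \<rho> ^ (n * k)) + \<delta>}"
        using small w(3) by (simp add: abs_le_iff algebra_simps)
      moreover have "w \<in> hits (n * k) A" using w x by (auto simp: hits_def)
      ultimately show "x \<in> (\<Union>t\<in>T. {t..t + \<delta>})" by (auto simp: T_def)
    qed
    then have "covering_number \<delta> A \<le> card T" by (intro covering_number_le) (auto simp: T_def)
    also have "\<dots> \<le> card (hits (n * k) A)" unfolding T_def by (intro card_image_le) simp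
    also have "\<dots> \<le> q ^ k" using cnt by (simp add: q_def)
    finally have cq: "covering_number \<delta> A \<le> q ^ k" .
    have "ln (real (covering_number \<delta> A)) \<le> k * ln (real q)"
    proof (cases "covering_number \<delta> A = 0")
      case True
      then show ?thesis using lnq by simp
    next
      case False
      have "real (covering_number \<delta> A) \<le> real q ^ k" using cq by (metis of_nat_le_iff of_nat_power)
      then have "ln (real (covering_number \<delta> A)) \<le> ln (real q ^ k)" using False by (intro ln_mono) auto
      then show ?thesis using q by (simp add: ln_realpow)
    qed
    also have "\<dots> \<le> ((l + ln (2 * D)) / N + 1) * ln (real q)"
      using k(2) lnq by (intro mult_right_mono) auto
    also have "\<dots> = s0 * l + K" using N by (simp add: s0_def K_def field_simps)
    also have "\<dots> \<le> s1 * l" using Kl by (simp add: algebra_simps)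
    finally have "ln (real (covering_number \<delta> A)) / l \<le> s1" using pos_divide_le_eq[OF l1] by blast
    then show ?thesis by (simp add: l_def)
  qed
  have "\<forall>\<^sub>F \<delta> in at_right 0. \<delta> \<in> {0<..<exp (- M)}" by (rule eventually_at_right_real) simp
  then have "\<forall>\<^sub>F \<delta> in at_right 0. ereal (ln (real (covering_number \<delta> A)) / (- ln \<delta>)) \<le> ereal s1"
    by (rule eventually_mono) (use le in auto)
  then have "Limsup (at_right 0) (\<lambda>\<delta>. ereal (ln (real (covering_number \<delta> A)) / (- ln \<delta>))) \<le> ereal s1"
    by (rule Limsup_bounded)
  also have "ereal s1 < ereal dm" using s1 by simp
  finally show ?thesis using False by (simp add: upper_minkowski_dim_def)
qed

end

section \<open>Fourier coefficients of integer digit systems\<close>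

text \<open>The additive character of period 1, so that integers in the argument disappear.\<close>

definition ee :: "real \<Rightarrow> complex" where "ee x = cis (2 * pi * x)"

lemma ee_add: "ee (x + y) = ee x * ee y"
  by (simp add: ee_def cis_mult distrib_left)

lemma ee_0 [simp]: "ee 0 = 1"
  by (simp add: ee_def)

lemma norm_ee [simp]: "norm (ee x) = 1"
  by (simp add: ee_def)

lemma cnj_ee: "cnj (ee x) = ee (- x)"
  by (simp add: ee_def cis_cnj)

lemma ee_Ints: "x \<in> \<int> \<Longrightarrow> ee x = 1"
  unfolding ee_def by (rule cis_multiple_2pi)

lemma ee_add_Ints: "y \<in> \<int> \<Longrightarrow> ee (x + y) = ee x"
  by (simp add: ee_add ee_Ints)

lemma norm_ee_diff_le: "norm (ee x - ee y) \<le> 2 * pi * \<bar>x - y\<bar>"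
proof -
  have "ee x - ee y = ee y * (ee (x - y) - 1)"
    by (simp add: right_diff_distrib flip: ee_add)
  then have "norm (ee x - ee y) = norm (ee (x - y) - 1)" by (simp add: norm_mult)
  also have "\<dots> = norm (exp (\<i> * of_real (2 * pi * (x - y))) - 1)"
    by (simp add: ee_def cis_conv_exp)
  also have "\<dots> = 2 * \<bar>sin (2 * pi * (x - y) / 2)\<bar>" by (rule dist_exp_i_1)
  also have "\<dots> \<le> 2 * \<bar>2 * pi * (x - y) / 2\<bar>"
    by (intro mult_left_mono abs_sin_x_le_abs_x) auto
  finally show ?thesis by (simp add: abs_mult)
qed

text \<open>The summands belonging to different blocks of letters are independent.\<close>

lemma second_moment:
  fixes f :: "nat list \<Rightarrow> complex"
  assumes mean: "(\<Sum>y\<in>words m G. f y) = 0" and f: "\<And>y. y \<in> words m G \<Longrightarrow> norm (f y) \<le> 2"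
    and d: "\<And>l. norm (d l) \<le> 1"
  shows "(\<Sum>w\<in>words m (s + N * G + E). (norm (\<Sum>l<N. d l * f (take G (drop (s + l * G) w))))\<^sup>2)
    \<le> 4 * real N * real m ^ (s + N * G + E)"
proof -
  define T where "T N w = (\<Sum>l<N. d l * f (take G (drop (s + l * G) w)))" for N w
  have T_append: "T N (x @ y) = T N x" if "length x = s + N * G" for N x y
    unfolding T_def
  proof (rule sum.cong[OF refl])
    fix l assume "l \<in> {..<N}"
    then have "Suc l * G \<le> N * G" by (intro mult_le_mono1) auto
    then have le: "s + l * G + G \<le> length x" using that by simp
    then show "d l * f (take G (drop (s + l * G) (x @ y))) = d l * f (take G (drop (s + l * G) x))"
      by simp
  qed
  have main: "(\<Sum>w\<in>words m (s + N * G). (norm (T N w))\<^sup>2) \<le> 4 * real N * real m ^ (s + N * G)" for N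
  proof (induction N)
    case 0
    then show ?case by (simp add: T_def)
  next
    case (Suc N)
    let ?k = "s + N * G"
    have step: "T (Suc N) (x @ y) = T N x + d N * f y" if "x \<in> words m ?k" "y \<in> words m G" for x y
    proof -
      have len: "length x = ?k" "length y = G" using that by (auto simp: words_def)
      have "T (Suc N) (x @ y) = T N (x @ y) + d N * f (take G (drop ?k (x @ y)))"
        by (simp add: T_def)
      then show ?thesis using T_append len by simp
    qed
    \<comment> \<open>Averaging over the last block kills the cross term because \<open>f\<close>
      has mean 0; the 4 bounds the squared modulus of \<open>d N * f y\<close>.\<close>
    have inner: "(\<Sum>y\<in>words m G. (norm (T (Suc N) (x @ y)))\<^sup>2)
        \<le> real m ^ G * (norm (T N x))\<^sup>2 + 4 * real m ^ G" if x: "x \<in> words m ?k" for x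
    proof -
      have "(norm (T (Suc N) (x @ y)))\<^sup>2 \<le> (norm (T N x))\<^sup>2 + 4 + 2 * Re (cnj (T N x) * d N * f y)"
        if y: "y \<in> words m G" for y
      proof -
        have "(norm (a + b))\<^sup>2 = (norm a)\<^sup>2 + (norm b)\<^sup>2 + 2 * Re (cnj a * b)" for a b :: complex
          unfolding cmod_power2 by (simp add: power2_eq_square algebra_simps)
        then have "(norm (T (Suc N) (x @ y)))\<^sup>2 =
            (norm (T N x))\<^sup>2 + (norm (d N * f y))\<^sup>2 + 2 * Re (cnj (T N x) * (d N * f y))"
          using step[OF x y] by simp
        moreover have "norm (d N * f y) \<le> 1 * 2"
          unfolding norm_mult using d f[OF y] by (intro mult_mono) auto
        then have "(norm (d N * f y))\<^sup>2 \<le> 2\<^sup>2" by (intro power_mono) auto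
        ultimately show ?thesis by (simp add: mult.assoc)
      qed
      then have "(\<Sum>y\<in>words m G. (norm (T (Suc N) (x @ y)))\<^sup>2)
          \<le> (\<Sum>y\<in>words m G. (norm (T N x))\<^sup>2 + 4 + 2 * Re (cnj (T N x) * d N * f y))"
        by (rule sum_mono)
      also have "\<dots> = real m ^ G * ((norm (T N x))\<^sup>2 + 4) + 2 * Re (\<Sum>y\<in>words m G. cnj (T N x) * d N * f y)"
        by (simp add: sum.distrib card_words sum_distrib_left)
      also have "(\<Sum>y\<in>words m G. cnj (T N x) * d N * f y) = 0"
        using mean by (simp flip: sum_distrib_left)
      finally show ?thesis by (simp add: algebra_simps)
    qed
    have "s + Suc N * G = ?k + G" by simp
    then have "(\<Sum>w\<in>words m (s + Suc N * G). (norm (T (Suc N) w))\<^sup>2)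
        = (\<Sum>x\<in>words m ?k. \<Sum>y\<in>words m G. (norm (T (Suc N) (x @ y)))\<^sup>2)"
      by (simp only: sum_words_append)
    also have "\<dots> \<le> (\<Sum>x\<in>words m ?k. real m ^ G * (norm (T N x))\<^sup>2 + 4 * real m ^ G)"
      by (intro sum_mono inner)
    also have "\<dots> = real m ^ G * (\<Sum>x\<in>words m ?k. (norm (T N x))\<^sup>2) + 4 * real m ^ G * real m ^ ?k"
      by (simp add: sum.distrib card_words sum_distrib_left)
    also have "\<dots> \<le> real m ^ G * (4 * real N * real m ^ ?k) + 4 * real m ^ G * real m ^ ?k"
      using Suc.IH by (intro add_mono mult_left_mono) auto
    also have "\<dots> = 4 * real (Suc N) * real m ^ (s + Suc N * G)"
      by (simp add: power_add algebra_simps)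
    finally show ?case .
  qed
  have "(\<Sum>w\<in>words m (s + N * G + E). (norm (T N w))\<^sup>2)
      = (\<Sum>x\<in>words m (s + N * G). \<Sum>y\<in>words m E. (norm (T N (x @ y)))\<^sup>2)"
    by (simp only: sum_words_append)
  also have "\<dots> = (\<Sum>x\<in>words m (s + N * G). \<Sum>y\<in>words m E. (norm (T N x))\<^sup>2)"
    by (intro sum.cong refl) (simp add: T_append length_words)
  also have "\<dots> = real m ^ E * (\<Sum>x\<in>words m (s + N * G). (norm (T N x))\<^sup>2)"
    by (simp add: card_words sum_distrib_left)
  also have "\<dots> \<le> real m ^ E * (4 * real N * real m ^ (s + N * G))"
    by (intro mult_left_mono main) auto
  finally show ?thesis by (simp add: T_def power_add algebra_simps)
qed

section \<open>The law of the random integer digit expansion and its Fourier transform\<close>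

locale integer_digits =
  fixes m p :: nat and \<rho> :: real and b :: "nat \<Rightarrow> int" and Bd :: real
  assumes m_pos: "m \<ge> 1" and p_ge_2: "p \<ge> 2" and rho_eq: "\<rho> = 1 / real p"
    and Bd: "\<And>i. i \<in> {1..m} \<Longrightarrow> \<bar>real_of_int (b i)\<bar> \<le> Bd" and Bd_pos: "Bd > 0"
begin

lemma rho_pos: "0 < \<rho>" and rho_less_1: "\<rho> < 1" and rho_le_half: "\<rho> \<le> 1 / 2"
  using p_ge_2 by (auto simp: rho_eq field_simps)

abbreviation B :: "nat list \<Rightarrow> real" where "B w \<equiv> addr \<rho> (\<lambda>i. real_of_int (b i)) w"

text \<open>\<open>Qinf\<close> below is, in the variable \<open>\<xi> * \<rho>\<close>, the Fourier transform of the law of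
  \<open>\<Sum>k. b (i k) * \<rho> ^ k\<close> for independent uniform letters \<open>i k\<close>.\<close>

definition P :: "real \<Rightarrow> complex" where "P \<xi> = (\<Sum>i\<in>{1..m}. ee (real_of_int (b i) * \<xi>)) / of_nat m"

definition Q :: "nat \<Rightarrow> real \<Rightarrow> complex" where "Q n \<xi> = (\<Prod>k<n. P (\<xi> * \<rho> ^ Suc k))"

text \<open>A Lipschitz constant for \<open>P\<close>, and also for \<open>Qinf\<close> because the
  scales \<open>\<rho> ^ Suc k\<close> add up to at most 1.\<close>

definition K :: real where "K = 2 * pi * Bd"

lemma K_pos: "K > 0" using Bd_pos by (simp add: K_def)

lemma norm_P_le: "norm (P \<xi>) \<le> 1"
proof -
  have "norm (\<Sum>i\<in>{1..m}. ee (real_of_int (b i) * \<xi>)) \<le> (\<Sum>i\<in>{1..m}. 1)" by (rule sum_norm_le) simp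
  then show ?thesis using m_pos by (simp add: P_def norm_divide)
qed

lemma P_0: "P 0 = 1" using m_pos by (simp add: P_def)

lemma P_add_Ints: "k \<in> \<int> \<Longrightarrow> P (\<xi> + k) = P \<xi>"
  unfolding P_def by (simp add: distrib_left ee_add_Ints)

lemma norm_P_diff_le: "norm (P \<xi> - P \<zeta>) \<le> K * \<bar>\<xi> - \<zeta>\<bar>"
proof -
  have "norm (\<Sum>i\<in>{1..m}. ee (real_of_int (b i) * \<xi>) - ee (real_of_int (b i) * \<zeta>)) \<le> (\<Sum>i\<in>{1..m}. K * \<bar>\<xi> - \<zeta>\<bar>)"
  proof (rule sum_norm_le)
    fix i assume i: "i \<in> {1..m}"
    have "norm (ee (real_of_int (b i) * \<xi>) - ee (real_of_int (b i) * \<zeta>)) \<le> 2 * pi * \<bar>real_of_int (b i) * \<xi> - real_of_int (b i) * \<zeta>\<bar>"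
      by (rule norm_ee_diff_le)
    also have "\<dots> = 2 * pi * (\<bar>real_of_int (b i)\<bar> * \<bar>\<xi> - \<zeta>\<bar>)"
      by (simp flip: right_diff_distrib abs_mult)
    also have "\<dots> \<le> 2 * pi * (Bd * \<bar>\<xi> - \<zeta>\<bar>)"
      using Bd[OF i] by (intro mult_left_mono mult_right_mono) auto
    finally show "norm (ee (real_of_int (b i) * \<xi>) - ee (real_of_int (b i) * \<zeta>)) \<le> K * \<bar>\<xi> - \<zeta>\<bar>" by (simp add: K_def)
  qed
  also have "\<dots> = real m * (K * \<bar>\<xi> - \<zeta>\<bar>)" by simp
  finally have "norm (\<Sum>i\<in>{1..m}. ee (real_of_int (b i) * \<xi>) - ee (real_of_int (b i) * \<zeta>)) / real m \<le> K * \<bar>\<xi> - \<zeta>\<bar>"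
    using m_pos by (simp add: divide_le_eq mult.commute)
  moreover have "P \<xi> - P \<zeta> = (\<Sum>i\<in>{1..m}. ee (real_of_int (b i) * \<xi>) - ee (real_of_int (b i) * \<zeta>)) / of_nat m"
    by (simp add: P_def sum_subtractf diff_divide_distrib)
  ultimately show ?thesis by (simp add: norm_divide)
qed

lemma sum_ee_words:
  "(\<Sum>w\<in>words m n. ee (\<xi> * B w)) = of_nat m ^ n * (\<Prod>k<n. P (\<xi> * \<rho> ^ k))"
proof (induction n arbitrary: \<xi>)
  case 0
  then show ?case by simp
next
  case (Suc n)
  have P: "(\<Sum>i\<in>{1..m}. ee (real_of_int (b i) * \<xi>)) = of_nat m * P \<xi>" using m_pos by (simp add: P_def)
  have "(\<Sum>w\<in>words m (Suc n). ee (\<xi> * B w)) = (\<Sum>i\<in>{1..m}. \<Sum>w\<in>words m n. ee (real_of_int (b i) * \<xi>) * ee (\<xi> * \<rho> * B w))"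
    unfolding sum_words_Suc by (simp add: algebra_simps flip: ee_add)
  also have "\<dots> = (\<Sum>i\<in>{1..m}. ee (real_of_int (b i) * \<xi>)) * (\<Sum>w\<in>words m n. ee (\<xi> * \<rho> * B w))"
    by (simp add: sum_product)
  also have "\<dots> = of_nat m * P \<xi> * (of_nat m ^ n * (\<Prod>k<n. P (\<xi> * \<rho> * \<rho> ^ k)))"
    by (simp only: P Suc.IH)
  also have "\<dots> = of_nat m ^ Suc n * (\<Prod>k<Suc n. P (\<xi> * \<rho> ^ k))"
    by (subst prod.lessThan_Suc_shift) (simp add: mult.assoc mult.left_commute)
  finally show ?case .
qed

lemma sum_ee_words_Q: "(\<Sum>w\<in>words m n. ee (\<xi> * \<rho> * B w)) = of_nat m ^ n * Q n \<xi>"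
  using sum_ee_words[of "\<xi> * \<rho>" n] by (simp add: Q_def mult.assoc)

lemma Q_Suc: "Q (Suc n) \<xi> = Q n \<xi> * P (\<xi> * \<rho> ^ Suc n)"
  by (simp add: Q_def)

lemma norm_Q_le: "norm (Q n \<xi>) \<le> 1"
  unfolding Q_def prod_norm[symmetric] by (intro prod_le_1) (auto simp: norm_P_le)

lemma norm_Q_Suc_diff: "norm (Q (Suc n) \<xi> - Q n \<xi>) \<le> K * \<bar>\<xi>\<bar> * \<rho> ^ Suc n"
proof -
  have "Q (Suc n) \<xi> - Q n \<xi> = Q n \<xi> * (P (\<xi> * \<rho> ^ Suc n) - P 0)"
    by (simp add: Q_def P_0 right_diff_distrib)
  then have "norm (Q (Suc n) \<xi> - Q n \<xi>) = norm (Q n \<xi>) * norm (P (\<xi> * \<rho> ^ Suc n) - P 0)"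
    by (simp only: norm_mult)
  also have "\<dots> \<le> 1 * (K * \<bar>\<xi> * \<rho> ^ Suc n - 0\<bar>)"
    by (intro mult_mono norm_Q_le norm_P_diff_le) auto
  finally have "norm (Q (Suc n) \<xi> - Q n \<xi>) \<le> K * \<bar>\<xi> * \<rho> ^ Suc n\<bar>" by simp
  then show ?thesis using rho_pos by (simp add: abs_mult mult.assoc)
qed

text \<open>Telescoping. The bound is a difference because \<open>\<rho> \<le> 1 / 2\<close> gives
  \<open>\<rho> ^ Suc j \<le> \<rho> ^ j - \<rho> ^ Suc j\<close>, which closes the induction
  without summing a series.\<close>

lemma norm_Q_diff: "norm (Q (n + k) \<xi> - Q n \<xi>) \<le> K * \<bar>\<xi>\<bar> * (\<rho> ^ n - \<rho> ^ (n + k))"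
proof (induction k)
  case 0
  then show ?case by simp
next
  case (Suc k)
  have "norm (Q (n + Suc k) \<xi> - Q n \<xi>)
      \<le> norm (Q (Suc (n + k)) \<xi> - Q (n + k) \<xi>) + norm (Q (n + k) \<xi> - Q n \<xi>)"
    using norm_triangle_ineq[of "Q (Suc (n + k)) \<xi> - Q (n + k) \<xi>" "Q (n + k) \<xi> - Q n \<xi>"] by simp
  also have "\<dots> \<le> K * \<bar>\<xi>\<bar> * \<rho> ^ Suc (n + k) + K * \<bar>\<xi>\<bar> * (\<rho> ^ n - \<rho> ^ (n + k))"
    by (intro add_mono norm_Q_Suc_diff Suc.IH)
  also have "\<dots> = K * \<bar>\<xi>\<bar> * (\<rho> ^ Suc (n + k) + (\<rho> ^ n - \<rho> ^ (n + k)))"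
    by (simp add: distrib_left)
  also have "\<dots> \<le> K * \<bar>\<xi>\<bar> * (\<rho> ^ n - \<rho> ^ (n + Suc k))"
  proof (intro mult_left_mono)
    have "\<rho> * \<rho> ^ (n + k) \<le> 1 / 2 * \<rho> ^ (n + k)"
      using rho_pos rho_le_half by (intro mult_right_mono) auto
    then show "\<rho> ^ Suc (n + k) + (\<rho> ^ n - \<rho> ^ (n + k)) \<le> \<rho> ^ n - \<rho> ^ (n + Suc k)" by simp
  qed (use K_pos in auto)
  finally show ?case .
qed

lemma rho_power_tendsto_0: "(\<lambda>n. c * \<rho> ^ n) \<longlonglongrightarrow> 0"
  by (rule tendsto_mult_right_zero, rule LIMSEQ_realpow_zero) (use rho_pos rho_less_1 in auto)

lemma convergent_Q: "convergent (\<lambda>n. Q n \<xi>)"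
proof (rule Cauchy_convergent, rule CauchyI')
  fix e :: real assume e: "0 < e"
  obtain n0 where n0: "K * \<bar>\<xi>\<bar> * \<rho> ^ n0 < e"
    using order_tendstoD(2)[OF rho_power_tendsto_0[of "K * \<bar>\<xi>\<bar>"] e] eventually_happens'[OF sequentially_bot] by blast
  have "norm (Q n \<xi> - Q k \<xi>) < e" if n: "n0 \<le> n" "n < k" for n k
  proof -
    obtain j where j: "k = n + j" using n(2) less_imp_add_positive by blast
    have "norm (Q k \<xi> - Q n \<xi>) \<le> K * \<bar>\<xi>\<bar> * (\<rho> ^ n - \<rho> ^ (n + j))" unfolding j by (rule norm_Q_diff)
    also have "\<dots> \<le> K * \<bar>\<xi>\<bar> * \<rho> ^ n0"
    proof (intro mult_left_mono)
      have "\<rho> ^ n \<le> \<rho> ^ n0" using n(1) rho_pos rho_less_1 by (intro power_decreasing) auto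
      then show "\<rho> ^ n - \<rho> ^ (n + j) \<le> \<rho> ^ n0" using zero_less_power[OF rho_pos, of "n + j"] by linarith
    qed (use K_pos in auto)
    finally show ?thesis using n0 by (simp add: norm_minus_commute)
  qed
  then show "\<exists>M. \<forall>n\<ge>M. \<forall>k>n. dist (Q n \<xi>) (Q k \<xi>) < e" unfolding dist_norm by blast
qed

definition Qinf :: "real \<Rightarrow> complex" where "Qinf \<xi> = lim (\<lambda>n. Q n \<xi>)"

lemma Q_tendsto: "(\<lambda>n. Q n \<xi>) \<longlonglongrightarrow> Qinf \<xi>"
  unfolding Qinf_def using convergent_Q by (simp add: convergent_LIMSEQ_iff)

lemma norm_Qinf_le: "norm (Qinf \<xi>) \<le> 1"
  by (rule LIMSEQ_le_const2[OF tendsto_norm[OF Q_tendsto]]) (use norm_Q_le in auto)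

lemma Qinf_0: "Qinf 0 = 1"
proof -
  have "(\<lambda>n. Q n 0) \<longlonglongrightarrow> 1" by (simp add: Q_def P_0)
  then show ?thesis using Q_tendsto LIMSEQ_unique by blast
qed

lemma norm_Qinf_diff: "norm (Qinf \<xi> - Qinf \<zeta>) \<le> K * \<bar>\<xi> - \<zeta>\<bar>"
proof (rule LIMSEQ_le_const2[OF tendsto_norm[OF tendsto_diff[OF Q_tendsto Q_tendsto]]], intro exI allI impI)
  fix n
  have "norm (Q n \<xi> - Q n \<zeta>) \<le> (\<Sum>k<n. norm (P (\<xi> * \<rho> ^ Suc k) - P (\<zeta> * \<rho> ^ Suc k)))"
    unfolding Q_def by (intro norm_prod_diff norm_P_le)
  also have "\<dots> \<le> (\<Sum>k<n. K * \<bar>\<xi> - \<zeta>\<bar> * \<rho> ^ Suc k)"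
  proof (rule sum_mono)
    fix k
    have "norm (P (\<xi> * \<rho> ^ Suc k) - P (\<zeta> * \<rho> ^ Suc k)) \<le> K * \<bar>\<xi> * \<rho> ^ Suc k - \<zeta> * \<rho> ^ Suc k\<bar>"
      by (rule norm_P_diff_le)
    also have "\<bar>\<xi> * \<rho> ^ Suc k - \<zeta> * \<rho> ^ Suc k\<bar> = \<bar>\<xi> - \<zeta>\<bar> * \<rho> ^ Suc k"
      using rho_pos by (simp only: abs_mult flip: left_diff_distrib) simp
    finally show "norm (P (\<xi> * \<rho> ^ Suc k) - P (\<zeta> * \<rho> ^ Suc k)) \<le> K * \<bar>\<xi> - \<zeta>\<bar> * \<rho> ^ Suc k"
      by (simp only: mult.assoc)
  qed
  also have "\<dots> = K * \<bar>\<xi> - \<zeta>\<bar> * (\<Sum>k<n. \<rho> ^ Suc k)" by (simp only: sum_distrib_left)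
  also have "\<dots> \<le> K * \<bar>\<xi> - \<zeta>\<bar> * 1"
  proof (intro mult_left_mono)
    have "(\<Sum>k<n. \<rho> ^ Suc k) \<le> 1 - \<rho> ^ n" for n
    proof (induction n)
      case (Suc n)
      have "\<rho> * \<rho> ^ n \<le> 1 / 2 * \<rho> ^ n" using rho_pos rho_le_half by (intro mult_right_mono) auto
      then show ?case using Suc by simp
    qed simp
    from this[of n] show "(\<Sum>k<n. \<rho> ^ Suc k) \<le> 1" using zero_less_power[OF rho_pos, of n] by linarith
  qed (use K_pos in auto)
  finally show "norm (Q n \<xi> - Q n \<zeta>) \<le> K * \<bar>\<xi> - \<zeta>\<bar>" by simp
qed

text \<open>The digits after the first \<open>n\<close> are again independent with the same law,
  scaled by \<open>\<rho> ^ n\<close>.\<close>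

lemma Qinf_split: "Qinf \<xi> = Q n \<xi> * Qinf (\<xi> * \<rho> ^ n)"
proof -
  have "Q (n + k) \<xi> = Q n \<xi> * Q k (\<xi> * \<rho> ^ n)" for k
  proof (induction k)
    case 0
    then show ?case by (simp add: Q_def)
  next
    case (Suc k)
    have "Q (n + Suc k) \<xi> = Q (n + k) \<xi> * P (\<xi> * \<rho> ^ Suc (n + k))" by (simp only: add_Suc_right Q_Suc)
    also have "\<xi> * \<rho> ^ Suc (n + k) = (\<xi> * \<rho> ^ n) * \<rho> ^ Suc k" by (simp add: power_add)
    finally show ?case by (simp only: Suc Q_Suc mult.assoc)
  qed
  moreover have "(\<lambda>k. Q (n + k) \<xi>) \<longlonglongrightarrow> Qinf \<xi>"
    using LIMSEQ_ignore_initial_segment[OF Q_tendsto[of \<xi>], of n] by (simp add: add.commute)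
  ultimately have "(\<lambda>k. Q n \<xi> * Q k (\<xi> * \<rho> ^ n)) \<longlonglongrightarrow> Qinf \<xi>" by simp
  moreover have "(\<lambda>k. Q n \<xi> * Q k (\<xi> * \<rho> ^ n)) \<longlonglongrightarrow> Q n \<xi> * Qinf (\<xi> * \<rho> ^ n)"
    by (intro tendsto_intros Q_tendsto)
  ultimately show ?thesis using LIMSEQ_unique by blast
qed

lemma Qinf_nonzero_small: "K * \<bar>\<xi>\<bar> < 1 \<Longrightarrow> Qinf \<xi> \<noteq> 0"
  using norm_Qinf_diff[of \<xi> 0] Qinf_0 by auto

text \<open>Were all nonzero integers zeros, then expanding the double sum over pairs of words of
  the squared Dirichlet kernel would leave only the diagonal terms, which are too small if
  \<open>m < p\<close>.\<close>

lemma Qinf_nonzero_exists: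
  assumes mp: "m < p"
  shows "\<exists>r::int. r \<noteq> 0 \<and> Qinf (real_of_int r) \<noteq> 0"
proof (rule ccontr)
  assume "\<not> ?thesis"
  then have zero: "Qinf (real_of_int r) = 0" if "r \<noteq> 0" for r :: int using that by blast
  \<comment> \<open>With \<open>i\<close> extra digits the tail factor
    \<open>Qinf (r * \<rho> ^ k)\<close> cannot vanish for \<open>\<bar>r\<bar> < p ^ n\<close>, so
    a zero of \<open>Qinf\<close> at \<open>r\<close> must come from the finite product
    \<open>Q k\<close>.\<close>
  obtain i where i: "K * \<rho> ^ i < 1"
    using order_tendstoD(2)[OF rho_power_tendsto_0[of K], of 1] eventually_happens'[OF sequentially_bot] by fastforce
  have bound: "p ^ n \<le> m ^ (n + i)" for n
  proof -
    define R where "R = p ^ n"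
    define k where "k = n + i"
    have Q0: "Q k (real_of_int r) = 0" if r: "r \<noteq> 0" "\<bar>r\<bar> < int R" for r
    proof -
      have "Qinf (r * \<rho> ^ k) \<noteq> 0"
      proof (rule Qinf_nonzero_small)
        have "\<bar>real_of_int r\<bar> \<le> real p ^ n" using r(2) unfolding R_def
          by (metis less_imp_le of_int_abs of_int_le_iff of_int_of_nat_eq of_nat_power)
        then have "\<bar>real_of_int r\<bar> * \<rho> ^ k \<le> real p ^ n * \<rho> ^ k"
          using rho_pos by (intro mult_right_mono) auto
        also have "\<dots> = \<rho> ^ i" using p_ge_2 by (simp add: rho_eq k_def power_add power_divide)
        finally have "K * \<bar>real_of_int r * \<rho> ^ k\<bar> \<le> K * \<rho> ^ i"
          using rho_pos K_pos by (intro mult_left_mono) (auto simp: abs_mult)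
        then show "K * \<bar>real_of_int r * \<rho> ^ k\<bar> < 1" using i by linarith
      qed
      then show ?thesis using Qinf_split[of r k] zero[OF r(1)] by simp
    qed
    define c where "c r = (\<Sum>w\<in>words m k. ee (real_of_int r * \<rho> * B w))" for r
    have c: "c r = of_nat m ^ k * Q k r" for r unfolding c_def by (rule sum_ee_words_Q)
    have c0: "c 0 = of_nat m ^ k" by (simp add: c_def card_words)
    have cr: "c r = 0" if "r \<noteq> 0" "\<bar>r\<bar> < int R" for r using Q0[OF that] by (simp add: c)
    define S where "S = (\<Sum>v\<in>words m k. \<Sum>w\<in>words m k.
        (norm (\<Sum>r<R. ee (real r * \<rho> * (B v - B w))))\<^sup>2)"
    have "complex_of_real S = (\<Sum>v\<in>words m k. \<Sum>w\<in>words m k. \<Sum>r<R. \<Sum>s<R.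
        ee (real r * \<rho> * (B v - B w)) * cnj (ee (real s * \<rho> * (B v - B w))))"
      unfolding S_def of_real_sum complex_norm_square by (simp only: cnj_sum sum_product)
    also have "\<dots> = (\<Sum>v\<in>words m k. \<Sum>w\<in>words m k. \<Sum>r<R. \<Sum>s<R.
        ee (real_of_int (int r - int s) * \<rho> * B v) * ee (real_of_int (int s - int r) * \<rho> * B w))"
      by (intro sum.cong refl) (simp add: cnj_ee algebra_simps flip: ee_add)
    also have "\<dots> = (\<Sum>r<R. \<Sum>s<R. \<Sum>v\<in>words m k. \<Sum>w\<in>words m k.
        ee (real_of_int (int r - int s) * \<rho> * B v) * ee (real_of_int (int s - int r) * \<rho> * B w))"
    proof -
      have swap: "(\<Sum>v\<in>A. \<Sum>w\<in>A. \<Sum>r\<in>D. \<Sum>s\<in>D. g v w r s) = (\<Sum>r\<in>D. \<Sum>s\<in>D. \<Sum>v\<in>A. \<Sum>w\<in>A. g v w r s)"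
        for A :: "nat list set" and D :: "nat set" and g :: "_ \<Rightarrow> _ \<Rightarrow> _ \<Rightarrow> _ \<Rightarrow> complex"
      proof -
        have "(\<Sum>v\<in>A. \<Sum>w\<in>A. \<Sum>r\<in>D. \<Sum>s\<in>D. g v w r s) = (\<Sum>v\<in>A. \<Sum>r\<in>D. \<Sum>w\<in>A. \<Sum>s\<in>D. g v w r s)"
          by (intro sum.cong refl sum.swap)
        also have "\<dots> = (\<Sum>r\<in>D. \<Sum>v\<in>A. \<Sum>w\<in>A. \<Sum>s\<in>D. g v w r s)" by (rule sum.swap)
        also have "\<dots> = (\<Sum>r\<in>D. \<Sum>v\<in>A. \<Sum>s\<in>D. \<Sum>w\<in>A. g v w r s)"
          by (intro sum.cong refl sum.swap)
        also have "\<dots> = (\<Sum>r\<in>D. \<Sum>s\<in>D. \<Sum>v\<in>A. \<Sum>w\<in>A. g v w r s)"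
          by (intro sum.cong refl sum.swap)
        finally show ?thesis .
      qed
      show ?thesis by (rule swap)
    qed
    also have "\<dots> = (\<Sum>r<R. \<Sum>s<R. c (int r - int s) * c (int s - int r))"
      unfolding c_def by (simp only: sum_product)
    also have "\<dots> = (\<Sum>r<R. \<Sum>s<R. if s = r then of_nat m ^ k * of_nat m ^ k else 0)"
    proof (intro sum.cong refl)
      fix r s assume "r \<in> {..<R}" "s \<in> {..<R}"
      then show "c (int r - int s) * c (int s - int r) = (if s = r then of_nat m ^ k * of_nat m ^ k else 0)"
        using c0 cr[of "int r - int s"] by auto
    qed
    also have "\<dots> = of_nat (R * (m ^ k * m ^ k))" by simp
    finally have S: "S = real (R * (m ^ k * m ^ k))" by (metis of_real_eq_iff of_real_of_nat_eq)
    \<comment> \<open>The pairs with equal words alone contribute \<open>m ^ k * R ^ 2\<close>,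
      whereas \<open>S = R * m ^ (2 * k)\<close>. So \<open>p ^ n \<le> m ^ (n + i)\<close> for
      every \<open>n\<close>, against \<open>m < p\<close>.\<close>
    have "real (m ^ k) * (real R)\<^sup>2 = (\<Sum>v\<in>words m k. (norm (\<Sum>r<R. ee (real r * \<rho> * (B v - B v))))\<^sup>2)"
      by (simp add: card_words)
    also have "\<dots> \<le> S"
      unfolding S_def
    proof (rule sum_mono)
      fix v assume v: "v \<in> words m k"
      show "(norm (\<Sum>r<R. ee (real r * \<rho> * (B v - B v))))\<^sup>2
          \<le> (\<Sum>w\<in>words m k. (norm (\<Sum>r<R. ee (real r * \<rho> * (B v - B w))))\<^sup>2)"
        using member_le_sum[OF v, of "\<lambda>w. (norm (\<Sum>r<R. ee (real r * \<rho> * (B v - B w))))\<^sup>2"] by auto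
    qed
    finally have "real (m ^ k * (R * R)) \<le> real (R * (m ^ k * m ^ k))"
      unfolding S by (simp only: of_nat_mult power2_eq_square)
    then have "m ^ k * (R * R) \<le> R * (m ^ k * m ^ k)" by (simp only: of_nat_le_iff)
    then have "(m ^ k * R) * R \<le> (m ^ k * R) * m ^ k" by (simp only: ac_simps)
    moreover have "0 < m ^ k * R" using m_pos p_ge_2 by (simp add: R_def)
    ultimately show ?thesis by (simp add: R_def k_def)
  qed
  have "1 < real p / real m" using mp m_pos by (simp add: field_simps)
  then obtain n where n: "real (m ^ i) < (real p / real m) ^ n" using real_arch_pow by blast
  then have "real (m ^ i) * real m ^ n < real p ^ n"
    using m_pos by (simp add: power_divide field_simps)
  moreover have "real (p ^ n) \<le> real (m ^ (n + i))" using bound by (simp only: of_nat_le_iff)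
  ultimately show False by (simp add: power_add mult.commute)
qed

end

section \<open>Coupling two digit systems\<close>

context integer_digits
begin

text \<open>The first letter has weight 1, which is why \<open>p ^ j\<close> clears the denominators
  of \<open>Suc j\<close> letters.\<close>

lemma p_power_B_Ints:
  assumes "set x \<subseteq> {1..m}" "length x \<le> Suc j"
  shows "real p ^ j * B x \<in> \<int>"
  using assms
proof (induction x arbitrary: j)
  case Nil
  then show ?case by simp
next
  case (Cons i x)
  show ?case
  proof (cases j)
    case 0
    then show ?thesis using Cons.prems by simp
  next
    case (Suc j')
    have "real p ^ j * B (i # x) = real_of_int (int p ^ j * b i) + real p ^ j' * B x"
      using p_ge_2 by (simp add: Suc rho_eq field_simps)
    moreover have "real p ^ j' * B x \<in> \<int>" using Cons Suc by (intro Cons.IH) auto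
    ultimately show ?thesis by (metis Ints_add Ints_of_int)
  qed
qed

lemma abs_B_le: "set x \<subseteq> {1..m} \<Longrightarrow> \<bar>B x\<bar> \<le> 2 * Bd"
proof (induction x)
  case Nil
  then show ?case using Bd_pos by simp
next
  case (Cons i x)
  have "\<bar>\<rho> * B x\<bar> \<le> 1 / 2 * (2 * Bd)"
    unfolding abs_mult using Cons rho_pos rho_le_half Bd_pos by (intro mult_mono) auto
  moreover have "\<bar>real_of_int (b i)\<bar> \<le> Bd" using Cons.prems by (intro Bd) simp
  ultimately show ?case by simp
qed

text \<open>After multiplication by \<open>p ^ j\<close> the first \<open>Suc j\<close> letters
  contribute an integer, which \<open>ee\<close> ignores, and the letters after the next
  \<open>G\<close> contribute only a multiple of \<open>\<rho> ^ G\<close>. The block itself keeps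
  one factor \<open>\<rho>\<close>, in accordance with \<open>sum_ee_words_Q\<close>.\<close>

lemma block_approx:
  assumes w: "w \<in> words m n" and le: "Suc j + G \<le> n"
  shows "norm (ee (real_of_int R * real p ^ j * B w) - ee (real_of_int R * \<rho> * B (take G (drop (Suc j) w))))
    \<le> 4 * pi * Bd * \<bar>real_of_int R\<bar> * \<rho> ^ G"
proof -
  define x y z where "x = take (Suc j) w" and "y = take G (drop (Suc j) w)"
    and "z = drop G (drop (Suc j) w)"
  have wxyz: "w = x @ y @ z" by (simp only: x_def y_def z_def append_take_drop_id)
  have len: "length x = Suc j" "length y = G" using w le by (auto simp: x_def y_def words_def)
  have set: "set x \<subseteq> {1..m}" "set z \<subseteq> {1..m}" using w by (auto simp: wxyz words_def)
  have pr: "real p ^ j * \<rho> ^ Suc j = \<rho>" using p_ge_2 by (simp add: rho_eq power_divide)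
  have Bw: "B w = B x + \<rho> ^ Suc j * (B y + \<rho> ^ G * B z)"
    by (simp add: wxyz addr_append len)
  have "real_of_int R * real p ^ j * B w =
      real_of_int R * (real p ^ j * \<rho> ^ Suc j) * (B y + \<rho> ^ G * B z) + real_of_int R * (real p ^ j * B x)"
    unfolding Bw by (simp add: algebra_simps)
  moreover have "real_of_int R * (real p ^ j * B x) \<in> \<int>"
    using p_power_B_Ints[OF set(1)] len by simp
  ultimately have "ee (real_of_int R * real p ^ j * B w) = ee (real_of_int R * \<rho> * (B y + \<rho> ^ G * B z))"
    unfolding pr by (simp only: ee_add_Ints)
  then have "norm (ee (real_of_int R * real p ^ j * B w) - ee (real_of_int R * \<rho> * B y))
      \<le> 2 * pi * \<bar>real_of_int R * \<rho> * (B y + \<rho> ^ G * B z) - real_of_int R * \<rho> * B y\<bar>"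
    by (simp only: norm_ee_diff_le)
  also have "real_of_int R * \<rho> * (B y + \<rho> ^ G * B z) - real_of_int R * \<rho> * B y
      = real_of_int R * (\<rho> * \<rho> ^ G * B z)"
    by (simp add: algebra_simps)
  also have "\<bar>\<dots>\<bar> = \<bar>real_of_int R\<bar> * (\<rho> * \<rho> ^ G * \<bar>B z\<bar>)"
    using rho_pos by (simp add: abs_mult)
  also have "2 * pi * \<dots> \<le> 2 * pi * (\<bar>real_of_int R\<bar> * (1 * \<rho> ^ G * (2 * Bd)))"
    using abs_B_le[OF set(2)] rho_pos rho_less_1 by (intro mult_left_mono mult_mono) auto
  finally show ?thesis by (simp add: y_def algebra_simps)
qed

end

text \<open>\<open>F\<close> is the pairing of words that comes from the coincidence of
  \<open>E\<close> with a copy, once the digits have been made integers; \<open>\<gamma>\<close> is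
  the ratio of the copy, with its powers of \<open>p\<close> split off as \<open>c1\<close> and
  \<open>c2\<close>, and \<open>\<beta>\<close> stems from a relative position. Bounded fibres allow
  averages over the words \<open>F x\<close> to be controlled by averages over all words.\<close>

locale coupled_digits = integer_digits +
  fixes u v c1 c2 n0 L C :: nat and w0 :: "nat list" and F :: "nat list \<Rightarrow> nat list"
    and \<gamma> \<tau> H :: real
  assumes ratio: "real v * \<gamma> * real p ^ c2 = real u * real p ^ c1"
    and w0: "w0 \<in> words m n0"
    and F: "\<And>k x. x \<in> words m k \<Longrightarrow> F x \<in> words m (n0 + k + L)"
    and relation: "\<And>k x. x \<in> words m k \<Longrightarrow>
        \<exists>\<beta>. \<bar>\<beta>\<bar> \<le> H \<and> \<gamma> * B (F x) + \<tau> = B (w0 @ x) + \<rho> ^ (n0 + k) * \<beta>"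
    and fibres: "\<And>k w'. card {x \<in> words m k. F x = w'} \<le> C"
begin

text \<open>The unimodular but otherwise unknown factor that the translation \<open>\<tau>\<close>
  contributes at position \<open>j\<close>.\<close>

definition phase :: "int \<Rightarrow> nat \<Rightarrow> complex" where
  "phase r j = ee (real_of_int (int v * r) * real p ^ j * \<tau>)"

lemma norm_phase [simp]: "norm (phase r j) = 1"
  by (simp add: phase_def)

lemma sum_fibres_le:
  assumes "\<And>w. 0 \<le> g w"
  shows "(\<Sum>x\<in>words m k. g (F x)) \<le> real C * (\<Sum>w\<in>words m (n0 + k + L). g w :: real)"
proof -
  have "(\<Sum>x\<in>words m k. g (F x)) = (\<Sum>w\<in>F ` words m k. \<Sum>x\<in>{x \<in> words m k. F x = w}. g (F x))"
    by (rule sum.image_gen) simp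
  also have "\<dots> = (\<Sum>w\<in>F ` words m k. real (card {x \<in> words m k. F x = w}) * g w)"
    by (intro sum.cong refl) simp
  also have "\<dots> \<le> (\<Sum>w\<in>F ` words m k. real C * g w)"
    using fibres assms by (intro sum_mono mult_right_mono) auto
  also have "\<dots> \<le> (\<Sum>w\<in>words m (n0 + k + L). real C * g w)"
    using F assms by (intro sum_mono2) auto
  finally show ?thesis by (simp add: sum_distrib_left)
qed

lemma sum_prefix_le:
  assumes "\<And>w. 0 \<le> g w"
  shows "(\<Sum>x\<in>words m k. g (w0 @ x)) \<le> (\<Sum>w\<in>words m (n0 + k). g w :: real)"
  unfolding sum_words_append
  using member_le_sum[OF w0, of "\<lambda>v. \<Sum>x\<in>words m k. g (v @ x)"] assms
  by (simp add: sum_nonneg)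

text \<open>Multiplying the relation by \<open>v * r * p ^ j\<close> turns
  \<open>v * \<gamma> * p ^ j\<close> into \<open>u * p ^ j'\<close> with
  \<open>j' - j = c1 - c2\<close>. So a block of \<open>F x\<close> at frequency
  \<open>u * r\<close> matches, up to the phase, the correspondingly shifted block of
  \<open>w0 @ x\<close> at frequency \<open>v * r\<close>.\<close>

lemma coupled_block:
  assumes x: "x \<in> words m k" and k: "k = Suc (c1 + c2 + G + N * G)" and l: "l < N"
  defines "j \<equiv> n0 + c2 + l * G"
  shows "norm (phase r j * ee (real_of_int (int u * r) * \<rho> * B (take G (drop (Suc (n0 + c1) + l * G) (F x))))
      - ee (real_of_int (int v * r) * \<rho> * B (take G (drop (Suc (n0 + c2) + l * G) (w0 @ x)))))
    \<le> (4 * pi * Bd * \<bar>real_of_int (int u * r)\<bar> + 4 * pi * Bd * \<bar>real_of_int (int v * r)\<bar>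
        + 2 * pi * \<bar>real_of_int (int v * r)\<bar> * H) * \<rho> ^ G"
proof -
  define j' where "j' = n0 + c1 + l * G"
  define R R' where "R = int v * r" and "R' = int u * r"
  have "Suc l * G \<le> N * G" using l by (intro mult_le_mono1) auto
  then have lG: "l * G + G \<le> N * G" by simp
  have wx: "w0 @ x \<in> words m (n0 + k)" using words_append[OF w0 x] .
  obtain \<beta> where \<beta>: "\<bar>\<beta>\<bar> \<le> H" "\<gamma> * B (F x) + \<tau> = B (w0 @ x) + \<rho> ^ (n0 + k) * \<beta>"
    using relation[OF x] by blast
  have a1: "norm (ee (real_of_int R' * real p ^ j' * B (F x)) - ee (real_of_int R' * \<rho> * B (take G (drop (Suc j') (F x)))))
      \<le> 4 * pi * Bd * \<bar>real_of_int R'\<bar> * \<rho> ^ G"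
    using lG by (intro block_approx[OF F[OF x]]) (simp add: j'_def k)
  have a2: "norm (ee (real_of_int R * real p ^ j * B (w0 @ x)) - ee (real_of_int R * \<rho> * B (take G (drop (Suc j) (w0 @ x)))))
      \<le> 4 * pi * Bd * \<bar>real_of_int R\<bar> * \<rho> ^ G"
    using lG by (intro block_approx[OF wx]) (simp add: j_def k)
  have key: "real v * real p ^ j * \<gamma> = real u * real p ^ j'"
  proof -
    have "real v * real p ^ j * \<gamma> = (real v * \<gamma> * real p ^ c2) * real p ^ (n0 + l * G)"
      by (simp add: j_def power_add algebra_simps)
    then show ?thesis unfolding ratio by (simp add: j'_def power_add algebra_simps)
  qed
  have "real_of_int R' * real p ^ j' * B (F x) + real_of_int R * real p ^ j * \<tau>
      = real_of_int r * (real v * real p ^ j * \<gamma>) * B (F x) + real_of_int r * real v * real p ^ j * \<tau>"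
    unfolding key by (simp add: R_def R'_def)
  also have "\<dots> = real_of_int R * real p ^ j * (\<gamma> * B (F x) + \<tau>)" by (simp add: R_def algebra_simps)
  also have "\<dots> = real_of_int R * real p ^ j * B (w0 @ x) + real_of_int R * (real p ^ j * \<rho> ^ (n0 + k)) * \<beta>"
    unfolding \<beta>(2) by (simp add: algebra_simps)
  finally have sum: "real_of_int R' * real p ^ j' * B (F x) + real_of_int R * real p ^ j * \<tau>
      - real_of_int R * real p ^ j * B (w0 @ x) = real_of_int R * (real p ^ j * \<rho> ^ (n0 + k)) * \<beta>"
    by simp
  have "norm (phase r j * ee (real_of_int R' * real p ^ j' * B (F x)) - ee (real_of_int R * real p ^ j * B (w0 @ x)))
      = norm (ee (real_of_int R' * real p ^ j' * B (F x) + real_of_int R * real p ^ j * \<tau>)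
          - ee (real_of_int R * real p ^ j * B (w0 @ x)))"
    by (simp add: phase_def R_def ee_add mult.commute)
  also have "\<dots> \<le> 2 * pi * \<bar>real_of_int R * (real p ^ j * \<rho> ^ (n0 + k)) * \<beta>\<bar>"
    unfolding sum[symmetric] by (rule norm_ee_diff_le)
  also have "\<dots> = 2 * pi * (\<bar>real_of_int R\<bar> * (real p ^ j * \<rho> ^ (n0 + k)) * \<bar>\<beta>\<bar>)"
    using rho_pos by (simp add: abs_mult)
  also have "\<dots> \<le> 2 * pi * (\<bar>real_of_int R\<bar> * \<rho> ^ G * H)"
  proof (intro mult_left_mono mult_mono)
    \<comment> \<open>At least \<open>G\<close> letters remain after position \<open>j\<close>, so
      the term with \<open>\<beta>\<close> stays of order \<open>\<rho> ^ G\<close> after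
      multiplication by \<open>p ^ j\<close>.\<close>
    have "j + G \<le> n0 + k" using lG by (simp add: j_def k)
    then obtain e where e: "n0 + k = j + G + e" using le_Suc_ex by blast
    have "real p ^ j * \<rho> ^ (n0 + k) = \<rho> ^ G * \<rho> ^ e"
      using p_ge_2 by (simp add: e power_add rho_eq power_divide)
    also have "\<dots> \<le> \<rho> ^ G * 1" using rho_pos rho_less_1 by (intro mult_left_mono power_le_one) auto
    finally show "real p ^ j * \<rho> ^ (n0 + k) \<le> \<rho> ^ G" by simp
  qed (use \<beta> rho_pos in auto)
  finally have a3: "norm (phase r j * ee (real_of_int R' * real p ^ j' * B (F x)) - ee (real_of_int R * real p ^ j * B (w0 @ x)))
      \<le> 2 * pi * \<bar>real_of_int R\<bar> * H * \<rho> ^ G" by (simp add: algebra_simps)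
  have tri: "norm (f * y' - z') \<le> norm (y - y') + norm (z - z') + norm (f * y - z)"
    if "norm f = 1" for f y y' z z' :: complex
  proof -
    have "f * y' - z' = (z - z') + (f * y - z) - f * (y - y')" by (simp add: algebra_simps)
    then have "norm (f * y' - z') \<le> norm ((z - z') + (f * y - z)) + norm (f * (y - y'))"
      by (simp only: norm_triangle_ineq4)
    also have "\<dots> \<le> norm (z - z') + norm (f * y - z) + norm (f * (y - y'))"
      by (intro add_right_mono norm_triangle_ineq)
    finally show ?thesis using that by (simp add: norm_mult)
  qed
  have "norm (phase r j * ee (real_of_int R' * \<rho> * B (take G (drop (Suc j') (F x))))
      - ee (real_of_int R * \<rho> * B (take G (drop (Suc j) (w0 @ x)))))
    \<le> 4 * pi * Bd * \<bar>real_of_int R'\<bar> * \<rho> ^ G + 4 * pi * Bd * \<bar>real_of_int R\<bar> * \<rho> ^ G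
        + 2 * pi * \<bar>real_of_int R\<bar> * H * \<rho> ^ G"
    by (rule order_trans[OF tri[OF norm_phase] add_mono[OF add_mono[OF a1 a2] a3]])
  then show ?thesis by (simp add: R_def R'_def j_def j'_def distrib_right)
qed

text \<open>The second moment bounds provide a single word \<open>x\<close> for which the block
  averages of both \<open>w0 @ x\<close> and \<open>F x\<close> are close to their means; the
  matching of blocks then relates these means. The weights \<open>d\<close> are left free in order
  to deal with the unknown phases.\<close>

lemma coupled_average:
  assumes d: "\<And>j. norm (d j) \<le> 1" and eps: "\<epsilon> > 0"
  shows "\<exists>N>0. \<exists>g. norm (Qinf (real_of_int (int u * r)) * (\<Sum>l<N. d (g l) * phase r (g l))
      - Qinf (real_of_int (int v * r)) * (\<Sum>l<N. d (g l))) \<le> \<epsilon> * real N"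
proof -
  define R R' where "R = real_of_int (int v * r)" and "R' = real_of_int (int u * r)"
  define M1 where "M1 = 4 * pi * Bd * \<bar>R'\<bar> + 4 * pi * Bd * \<bar>R\<bar> + 2 * pi * \<bar>R\<bar> * H"
  have "\<forall>\<^sub>F G in sequentially. M1 * \<rho> ^ G < \<epsilon> / 4"
    using order_tendstoD(2)[OF rho_power_tendsto_0[of M1], of "\<epsilon> / 4"] eps by simp
  moreover have "\<forall>\<^sub>F G in sequentially. dist (Q G R) (Qinf R) < \<epsilon> / 4"
    using tendstoD[OF Q_tendsto[of R], of "\<epsilon> / 4"] eps by simp
  moreover have "\<forall>\<^sub>F G in sequentially. dist (Q G R') (Qinf R') < \<epsilon> / 4"
    using tendstoD[OF Q_tendsto[of R'], of "\<epsilon> / 4"] eps by simp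
  ultimately have "\<forall>\<^sub>F G in sequentially. M1 * \<rho> ^ G < \<epsilon> / 4 \<and>
      dist (Q G R) (Qinf R) < \<epsilon> / 4 \<and> dist (Q G R') (Qinf R') < \<epsilon> / 4"
    by eventually_elim simp
  then obtain G where G: "M1 * \<rho> ^ G < \<epsilon> / 4" "norm (Q G R - Qinf R) < \<epsilon> / 4"
      "norm (Q G R' - Qinf R') < \<epsilon> / 4"
    using eventually_happens'[OF sequentially_bot] unfolding dist_norm by blast
  \<comment> \<open>Relative to averages over all words, passing to words that begin with
    \<open>w0\<close> costs \<open>m ^ n0\<close>, and passing to the words \<open>F x\<close> costs
    \<open>C * m ^ (n0 + L)\<close>.\<close>
  define M2 where "M2 = real m ^ n0 * (1 + real C * real m ^ L)"
  have M2: "M2 > 0" using m_pos by (simp add: M2_def add_pos_nonneg)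
  \<comment> \<open>This size makes \<open>4 * N * M2\<close> at most the square of
    \<open>\<epsilon> * N / 8\<close>.\<close>
  obtain N :: nat where N: "real N > 256 * M2 / \<epsilon>\<^sup>2" using reals_Archimedean2 by blast
  have "0 < 256 * M2 / \<epsilon>\<^sup>2" using M2 eps by simp
  with N have N0: "N > 0" using of_nat_0_less_iff by (metis less_trans)
  define k where "k = Suc (c1 + c2 + G + N * G)"
  define g where "g l = n0 + c2 + l * G" for l
  define \<psi> \<psi>' where "\<psi> y = ee (R * \<rho> * B y)" and "\<psi>' y = ee (R' * \<rho> * B y)" for y
  define blk blk' where "blk l w = take G (drop (Suc (n0 + c2) + l * G) w)"
    and "blk' l w = take G (drop (Suc (n0 + c1) + l * G) w)" for l and w :: "nat list"
  define Z where "Z w = (\<Sum>l<N. d (g l) * (\<psi> (blk l w) - Q G R))" for w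
  define Z' where "Z' w = (\<Sum>l<N. (d (g l) * phase r (g l)) * (\<psi>' (blk' l w) - Q G R'))" for w
  have mean: "(\<Sum>y\<in>words m G. \<psi> y - Q G R) = 0" "(\<Sum>y\<in>words m G. \<psi>' y - Q G R') = 0"
    by (simp_all add: sum_subtractf \<psi>_def \<psi>'_def sum_ee_words_Q card_words)
  have two: "norm (\<psi> y - Q G R) \<le> 2" "norm (\<psi>' y - Q G R') \<le> 2" for y
    using norm_triangle_ineq4[of "\<psi> y" "Q G R"] norm_triangle_ineq4[of "\<psi>' y" "Q G R'"]
      norm_Q_le[of G R] norm_Q_le[of G R'] by (auto simp: \<psi>_def \<psi>'_def)
  have ph: "norm (d j * phase r j) \<le> 1" for j using d by (simp add: norm_mult)
  \<comment> \<open>The trailing \<open>G + c1\<close> letters, and \<open>G + c2 + L\<close>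
    letters in the second case, fill both block systems up to the lengths of \<open>w0 @ x\<close>
    and \<open>F x\<close>.\<close>
  have "(\<Sum>w\<in>words m (Suc (n0 + c2) + N * G + (G + c1)). (norm (Z w))\<^sup>2)
      \<le> 4 * real N * real m ^ (Suc (n0 + c2) + N * G + (G + c1))"
    unfolding Z_def blk_def using mean(1) two(1) d by (rule second_moment)
  also have "Suc (n0 + c2) + N * G + (G + c1) = n0 + k" by (simp add: k_def)
  finally have Z: "(\<Sum>w\<in>words m (n0 + k). (norm (Z w))\<^sup>2) \<le> 4 * real N * real m ^ (n0 + k)" .
  have "(\<Sum>w\<in>words m (Suc (n0 + c1) + N * G + (G + c2 + L)). (norm (Z' w))\<^sup>2)
      \<le> 4 * real N * real m ^ (Suc (n0 + c1) + N * G + (G + c2 + L))"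
    unfolding Z'_def blk'_def using mean(2) two(2) ph by (rule second_moment)
  also have "Suc (n0 + c1) + N * G + (G + c2 + L) = n0 + k + L" by (simp add: k_def)
  finally have Z': "(\<Sum>w\<in>words m (n0 + k + L). (norm (Z' w))\<^sup>2) \<le> 4 * real N * real m ^ (n0 + k + L)" .
  have total: "(\<Sum>x\<in>words m k. (norm (Z (w0 @ x)))\<^sup>2 + (norm (Z' (F x)))\<^sup>2) \<le> real m ^ k * (4 * real N * M2)"
  proof -
    have "(\<Sum>x\<in>words m k. (norm (Z (w0 @ x)))\<^sup>2) \<le> 4 * real N * real m ^ (n0 + k)"
      by (rule order_trans[OF sum_prefix_le Z]) simp
    moreover have "(\<Sum>x\<in>words m k. (norm (Z' (F x)))\<^sup>2) \<le> real C * (4 * real N * real m ^ (n0 + k + L))"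
      by (rule order_trans[OF sum_fibres_le mult_left_mono[OF Z']]) simp_all
    ultimately show ?thesis by (simp add: sum.distrib M2_def power_add algebra_simps)
  qed
  have "\<exists>x\<in>words m k. (norm (Z (w0 @ x)))\<^sup>2 + (norm (Z' (F x)))\<^sup>2 \<le> 4 * real N * M2"
  proof (rule ccontr)
    assume "\<not> ?thesis"
    then have "\<And>x. x \<in> words m k \<Longrightarrow> 4 * real N * M2 < (norm (Z (w0 @ x)))\<^sup>2 + (norm (Z' (F x)))\<^sup>2"
      by (meson not_le)
    moreover have "words m k \<noteq> {}" using card_words[of m k] m_pos by auto
    ultimately have "(\<Sum>x\<in>words m k. 4 * real N * M2) < (\<Sum>x\<in>words m k. (norm (Z (w0 @ x)))\<^sup>2 + (norm (Z' (F x)))\<^sup>2)"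
      by (intro sum_strict_mono) auto
    then show False using total by (simp add: card_words)
  qed
  then obtain x where x: "x \<in> words m k"
    and sq: "(norm (Z (w0 @ x)))\<^sup>2 + (norm (Z' (F x)))\<^sup>2 \<le> 4 * real N * M2" by blast
  have "256 * M2 < real N * \<epsilon>\<^sup>2" using N eps by (simp add: divide_less_eq)
  then have "real N * (256 * M2) \<le> real N * (real N * \<epsilon>\<^sup>2)" by (intro mult_left_mono) auto
  also have "\<dots> = (\<epsilon> * real N)\<^sup>2" by (simp add: power2_eq_square ac_simps)
  finally have "4 * real N * M2 \<le> (\<epsilon> * real N / 8)\<^sup>2" by (simp add: power_divide)
  then have "(norm (Z (w0 @ x)))\<^sup>2 \<le> (\<epsilon> * real N / 8)\<^sup>2" "(norm (Z' (F x)))\<^sup>2 \<le> (\<epsilon> * real N / 8)\<^sup>2"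
    using sq zero_le_power2[of "norm (Z (w0 @ x))"] zero_le_power2[of "norm (Z' (F x))"] by linarith+
  then have zz: "norm (Z (w0 @ x)) \<le> \<epsilon> * real N / 8" "norm (Z' (F x)) \<le> \<epsilon> * real N / 8"
    using eps by (auto intro!: power2_le_imp_le)
  define T where "T = (\<Sum>l<N. d (g l) * (phase r (g l) * \<psi>' (blk' l (F x)) - \<psi> (blk l (w0 @ x))))"
  have "norm T \<le> (\<Sum>l<N. M1 * \<rho> ^ G)"
    unfolding T_def
  proof (rule sum_norm_le)
    fix l assume "l \<in> {..<N}"
    then have "norm (phase r (g l) * \<psi>' (blk' l (F x)) - \<psi> (blk l (w0 @ x))) \<le> M1 * \<rho> ^ G"
      using coupled_block[OF x k_def, of l r] by (simp add: g_def \<psi>_def \<psi>'_def blk_def blk'_def M1_def R_def R'_def)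
    then have "norm (d (g l)) * norm (phase r (g l) * \<psi>' (blk' l (F x)) - \<psi> (blk l (w0 @ x))) \<le> 1 * (M1 * \<rho> ^ G)"
      using d by (intro mult_mono) auto
    then show "norm (d (g l) * (phase r (g l) * \<psi>' (blk' l (F x)) - \<psi> (blk l (w0 @ x)))) \<le> M1 * \<rho> ^ G"
      by (simp add: norm_mult)
  qed
  also have "\<dots> = M1 * \<rho> ^ G * real N" by simp
  also have "\<dots> \<le> \<epsilon> / 4 * real N" using G(1) by (intro mult_right_mono) auto
  finally have T: "norm T \<le> \<epsilon> / 4 * real N" .
  define S S' where "S = (\<Sum>l<N. d (g l))" and "S' = (\<Sum>l<N. d (g l) * phase r (g l))"
  have SN: "norm S \<le> real N" "norm S' \<le> real N"
  proof -
    have "norm S \<le> (\<Sum>l<N. 1)" unfolding S_def by (rule sum_norm_le) (rule d)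
    then show "norm S \<le> real N" by simp
    have "norm S' \<le> (\<Sum>l<N. 1)" unfolding S'_def by (rule sum_norm_le) (rule ph)
    then show "norm S' \<le> real N" by simp
  qed
  have "Q G R' * S' - Q G R * S = T - Z' (F x) + Z (w0 @ x)"
    by (simp add: S_def S'_def T_def Z_def Z'_def sum_distrib_left sum_subtractf sum.distrib algebra_simps)
  then have "Qinf R' * S' - Qinf R * S
      = (T - Z' (F x) + Z (w0 @ x)) + ((Qinf R' - Q G R') * S' - (Qinf R - Q G R) * S)"
    by (simp add: algebra_simps)
  also have "norm \<dots> \<le> norm (T - Z' (F x) + Z (w0 @ x)) + norm ((Qinf R' - Q G R') * S' - (Qinf R - Q G R) * S)"
    by (rule norm_triangle_ineq)
  also have "\<dots> \<le> (norm T + norm (Z' (F x)) + norm (Z (w0 @ x)))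
      + (norm ((Qinf R' - Q G R') * S') + norm ((Qinf R - Q G R) * S))"
    by (intro add_mono norm_triangle_ineq4 order_trans[OF norm_triangle_ineq] order_refl)
  \<comment> \<open>In units of \<open>\<epsilon> * N\<close>: 1/4 for the matching of blocks, 1/8
    for each fluctuation, and 1/4 for each replacement of \<open>Q G\<close> by
    \<open>Qinf\<close>.\<close>
  also have "\<dots> \<le> (\<epsilon> / 4 * real N + \<epsilon> * real N / 8 + \<epsilon> * real N / 8) + (\<epsilon> / 4 * real N + \<epsilon> / 4 * real N)"
    unfolding norm_mult using T zz SN G(2,3) eps
    by (intro add_mono mult_mono) (auto simp: norm_minus_commute)
  also have "\<dots> = \<epsilon> * real N" by simp
  finally show ?thesis using N0 unfolding S_def S'_def R_def R'_def by blast
qed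

text \<open>The weights \<open>cnj (phase r j)\<close> turn the first sum into \<open>N\<close>
  while the second has modulus at most \<open>N\<close>; constant weights do the reverse. Each
  choice gives one inequality.\<close>

lemma norm_Qinf_coupled: "norm (Qinf (real_of_int (int u * r))) = norm (Qinf (real_of_int (int v * r)))"
proof (rule antisym)
  have tri: "norm a \<le> norm (a - b) + norm b" for a b :: complex
    using norm_triangle_sub[of a b] by simp
  let ?q = "Qinf (real_of_int (int v * r))" and ?q' = "Qinf (real_of_int (int u * r))"
  show "norm ?q' \<le> norm ?q"
  proof (rule field_le_epsilon)
    fix \<epsilon> :: real assume eps: "0 < \<epsilon>"
    obtain N g where N: "N > 0" and le: "norm (?q' * (\<Sum>l<N. cnj (phase r (g l)) * phase r (g l))
        - ?q * (\<Sum>l<N. cnj (phase r (g l)))) \<le> \<epsilon> * real N"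
      using coupled_average[of "\<lambda>j. cnj (phase r j)" \<epsilon> r] eps by auto
    have "cnj (phase r j) * phase r j = 1" for j
      using complex_norm_square[of "phase r j"] by (simp add: mult.commute)
    then have eq: "(\<Sum>l<N. cnj (phase r (g l)) * phase r (g l)) = of_nat N" by simp
    have "norm (\<Sum>l<N. cnj (phase r (g l))) \<le> (\<Sum>l<N. 1)" by (rule sum_norm_le) simp
    then have S: "norm (\<Sum>l<N. cnj (phase r (g l))) \<le> real N" by simp
    have "norm ?q' * real N = norm (?q' * of_nat N)" by (simp add: norm_mult)
    also have "\<dots> \<le> norm (?q' * of_nat N - ?q * (\<Sum>l<N. cnj (phase r (g l))))
        + norm (?q * (\<Sum>l<N. cnj (phase r (g l))))"
      by (rule tri)
    also have "\<dots> \<le> \<epsilon> * real N + norm ?q * real N"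
      unfolding norm_mult using le S by (intro add_mono mult_left_mono) (auto simp: eq)
    finally have "norm ?q' * real N \<le> (norm ?q + \<epsilon>) * real N" by (simp add: algebra_simps)
    then show "norm ?q' \<le> norm ?q + \<epsilon>" using N by simp
  qed
  show "norm ?q \<le> norm ?q'"
  proof (rule field_le_epsilon)
    fix \<epsilon> :: real assume eps: "0 < \<epsilon>"
    obtain N g where N: "N > 0" and le: "norm (?q' * (\<Sum>l<N. phase r (g l)) - ?q * of_nat N) \<le> \<epsilon> * real N"
      using coupled_average[of "\<lambda>j. 1" \<epsilon> r] eps by auto
    have "norm (\<Sum>l<N. phase r (g l)) \<le> (\<Sum>l<N. 1)" by (rule sum_norm_le) simp
    then have S: "norm (\<Sum>l<N. phase r (g l)) \<le> real N" by simp
    have "norm ?q * real N = norm (?q * of_nat N)" by (simp add: norm_mult)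
    also have "\<dots> \<le> norm (?q * of_nat N - ?q' * (\<Sum>l<N. phase r (g l))) + norm (?q' * (\<Sum>l<N. phase r (g l)))"
      by (rule tri)
    also have "\<dots> \<le> \<epsilon> * real N + norm ?q' * real N"
      unfolding norm_mult using le S by (intro add_mono mult_left_mono) (auto simp: norm_minus_commute)
    finally have "norm ?q * real N \<le> (norm ?q' + \<epsilon>) * real N" by (simp add: algebra_simps)
    then show "norm ?q \<le> norm ?q' + \<epsilon>" using N by simp
  qed
qed

end

section \<open>Invariant Fourier coefficients\<close>

lemma ee_eq_1_iff: "ee x = 1 \<longleftrightarrow> x \<in> \<int>"
proof
  assume "ee x = 1"
  then have "cos (2 * pi * x) = 1" by (simp add: ee_def complex_eq_iff)
  then obtain n :: int where "2 * pi * x = real_of_int n * 2 * pi" using cos_one_2pi_int by blast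
  then have "x = real_of_int n" by simp
  then show "x \<in> \<int>" by simp
qed (rule ee_Ints)

context integer_digits
begin

text \<open>Two different unit vectors have a sum of modulus below 2 by the parallelogram identity,
  and the other \<open>m - 2\<close> terms cannot make up for it.\<close>

lemma norm_P_less_1:
  assumes ij: "i \<in> {1..m}" "j \<in> {1..m}" and ne: "ee (real_of_int (b i) * \<xi>) \<noteq> ee (real_of_int (b j) * \<xi>)"
  shows "norm (P \<xi>) < 1"
proof -
  define z where "z k = ee (real_of_int (b k) * \<xi>)" for k
  have "i \<noteq> j" using ne by auto
  have "(\<Sum>k\<in>{1..m}. z k) = z i + (\<Sum>k\<in>{1..m} - {i}. z k)"
    using ij by (intro sum.remove) auto
  also have "(\<Sum>k\<in>{1..m} - {i}. z k) = z j + (\<Sum>k\<in>{1..m} - {i} - {j}. z k)"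
    using ij \<open>i \<noteq> j\<close> by (intro sum.remove) auto
  finally have "norm (\<Sum>k\<in>{1..m}. z k) = norm ((z i + z j) + (\<Sum>k\<in>{1..m} - {i} - {j}. z k))"
    by (simp add: add.assoc)
  also have "\<dots> \<le> norm (z i + z j) + norm (\<Sum>k\<in>{1..m} - {i} - {j}. z k)" by (rule norm_triangle_ineq)
  also have "norm (\<Sum>k\<in>{1..m} - {i} - {j}. z k) \<le> (\<Sum>k\<in>{1..m} - {i} - {j}. 1)"
    by (rule sum_norm_le) (simp add: z_def)
  also have "\<dots> = real m - 2"
    using ij \<open>i \<noteq> j\<close> card_mono[of "{1..m}" "{i, j}"] by (simp add: card_Diff_singleton of_nat_diff)
  also have "norm (z i + z j) < 2"
  proof -
    have "(norm (z i + z j))\<^sup>2 + (norm (z i - z j))\<^sup>2 = 2 * (norm (z i))\<^sup>2 + 2 * (norm (z j))\<^sup>2"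
      unfolding cmod_power2 by (simp add: power2_eq_square algebra_simps)
    moreover have "norm (z i) = 1" "norm (z j) = 1" by (simp_all add: z_def)
    moreover have "0 < (norm (z i - z j))\<^sup>2" using ne by (simp add: z_def)
    ultimately have "(norm (z i + z j))\<^sup>2 < 4" by (simp only: power_one)
    then have "(norm (z i + z j))\<^sup>2 < 2\<^sup>2" by simp
    then show ?thesis by (rule power2_less_imp_less) simp
  qed
  finally have "norm (\<Sum>k\<in>{1..m}. z k) < real m" by simp
  then show ?thesis using m_pos by (simp add: P_def z_def norm_divide)
qed

lemma norm_Qinf_uminus: "norm (Qinf (- \<xi>)) = norm (Qinf \<xi>)"
proof -
  have "P (- x) = cnj (P x)" for x by (simp add: P_def cnj_ee)
  then have "norm (P (- x)) = norm (P x)" for x by simp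
  then have "norm (Q n (- \<xi>)) = norm (Q n \<xi>)" for n
    by (simp add: Q_def flip: prod_norm)
  then have "(\<lambda>n. norm (Q n \<xi>)) \<longlonglongrightarrow> norm (Qinf (- \<xi>))"
    using tendsto_norm[OF Q_tendsto[of "- \<xi>"]] by simp
  then show ?thesis using tendsto_norm[OF Q_tendsto[of \<xi>]] LIMSEQ_unique by blast
qed

text \<open>For \<open>M\<close> divisible by the order of \<open>p\<close> modulo \<open>u\<close>, the base \<open>p\<close> expansion of
  \<open>v * r * (p ^ M - 1) / u\<close> is the \<open>M\<close>-digit truncation of a periodic one.\<close>

lemma Qinf_power_tendsto_0:
  fixes u v :: nat and r :: int
  assumes u: "u > 1" and cop: "coprime u p" "coprime u v"
    and ij: "i \<in> {1..m}" "j \<in> {1..m}" and ndvd: "\<not> int u dvd r * (b i - b j)"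
  shows "(\<lambda>M. Qinf (real v * real_of_int r * (real p ^ M - 1) / real u)) \<longlonglongrightarrow> 0"
proof -
  define Y where "Y = {y \<in> {0..<int u}. \<not> int u dvd y * (b i - b j)}"
  \<comment> \<open>Since \<open>P\<close> has period 1, only residues modulo \<open>u\<close>
    matter, and the maximum over finitely many of them is a uniform bound below 1; 0 is inserted to
    make the set non-empty.\<close>
  define \<theta> where "\<theta> = Max (insert 0 ((\<lambda>y. norm (P (real_of_int y / real u))) ` Y))"
  have fin: "finite (insert 0 ((\<lambda>y. norm (P (real_of_int y / real u))) ` Y))"
    using finite_subset[of Y "{0..<int u}"] by (simp add: Y_def subset_iff)
  have lt: "norm (P (real_of_int y / real u)) < 1" if y: "\<not> int u dvd y * (b i - b j)" for y
  proof (rule norm_P_less_1[OF ij], rule notI)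
    assume "ee (real_of_int (b i) * (real_of_int y / real u)) = ee (real_of_int (b j) * (real_of_int y / real u))"
    moreover have "real_of_int (b i) * (real_of_int y / real u)
        = real_of_int (b j) * (real_of_int y / real u) + real_of_int (y * (b i - b j)) / real u"
      by (simp add: diff_divide_distrib algebra_simps)
    ultimately have "ee (real_of_int (y * (b i - b j)) / real u) = 1"
      by (simp only: ee_add) (metis mult_cancel_left2 norm_ee norm_zero zero_neq_one)
    then have "real_of_int (y * (b i - b j)) / real u \<in> \<int>" by (simp only: ee_eq_1_iff)
    then obtain k where "real_of_int (y * (b i - b j)) / real u = real_of_int k" by (auto elim: Ints_cases)
    then have "real_of_int (y * (b i - b j)) = real_of_int (k * int u)" using u by (simp add: field_simps)
    then have "y * (b i - b j) = k * int u" by (simp only: of_int_eq_iff)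
    then show False using y by simp
  qed
  have \<theta>1: "\<theta> < 1" unfolding \<theta>_def using fin lt by (subst Max_less_iff) (auto simp: Y_def)
  have \<theta>0: "0 \<le> \<theta>" unfolding \<theta>_def using fin by (intro Max_ge) auto
  have bound: "norm (P (real_of_int y / real u)) \<le> \<theta>" if y: "\<not> int u dvd y * (b i - b j)" for y
  proof -
    define y' where "y' = y mod int u"
    have yy: "y = y' + int u * (y div int u)" by (simp add: y'_def)
    have "int u dvd y * (b i - b j) \<longleftrightarrow> int u dvd y' * (b i - b j)"
      by (subst yy) (simp add: distrib_right dvd_add_left_iff mult.assoc)
    then have "y' \<in> Y" using y u by (simp add: Y_def y'_def)
    moreover have "real_of_int y / real u = real_of_int y' / real u + real_of_int (y div int u)"
      using u by (subst yy) (simp add: field_simps)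
    then have "P (real_of_int y / real u) = P (real_of_int y' / real u)" by (simp add: P_add_Ints)
    ultimately show ?thesis unfolding \<theta>_def using fin by (intro Max_ge) auto
  qed
  \<comment> \<open>Halfway between \<open>\<theta>\<close> and 1: the room left is for the error
    caused by the \<open>- 1\<close> in \<open>p ^ M - 1\<close>, which is small enough from
    \<open>k0\<close> on.\<close>
  define \<theta>' where "\<theta>' = (1 + \<theta>) / 2"
  have \<theta>': "0 < \<theta>'" "\<theta>' < 1" using \<theta>0 \<theta>1 by (auto simp: \<theta>'_def)
  define A where "A = real v * real_of_int r / real u"
  obtain k0 where k0: "K * \<bar>A\<bar> * \<rho> ^ k0 < (1 - \<theta>) / 2"
    using order_tendstoD(2)[OF rho_power_tendsto_0[of "K * \<bar>A\<bar>"], of "(1 - \<theta>) / 2"] \<theta>1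
      eventually_happens'[OF sequentially_bot] by fastforce
  have factor: "norm (P (A * (real p ^ M - 1) * \<rho> ^ Suc k)) \<le> \<theta>'" if k: "k0 \<le> k" "k < M" for k M
  proof -
    \<comment> \<open>Up to that error the argument of the factor is \<open>y / u\<close>. As
      \<open>v\<close> and \<open>p\<close> are coprime to \<open>u\<close>, the non-divisibility
      assumed for \<open>r\<close> passes to \<open>y\<close>.\<close>
    define y where "y = int v * r * int p ^ (M - Suc k)"
    have "\<not> int u dvd y * (b i - b j)"
    proof
      assume "int u dvd y * (b i - b j)"
      then have "int u dvd int (v * p ^ (M - Suc k)) * (r * (b i - b j))"
        by (simp add: y_def algebra_simps)
      moreover have "coprime (int u) (int (v * p ^ (M - Suc k)))"
        using cop by (simp only: coprime_int_iff coprime_mult_right_iff coprime_power_right_iff) simp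
      ultimately show False using ndvd coprime_dvd_mult_right_iff by blast
    qed
    then have y: "norm (P (real_of_int y / real u)) \<le> \<theta>" by (rule bound)
    have "real p ^ M = real p ^ (M - Suc k) * real p ^ Suc k" using k(2) by (simp del: power_Suc flip: power_add)
    then have "real p ^ M * \<rho> ^ Suc k = real p ^ (M - Suc k)" using p_ge_2 by (simp add: rho_eq power_divide)
    moreover have "A * (real p ^ M - 1) * \<rho> ^ Suc k = A * (real p ^ M * \<rho> ^ Suc k) - A * \<rho> ^ Suc k"
      by (simp only: right_diff_distrib left_diff_distrib mult.assoc mult_1_left)
    moreover have "A * real p ^ (M - Suc k) = real_of_int y / real u" by (simp add: A_def y_def)
    ultimately have eq: "A * (real p ^ M - 1) * \<rho> ^ Suc k = real_of_int y / real u - A * \<rho> ^ Suc k"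
      by (simp only:)
    have "norm (P (A * (real p ^ M - 1) * \<rho> ^ Suc k) - P (real_of_int y / real u)) \<le> K * \<bar>A * \<rho> ^ Suc k\<bar>"
      using norm_P_diff_le[of "A * (real p ^ M - 1) * \<rho> ^ Suc k" "real_of_int y / real u"]
      unfolding eq by simp
    also have "K * \<bar>A * \<rho> ^ Suc k\<bar> = K * \<bar>A\<bar> * \<rho> ^ Suc k" using rho_pos by (simp add: abs_mult)
    also have "\<dots> \<le> K * \<bar>A\<bar> * \<rho> ^ k0"
      using k(1) rho_pos rho_less_1 K_pos by (intro mult_left_mono power_decreasing) auto
    finally have "norm (P (A * (real p ^ M - 1) * \<rho> ^ Suc k) - P (real_of_int y / real u)) \<le> (1 - \<theta>) / 2"
      using k0 by linarith
    moreover have "norm (P (A * (real p ^ M - 1) * \<rho> ^ Suc k)) \<le>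
        norm (P (real_of_int y / real u)) + norm (P (A * (real p ^ M - 1) * \<rho> ^ Suc k) - P (real_of_int y / real u))"
      by (rule norm_triangle_sub)
    ultimately show ?thesis using y unfolding \<theta>'_def by (simp add: field_simps)
  qed
  have "norm (Qinf (A * (real p ^ M - 1))) \<le> \<theta>' ^ (M - k0)" for M
  proof -
    have "norm (Qinf (A * (real p ^ M - 1))) \<le> norm (Q M (A * (real p ^ M - 1))) * 1"
      by (subst Qinf_split[of _ M]) (simp only: norm_mult, intro mult_left_mono norm_Qinf_le norm_ge_zero)
    also have "\<dots> = (\<Prod>k<M. norm (P (A * (real p ^ M - 1) * \<rho> ^ Suc k)))" by (simp add: Q_def prod_norm)
    also have "\<dots> \<le> (\<Prod>k<M. if k < k0 then 1 else \<theta>')"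
      by (intro prod_mono) (auto simp: norm_P_le intro: factor simp del: power_Suc)
    also have "\<dots> = \<theta>' ^ (M - k0)"
      by (induction M) (auto simp: Suc_diff_le not_less)
    finally show ?thesis .
  qed
  note le = this
  have "(\<lambda>M. Qinf (A * (real p ^ M - 1))) \<longlonglongrightarrow> 0"
  proof (rule Lim_null_comparison)
    show "\<forall>\<^sub>F M in sequentially. norm (Qinf (A * (real p ^ M - 1))) \<le> \<theta>' ^ (M - k0)"
      using le by simp
    have "(\<lambda>n. \<theta>' ^ n) \<longlonglongrightarrow> 0" using \<theta>' by (intro LIMSEQ_realpow_zero) auto
    then show "(\<lambda>M. \<theta>' ^ (M - k0)) \<longlonglongrightarrow> 0" using LIMSEQ_offset[of "\<lambda>M. \<theta>' ^ (M - k0)" k0 0] by simp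
  qed
  then show ?thesis by (simp add: A_def field_simps)
qed

text \<open>For \<open>k < M\<close> the number \<open>p ^ M * \<rho> ^ Suc k\<close> is an integer,
  so the first \<open>M\<close> factors at \<open>r * (p ^ M - 1)\<close> are those at
  \<open>- r\<close>, and the remaining ones give \<open>Qinf (r * (1 - \<rho> ^ M))\<close>. By
  conjugation symmetry the former have product of modulus at least
  \<open>norm (Qinf r)\<close>.\<close>

lemma norm_Qinf_repunit_ge:
  fixes r :: int
  shows "norm (Qinf r) * norm (Qinf (r * (1 - \<rho> ^ M))) \<le> norm (Qinf (r * (real p ^ M - 1)))"
proof -
  have pr: "real p ^ M * \<rho> ^ M = 1" using p_ge_2 by (simp add: rho_eq power_divide)
  have "Q M (r * (real p ^ M - 1)) = Q M (- r)"
    unfolding Q_def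
  proof (rule prod.cong[OF refl])
    fix k assume "k \<in> {..<M}"
    then have "real p ^ M = real p ^ (M - Suc k) * real p ^ Suc k" by (simp del: power_Suc flip: power_add)
    then have "real p ^ M * \<rho> ^ Suc k = real p ^ (M - Suc k)" using p_ge_2 by (simp add: rho_eq power_divide)
    then have "r * (real p ^ M - 1) * \<rho> ^ Suc k = - r * \<rho> ^ Suc k + real_of_int (r * int p ^ (M - Suc k))"
      by (simp add: algebra_simps)
    then show "P (r * (real p ^ M - 1) * \<rho> ^ Suc k) = P (- r * \<rho> ^ Suc k)"
      by (simp only: P_add_Ints Ints_of_int)
  qed
  moreover have "r * (real p ^ M - 1) * \<rho> ^ M = r * (1 - \<rho> ^ M)"
    using pr by (simp add: algebra_simps)
  ultimately have "Qinf (r * (real p ^ M - 1)) = Q M (- r) * Qinf (r * (1 - \<rho> ^ M))"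
    using Qinf_split[of "r * (real p ^ M - 1)" M] by (simp only:)
  moreover have "norm (Qinf r) \<le> norm (Q M (- r))"
  proof -
    have "norm (Qinf r) = norm (Q M (- r)) * norm (Qinf (- r * \<rho> ^ M))"
      by (subst norm_Qinf_uminus[symmetric], subst Qinf_split[of _ M]) (simp add: norm_mult)
    also have "\<dots> \<le> norm (Q M (- r)) * 1" by (intro mult_left_mono norm_Qinf_le) auto
    finally show ?thesis by simp
  qed
  ultimately show ?thesis by (simp add: norm_mult mult_right_mono)
qed

lemma no_coprime_invariance:
  fixes u v :: nat
  assumes mp: "m < p" and u: "u > 1" and cop: "coprime u p" "coprime u v"
    and inv: "\<And>r::int. norm (Qinf (real_of_int (int u * r))) = norm (Qinf (real_of_int (int v * r)))"
    and ij: "i \<in> {1..m}" "j \<in> {1..m}" and ne: "b i \<noteq> b j"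
  shows False
proof -
  obtain r :: int where r: "r \<noteq> 0" "Qinf (real_of_int r) \<noteq> 0" using Qinf_nonzero_exists[OF mp] by blast
  \<comment> \<open>Using the number itself as the exponent makes \<open>U = u ^ k\<close> exceed
    \<open>\<bar>r * (b i - b j)\<bar>\<close>, so \<open>U\<close> cannot divide this non-zero
    integer.\<close>
  define k where "k = nat \<bar>r * (b i - b j)\<bar>"
  define U V where "U = u ^ k" and "V = v ^ k"
  have "k < 2 ^ k" by simp
  also have "2 ^ k \<le> U" unfolding U_def using u by (intro power_mono) auto
  finally have kU: "k < U" .
  have k0: "0 < k" using r(1) ne by (simp add: k_def)
  have U1: "1 < U" using kU k0 by simp
  have ndvd: "\<not> int U dvd r * (b i - b j)"
  proof
    assume "int U dvd r * (b i - b j)"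
    then have "\<bar>int U\<bar> \<le> \<bar>r * (b i - b j)\<bar>" using r(1) ne by (intro dvd_imp_le_int) auto
    then show False using kU by (simp add: k_def)
  qed
  have inv': "norm (Qinf (real_of_int (int (u ^ n) * s))) = norm (Qinf (real_of_int (int (v ^ n) * s)))" for n s
  proof (induction n arbitrary: s)
    case 0
    then show ?case by simp
  next
    case (Suc n)
    have "int (u ^ Suc n) * s = int u * (int (u ^ n) * s)" by simp
    then have "norm (Qinf (real_of_int (int (u ^ Suc n) * s))) = norm (Qinf (real_of_int (int v * (int (u ^ n) * s))))"
      by (simp only: inv)
    also have "int v * (int (u ^ n) * s) = int (u ^ n) * (int v * s)" by simp
    also have "norm (Qinf (real_of_int \<dots>)) = norm (Qinf (real_of_int (int (v ^ n) * (int v * s))))"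
      by (rule Suc.IH)
    also have "int (v ^ n) * (int v * s) = int (v ^ Suc n) * s" by simp
    finally show ?case .
  qed
  have copU: "coprime U p" "coprime U V"
    unfolding U_def V_def using cop by simp_all
  \<comment> \<open>By Euler's theorem \<open>U\<close> divides \<open>p ^ (t * \<phi>) - 1\<close>,
    so the invariance can be applied to the integer
    \<open>r * (p ^ (t * \<phi>) - 1) / U\<close>.\<close>
  define \<phi> where "\<phi> = totient U"
  have \<phi>: "\<phi> > 0" using U1 by (simp add: \<phi>_def)
  have dvd: "int U dvd int p ^ (t * \<phi>) - 1" for t
  proof -
    have "[p ^ totient U = 1] (mod U)" using copU(1) by (intro euler_theorem) (simp add: coprime_commute)
    then have "[(p ^ totient U) ^ t = 1 ^ t] (mod U)" by (rule cong_pow)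
    then have "[p ^ (t * \<phi>) = 1] (mod U)" by (simp add: \<phi>_def mult.commute flip: power_mult)
    then have "[int (p ^ (t * \<phi>)) = int 1] (mod int U)" by (simp only: cong_int_iff)
    then show ?thesis by (simp add: cong_iff_dvd_diff)
  qed
  have eq: "norm (Qinf (r * (real p ^ (t * \<phi>) - 1)))
      = norm (Qinf (real V * real_of_int r * (real p ^ (t * \<phi>) - 1) / real U))" for t
  proof -
    obtain q where q: "int p ^ (t * \<phi>) - 1 = int U * q" using dvd by blast
    then have "real_of_int (int p ^ (t * \<phi>) - 1) = real_of_int (int U * q)" by (simp only:)
    then have q': "real p ^ (t * \<phi>) - 1 = real U * real_of_int q" by simp
    have "r * (real p ^ (t * \<phi>) - 1) = real_of_int (int U * (r * q))" unfolding q' by simp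
    moreover have "real V * real_of_int r * (real p ^ (t * \<phi>) - 1) / real U = real_of_int (int V * (r * q))"
      unfolding q' using U1 by simp
    ultimately show ?thesis using inv'[of k "r * q"] by (simp only: U_def V_def)
  qed
  have mono: "strict_mono (\<lambda>t. t * \<phi>)" using \<phi> by (simp add: strict_mono_def)
  have "(\<lambda>t. Qinf (real V * real_of_int r * (real p ^ (t * \<phi>) - 1) / real U)) \<longlonglongrightarrow> 0"
    using LIMSEQ_subseq_LIMSEQ[OF Qinf_power_tendsto_0[OF U1 copU ij ndvd] mono] by (simp add: o_def)
  then have right: "(\<lambda>t. norm (Qinf (real V * real_of_int r * (real p ^ (t * \<phi>) - 1) / real U))) \<longlonglongrightarrow> 0"
    by (rule tendsto_norm_zero)
  have "(\<lambda>M. Qinf (r * (1 - \<rho> ^ M))) \<longlonglongrightarrow> Qinf r"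
  proof (rule LIM_zero_cancel, rule Lim_null_comparison)
    show "\<forall>\<^sub>F M in sequentially. norm (Qinf (r * (1 - \<rho> ^ M)) - Qinf r) \<le> K * \<bar>real_of_int r\<bar> * \<rho> ^ M"
    proof (intro always_eventually allI)
      fix M
      have "r * (1 - \<rho> ^ M) - r = - r * \<rho> ^ M" by (simp add: algebra_simps)
      then have "\<bar>r * (1 - \<rho> ^ M) - r\<bar> = \<bar>real_of_int r\<bar> * \<rho> ^ M" using rho_pos by (simp add: abs_mult)
      then show "norm (Qinf (r * (1 - \<rho> ^ M)) - Qinf r) \<le> K * \<bar>real_of_int r\<bar> * \<rho> ^ M"
        using norm_Qinf_diff[of "r * (1 - \<rho> ^ M)" r] by simp
    qed
    show "(\<lambda>M. K * \<bar>real_of_int r\<bar> * \<rho> ^ M) \<longlonglongrightarrow> 0" by (rule rho_power_tendsto_0)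
  qed
  then have "(\<lambda>t. Qinf (r * (1 - \<rho> ^ (t * \<phi>)))) \<longlonglongrightarrow> Qinf r"
    using LIMSEQ_subseq_LIMSEQ[OF _ mono] by (simp add: o_def)
  then have left: "(\<lambda>t. norm (Qinf r) * norm (Qinf (r * (1 - \<rho> ^ (t * \<phi>))))) \<longlonglongrightarrow> norm (Qinf r) * norm (Qinf r)"
    by (intro tendsto_intros)
  have "norm (Qinf r) * norm (Qinf r) \<le> 0"
    by (rule LIMSEQ_le[OF left right], intro exI allI impI, unfold eq[symmetric], rule norm_Qinf_repunit_ge)
  then show False using r(2) by (simp add: mult_le_0_iff)
qed

end

section \<open>Rational functionals and common denominators\<close>

lemma rational_linear_functional_exists:
  fixes d :: real
  assumes "d \<noteq> 0"
  shows "\<exists>h :: real \<Rightarrow> real. h d = 1 \<and> (\<forall>x. h x \<in> \<rat>) \<and> (\<forall>x y. h (x + y) = h x + h y) \<and>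
    (\<forall>q\<in>\<rat>. \<forall>x. h (q * x) = q * h x)"
proof -
  interpret V: vector_space_pair "\<lambda>(q::rat) (x::real). of_rat q * x" "\<lambda>(q::rat) (x::rat). q * x"
    by unfold_locales (auto simp: algebra_simps of_rat_add of_rat_mult)
  have "V.vs1.independent {d}" using assms by (simp add: V.vs1.dependent_single)
  \<comment> \<open>The reals are a vector space over the rationals, in which a non-zero
    \<open>d\<close> belongs to a basis; the target space \<open>rat\<close> makes all values
    rational.\<close>
  from V.linear_independent_extend[OF this, of "\<lambda>_. 1"] obtain g where
    g: "Vector_Spaces.linear (\<lambda>(q::rat) (x::real). of_rat q * x) (\<lambda>(q::rat) (x::rat). q * x) g" "g d = 1"
    by auto
  have add: "g (x + y) = g x + g y" and scale: "g (of_rat q * x) = q * g x" for x y q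
    using V.linear_add[OF g(1)] V.linear_scale[OF g(1)] by auto
  define h :: "real \<Rightarrow> real" where "h x = of_rat (g x)" for x
  have "h (q * x) = q * h x" if "q \<in> \<rat>" for q x
    using that by (elim Rats_cases) (simp add: h_def scale of_rat_mult)
  then show ?thesis using g(2) by (intro exI[of _ h]) (auto simp: h_def add of_rat_add)
qed

lemma common_denominator_exists:
  fixes X :: "real set"
  assumes "finite X" "X \<subseteq> \<rat>"
  shows "\<exists>N::nat. N > 0 \<and> (\<forall>x\<in>X. real N * x \<in> \<int>)"
  using assms
proof (induction X rule: finite_induct)
  case empty
  then show ?case by auto
next
  case (insert x X)
  then obtain N :: nat where N: "N > 0" "\<forall>y\<in>X. real N * y \<in> \<int>" by auto
  obtain a :: int and c :: nat where x: "c > 0" "x = of_int a / of_nat c"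
    using insert.prems by (elim insert_subset[THEN iffD1, THEN conjunct1, elim_format] Rats_cases') (metis pos_int_cases of_int_of_nat_eq)
  have "real (c * N) * x = of_int (int N * a)" using x by simp
  moreover have "real (c * N) * y = of_int (int c) * (real N * y)" for y by simp
  ultimately have "real (c * N) * y \<in> \<int>" if "y \<in> insert x X" for y
    using that N(2) by (metis Ints_mult Ints_of_int insert_iff)
  then show ?case using N(1) x(1) by (intro exI[of _ "c * N"]) auto
qed

section \<open>Integer digits from relative positions\<close>

text \<open>The finitely many relative positions survive a \<open>\<rat>\<close>-linear functional, which
  replaces the digits by integers; the separation of the original digits still bounds the fibres
  of the word pairing.\<close>

lemma (in separated_ifs) no_relative_positions:
  fixes u v c1 c2 n0 L :: nat and \<gamma> t :: real
  assumes mp: "m < p" and cop: "coprime u p" "coprime v p" "coprime u v" and uv: "u \<noteq> 1 \<or> v \<noteq> 1"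
    and pos: "u > 0" "v > 0" and \<gamma>: "\<gamma> \<in> \<rat>"
    and ratio: "real v * \<gamma> * real p ^ c2 = real u * real p ^ c1"
    and fin: "finite \<Theta>" and w0: "w0 \<in> words m n0"
    and rel: "\<And>n x. x \<in> words m n \<Longrightarrow> \<exists>w'\<in>words m (n0 + n + L). \<exists>\<theta>\<in>\<Theta>.
        \<gamma> * pt w' + t = pt (w0 @ x) + \<rho> ^ (n0 + n) * \<theta>"
  shows False
proof -
  \<comment> \<open>Separation makes \<open>a 1\<close> and \<open>a 2\<close> different;
    normalising the functional at their difference keeps the integer digits \<open>b 1\<close> and
    \<open>b 2\<close> different.\<close>
  have "[1] \<in> words m 1" "[2] \<in> words m 1" using m_ge_2 by (auto simp: words_def)
  then have "l * \<rho> ^ 1 \<le> \<bar>pt [1] - pt [2]\<bar>" by (intro separated) auto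
  moreover have "0 < l * \<rho> ^ 1" using l_pos rho_pos by simp
  ultimately have ne: "a 1 - a 2 \<noteq> 0" by auto
  obtain h0 :: "real \<Rightarrow> real" where h0: "h0 (a 1 - a 2) = 1" "\<And>x. h0 x \<in> \<rat>"
    "\<And>x y. h0 (x + y) = h0 x + h0 y" "\<And>q x. q \<in> \<rat> \<Longrightarrow> h0 (q * x) = q * h0 x"
    using rational_linear_functional_exists[OF ne] by blast
  obtain N :: nat where N: "N > 0" "\<forall>x\<in>(\<lambda>i. h0 (a i)) ` {1..m}. real N * x \<in> \<int>"
    using common_denominator_exists[of "(\<lambda>i. h0 (a i)) ` {1..m}"] h0(2) by blast
  define h where "h x = real N * h0 x" for x
  have add: "h (x + y) = h x + h y" and scale: "q \<in> \<rat> \<Longrightarrow> h (q * x) = q * h x" for x y q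
    using h0(3,4) by (auto simp: h_def algebra_simps)
  define b where "b i = \<lfloor>h (a i)\<rfloor>" for i
  have b: "real_of_int (b i) = h (a i)" if "i \<in> {1..m}" for i
    using N(2) that by (auto simp: b_def h_def elim!: Ints_cases)
  have bne: "b 1 \<noteq> b 2"
  proof
    assume "b 1 = b 2"
    then have eq: "h (a 1) = h (a 2)" using b[of 1] b[of 2] m_ge_2 by simp
    have "h (a 1) = h (a 1 - a 2) + h (a 2)" using add[of "a 1 - a 2" "a 2"] by simp
    then have "h (a 1 - a 2) = 0" using eq by simp
    then show False using N(1) h0(1) by (simp add: h_def)
  qed
  have rho_Rats: "\<rho> \<in> \<rat>" by (simp add: rho_eq)
  define Bd where "Bd = 1 + (\<Sum>i\<in>{1..m}. \<bar>real_of_int (b i)\<bar>)"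
  interpret digits: integer_digits m p \<rho> b Bd
  proof
    fix i assume "i \<in> {1..m}"
    then show "\<bar>real_of_int (b i)\<bar> \<le> Bd"
      unfolding Bd_def using member_le_sum[of i "{1..m}" "\<lambda>i. \<bar>real_of_int (b i)\<bar>"] by simp
  next
    have "0 \<le> (\<Sum>i\<in>{1..m}. \<bar>real_of_int (b i)\<bar>)" by (rule sum_nonneg) simp
    then show "Bd > 0" unfolding Bd_def by (rule add_pos_nonneg[OF zero_less_one])
  qed (use m_ge_2 p_ge_2 rho_eq in auto)
  have h_pt: "h (pt w) = digits.B w" if "set w \<subseteq> {1..m}" for w
    using that
  proof (induction w)
    case Nil
    show ?case using add[of 0 0] by simp
  next
    case (Cons i w)
    then show ?case using rho_Rats by (simp add: add scale b)
  qed
  \<comment> \<open>The length of a word determines \<open>n\<close>, so \<open>F\<close> and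
    \<open>T\<close> can be functions of the word alone; lists that are not words get arbitrary
    values.\<close>
  have "\<exists>w' \<theta>. \<forall>n. x \<in> words m n \<longrightarrow> w' \<in> words m (n0 + n + L) \<and> \<theta> \<in> \<Theta> \<and>
      \<gamma> * pt w' + t = pt (w0 @ x) + \<rho> ^ (n0 + n) * \<theta>" for x
  proof (cases "x \<in> words m (length x)")
    case True
    then show ?thesis using rel[OF True] length_words by metis
  next
    case False
    then show ?thesis using length_words by metis
  qed
  then obtain F T where FT: "\<And>n x. x \<in> words m n \<Longrightarrow> F x \<in> words m (n0 + n + L) \<and> T x \<in> \<Theta> \<and>
      \<gamma> * pt (F x) + t = pt (w0 @ x) + \<rho> ^ (n0 + n) * T x"
    by metis
  define H where "H = (\<Sum>\<theta>\<in>\<Theta>. \<bar>h \<theta>\<bar>)"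
  have relation: "\<exists>\<beta>. \<bar>\<beta>\<bar> \<le> H \<and> \<gamma> * digits.B (F x) + h t = digits.B (w0 @ x) + \<rho> ^ (n0 + k) * \<beta>"
    if x: "x \<in> words m k" for k x
  proof (intro exI[of _ "h (T x)"] conjI)
    show "\<bar>h (T x)\<bar> \<le> H"
      unfolding H_def using FT[OF x] fin by (intro member_le_sum) auto
    have "h (\<gamma> * pt (F x) + t) = h (pt (w0 @ x) + \<rho> ^ (n0 + k) * T x)" using FT[OF x] by simp
    then have "\<gamma> * h (pt (F x)) + h t = h (pt (w0 @ x)) + \<rho> ^ (n0 + k) * h (T x)"
      using \<gamma> rho_Rats by (simp add: add scale)
    moreover have "set (F x) \<subseteq> {1..m}" "set (w0 @ x) \<subseteq> {1..m}"
      using FT[OF x] w0 x by (auto simp: words_def)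
    ultimately show "\<gamma> * digits.B (F x) + h t = digits.B (w0 @ x) + \<rho> ^ (n0 + k) * h (T x)"
      by (simp only: h_pt)
  qed
  \<comment> \<open>Given \<open>F x\<close> and the position \<open>T x\<close>, the relation for
    the original digits determines the address of \<open>w0 @ x\<close>, hence
    \<open>x\<close>.\<close>
  have fibres: "card {x \<in> words m k. F x = w'} \<le> card \<Theta>" for k w'
  proof (rule card_inj_on_le[of T])
    show "inj_on T {x \<in> words m k. F x = w'}"
    proof (rule inj_onI)
      fix x y assume xy: "x \<in> {x \<in> words m k. F x = w'}" "y \<in> {x \<in> words m k. F x = w'}" "T x = T y"
      then have "pt (w0 @ x) = pt (w0 @ y)" using FT[of x k] FT[of y k] by simp
      moreover have "w0 @ x \<in> words m (n0 + k)" "w0 @ y \<in> words m (n0 + k)"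
        using xy words_append[OF w0] by auto
      ultimately have "w0 @ x = w0 @ y" using inj_on_pt inj_onD by metis
      then show "x = y" by simp
    qed
  qed (use FT fin in auto)
  interpret coupled_digits m p \<rho> b Bd u v c1 c2 n0 L "card \<Theta>" w0 F \<gamma> "h t" H
    by unfold_locales (use ratio w0 FT relation fibres in auto)
  have ij: "1 \<in> {1..m}" "2 \<in> {1..m}" using m_ge_2 by auto
  \<comment> \<open>The invariance is symmetric in \<open>u\<close> and \<open>v\<close>, so the one
    that exceeds 1 can serve as the denominator.\<close>
  show False
  proof (cases "u = 1")
    case False
    then have "u > 1" using pos by simp
    then show False
      using digits.no_coprime_invariance[OF mp _ cop(1,3) norm_Qinf_coupled ij bne] by blast
  next
    case True
    then have "v > 1" using uv pos by simp
    then show False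
      using digits.no_coprime_invariance[OF mp _ cop(2) _ norm_Qinf_coupled[symmetric] ij bne] cop(3)
      by (simp add: coprime_commute)
  qed
qed

section \<open>From the open set condition to separated addresses\<close>

lemma open_set_condition_imp_separated:
  fixes a :: "nat \<Rightarrow> real"
  assumes rho: "0 < \<rho>" and osc: "open_set_condition {1..m} (\<lambda>i x. \<rho> * x + a i)"
  shows "\<exists>l>0. \<forall>n. \<forall>v\<in>words m n. \<forall>w\<in>words m n. v \<noteq> w \<longrightarrow>
    l * \<rho> ^ n \<le> \<bar>addr \<rho> a v - addr \<rho> a w\<bar>"
proof -
  obtain V where V: "V \<noteq> {}" "open V" "disjoint_family_on (\<lambda>i. (\<lambda>x. \<rho> * x + a i) ` V) {1..m}"
    "\<And>i. i \<in> {1..m} \<Longrightarrow> (\<lambda>x. \<rho> * x + a i) ` V \<subseteq> V"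
    using osc unfolding open_set_condition_def by blast
  obtain z where z: "z \<in> V" using V(1) by blast
  obtain l where l: "l > 0" "\<And>y. dist y z < l \<Longrightarrow> y \<in> V"
    using V(2) z unfolding open_dist by blast
  have sub: "\<rho> ^ n * x + addr \<rho> a w \<in> V" if "x \<in> V" "w \<in> words m n" for n x w
    using that(2)
  proof (induction n arbitrary: w)
    case 0
    then show ?case using that(1) by simp
  next
    case (Suc n)
    then obtain i u where w: "w = i # u" "i \<in> {1..m}" "u \<in> words m n" unfolding words_Suc by auto
    have "\<rho> * (\<rho> ^ n * x + addr \<rho> a u) + a i \<in> V" using V(4)[OF w(2)] Suc.IH[OF w(3)] by blast
    then show ?case by (simp add: w algebra_simps)
  qed
  have disj: "\<rho> ^ n * x + addr \<rho> a v \<noteq> \<rho> ^ n * y + addr \<rho> a w"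
    if "x \<in> V" "y \<in> V" "v \<in> words m n" "w \<in> words m n" "v \<noteq> w" for n x y v w
    using that(3-5)
  proof (induction n arbitrary: v w)
    case 0
    then show ?case by simp
  next
    case (Suc n)
    obtain i v' where v: "v = i # v'" "i \<in> {1..m}" "v' \<in> words m n" using Suc.prems(1) unfolding words_Suc by auto
    obtain j w' where w: "w = j # w'" "j \<in> {1..m}" "w' \<in> words m n" using Suc.prems(2) unfolding words_Suc by auto
    define x' y' where "x' = \<rho> ^ n * x + addr \<rho> a v'" and "y' = \<rho> ^ n * y + addr \<rho> a w'"
    have "x' \<in> V" "y' \<in> V" unfolding x'_def y'_def using sub that(1,2) v(3) w(3) by auto
    have "\<rho> * x' + a i \<noteq> \<rho> * y' + a j"
    proof (cases "i = j")
      case True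
      then have "v' \<noteq> w'" using Suc.prems(3) v(1) w(1) by simp
      then have "x' \<noteq> y'" unfolding x'_def y'_def by (rule Suc.IH[OF v(3) w(3)])
      then show ?thesis using True rho by simp
    next
      case False
      then have "(\<lambda>x. \<rho> * x + a i) ` V \<inter> (\<lambda>x. \<rho> * x + a j) ` V = {}"
        using V(3) v(2) w(2) unfolding disjoint_family_on_def by blast
      then show ?thesis using \<open>x' \<in> V\<close> \<open>y' \<in> V\<close> by blast
    qed
    then show ?case by (simp add: v(1) w(1) x'_def y'_def algebra_simps)
  qed
  have "l * \<rho> ^ n \<le> \<bar>addr \<rho> a v - addr \<rho> a w\<bar>"
    if vw: "v \<in> words m n" "w \<in> words m n" "v \<noteq> w" for n v w
  proof (rule ccontr)
    assume less: "\<not> l * \<rho> ^ n \<le> \<bar>addr \<rho> a v - addr \<rho> a w\<bar>"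
    \<comment> \<open>With addresses closer than \<open>l * \<rho> ^ n\<close>, the image of
      \<open>z\<close> in the copy of \<open>V\<close> for \<open>v\<close> is also the image of a
      point \<open>y\<close> of \<open>V\<close> in the copy for \<open>w\<close>, although the two
      copies are disjoint.\<close>
    define y where "y = z + (addr \<rho> a v - addr \<rho> a w) / \<rho> ^ n"
    have "dist y z < l"
      using less rho by (simp add: y_def dist_real_def abs_divide divide_less_eq)
    then have "y \<in> V" by (rule l(2))
    moreover have "\<rho> ^ n * z + addr \<rho> a v = \<rho> ^ n * y + addr \<rho> a w"
      using rho by (simp add: y_def distrib_left)
    ultimately show False using disj[OF z _ vw] by blast
  qed
  then show ?thesis using l(1) by blast
qed

text \<open>Strip the powers of \<open>p\<close> from the numerator and the denominator of the
  reduced fraction.\<close>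

lemma positive_rational_split_prime:
  fixes \<gamma> :: real and p :: nat
  assumes "\<gamma> \<in> \<rat>" "\<gamma> > 0" "prime p"
  shows "\<exists>u v i j :: nat. u > 0 \<and> v > 0 \<and> coprime u v \<and> coprime u p \<and> coprime v p \<and>
    \<gamma> * (real v * real p ^ j) = real u * real p ^ i"
proof -
  obtain x y :: nat where xy: "y \<noteq> 0" "\<bar>\<gamma>\<bar> = real x / real y" "coprime x y"
    using Rats_abs_nat_div_natE[OF assms(1)] by metis
  have g: "\<gamma> = real x / real y" using xy(2) assms(2) by simp
  then have x0: "x \<noteq> 0" using assms(2) by (cases "x = 0") auto
  have nu: "\<not> is_unit p" using assms(3) not_prime_unit by blast
  obtain u where u: "x = p ^ multiplicity p x * u" "\<not> p dvd u"
    using multiplicity_decompose'[OF x0 nu] by blast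
  obtain v where v: "y = p ^ multiplicity p y * v" "\<not> p dvd v"
    using multiplicity_decompose'[OF xy(1) nu] by blast
  have "u dvd x" "v dvd y" using u(1) v(1) by (metis dvd_triv_right)+
  then have "coprime u v" using xy(3) coprime_divisors by blast
  moreover have "coprime u p" "coprime v p"
    using u(2) v(2) assms(3) by (auto simp: coprime_commute intro: prime_imp_coprime)
  moreover have "u > 0" "v > 0" using u(2) v(2) by (auto intro: Nat.gr0I)
  moreover have "\<gamma> * (real v * real p ^ multiplicity p y) = real u * real p ^ multiplicity p x"
  proof -
    have "real x = real u * real p ^ multiplicity p x" by (subst u(1)) simp
    moreover have "real y = real v * real p ^ multiplicity p y" by (subst v(1)) simp
    moreover have "\<gamma> * real y = real x" using g xy(1) by simp
    ultimately show ?thesis by simp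
  qed
  ultimately show ?thesis by blast
qed

section \<open>The two directions of the equivalence\<close>

theorem corollary1p2:
  fixes m :: nat and \<rho> :: real and a :: "nat \<Rightarrow> real" and E :: "real set" and \<gamma> :: real
  assumes "m \<ge> 2"
    and "0 < \<rho>" and "\<rho> < 1"
    and "self_similar_set {1..m} (\<lambda>i x. \<rho> * x + a i) E"
    and "open_set_condition {1..m} (\<lambda>i x. \<rho> * x + a i)"
    and "hausdorff_dim E < 1"
    and "\<exists>p::nat. prime p \<and> inverse \<rho> = real p"
    and "\<gamma> \<in> \<rat>" and "\<gamma> > 0"
  shows "(\<forall>\<alpha>::real. upper_minkowski_dim ((\<lambda>x. \<gamma> * x + \<alpha>) ` E \<inter> E) < hausdorff_dim E)
     \<longleftrightarrow> \<gamma> \<notin> {\<rho> powi k | k::int. True}"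
proof -
  obtain p :: nat where p: "prime p" "inverse \<rho> = real p" using assms(7) by blast
  have rho: "\<rho> = 1 / real p" using p(2) by (metis inverse_inverse_eq inverse_eq_divide)
  have p2: "p \<ge> 2" using p(1) by (rule prime_ge_2_nat)
  obtain l where l: "l > 0" "\<And>n v w. v \<in> words m n \<Longrightarrow> w \<in> words m n \<Longrightarrow> v \<noteq> w \<Longrightarrow>
      l * \<rho> ^ n \<le> \<bar>addr \<rho> a v - addr \<rho> a w\<bar>"
    using open_set_condition_imp_separated[OF assms(2,5)] by blast
  interpret separated_ifs m p \<rho> a E l
    using assms(1,4) p2 rho l unfolding self_similar_set_def by unfold_locales auto
  have dim: "hausdorff_dim E = ereal dm" by (rule hausdorff_dim_eq)
  have "dm < 1" using assms(6) dim by (simp add: one_ereal_def)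
  then have "ln (real m) < ln (real p)" using ln_p_pos by (simp add: dm_def)
  then have mp: "m < p" using m_ge_2 p2 by (subst (asm) ln_less_cancel_iff) auto
  show ?thesis
  proof
    assume less: "\<forall>\<alpha>::real. upper_minkowski_dim ((\<lambda>x. \<gamma> * x + \<alpha>) ` E \<inter> E) < hausdorff_dim E"
    show "\<gamma> \<notin> {\<rho> powi k | k::int. True}"
    proof
      assume "\<gamma> \<in> {\<rho> powi k | k::int. True}"
      then obtain k :: int where k: "\<gamma> = \<rho> powi k" by blast
      define n where "n = nat \<bar>k\<bar>"
      \<comment> \<open>For \<open>k \<ge> 0\<close> the cylinder of \<open>w\<close> is itself a
        copy of ratio \<open>\<gamma>\<close> inside \<open>E\<close>; for \<open>k < 0\<close> the
        inverse of its map expands \<open>E\<close> to a copy of ratio \<open>\<gamma>\<close> that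
        contains \<open>E\<close>.\<close>
      define w where "w = replicate n (1::nat)"
      have w: "w \<in> words m n" using m_ge_2 by (auto simp: w_def words_def)
      have "\<exists>\<alpha> c b. c > 0 \<and> (\<lambda>x. c * x + b) ` E \<subseteq> (\<lambda>x. \<gamma> * x + \<alpha>) ` E \<inter> E"
      proof (cases "k \<ge> 0")
        case True
        then have "\<gamma> = \<rho> ^ n" by (simp add: k n_def power_int_def)
        then have "(\<lambda>x. \<gamma> * x + pt w) ` E \<subseteq> (\<lambda>x. \<gamma> * x + pt w) ` E \<inter> E"
          using address_mem w by auto
        then show ?thesis using assms(9) by blast
      next
        case False
        then have g: "\<gamma> * \<rho> ^ n = 1" using rho_pos
          by (simp add: k n_def power_int_def power_inverse)
        have "x \<in> (\<lambda>x. \<gamma> * x + (- \<gamma> * pt w)) ` E" if x: "x \<in> E" for x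
        proof (rule image_eqI[OF _ address_mem[OF x w]])
          have "\<gamma> * (\<rho> ^ n * x + pt w) + (- \<gamma> * pt w) = (\<gamma> * \<rho> ^ n) * x" by (simp add: algebra_simps)
          then show "x = \<gamma> * (\<rho> ^ n * x + pt w) + (- \<gamma> * pt w)" by (simp only: g mult_1_left)
        qed
        then have "(\<lambda>x. 1 * x + 0) ` E \<subseteq> (\<lambda>x. \<gamma> * x + (- \<gamma> * pt w)) ` E \<inter> E" by auto
        then show ?thesis using zero_less_one by blast
      qed
      then obtain \<alpha> c b where "c > 0" "(\<lambda>x. c * x + b) ` E \<subseteq> (\<lambda>x. \<gamma> * x + \<alpha>) ` E \<inter> E" by blast
      then have "ereal dm \<le> upper_minkowski_dim ((\<lambda>x. \<gamma> * x + \<alpha>) ` E \<inter> E)"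
        by (intro dm_le_upper_minkowski_dim) auto
      then show False using less dim by (metis not_less)
    qed
  next
    assume not_power: "\<gamma> \<notin> {\<rho> powi k | k::int. True}"
    obtain u v i j :: nat where uv: "u > 0" "v > 0" "coprime u v" "coprime u p" "coprime v p"
      and split: "\<gamma> * (real v * real p ^ j) = real u * real p ^ i"
      using positive_rational_split_prime[OF assms(8,9) p(1)] by blast
    have ne: "v \<noteq> 1 \<or> u \<noteq> 1"
    proof (rule ccontr)
      assume "\<not> ?thesis"
      then have "\<gamma> * real p ^ j = real p ^ i" using split by simp
      then have "\<gamma> = real p ^ i / real p ^ j" using p2 by (simp add: field_simps)
      also have "\<dots> = \<rho> powi (int j - int i)"
        using p2 by (simp add: rho power_int_diff power_divide)
      finally show False using not_power by blast
    qed
    show "\<forall>\<alpha>::real. upper_minkowski_dim ((\<lambda>x. \<gamma> * x + \<alpha>) ` E \<inter> E) < hausdorff_dim E"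
    proof (rule ccontr)
      assume "\<not> ?thesis"
      then obtain \<alpha> where "\<not> upper_minkowski_dim ((\<lambda>x. \<gamma> * x + \<alpha>) ` E \<inter> E) < ereal dm"
        unfolding dim by blast
      then have "full ((\<lambda>x. \<gamma> * x + \<alpha>) ` E \<inter> E)"
        using not_full_imp_upper_minkowski_dim_less by blast
      then have "full ((\<lambda>x. \<gamma> * x + \<alpha>) ` E)" by (rule full_mono) auto
      then obtain k t W where W: "open W" "E \<inter> W \<noteq> {}"
        "\<And>z. z \<in> W \<Longrightarrow> z \<in> E \<longleftrightarrow> z \<in> (\<lambda>x. \<rho> ^ k / \<gamma> * x + t) ` E"
        using full_imp_local_equality[OF assms(9)] by meson
      \<comment> \<open>The coincidence is with a copy of ratio
        \<open>\<rho> ^ k / \<gamma>\<close>, so \<open>u\<close> and \<open>v\<close> exchange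
        their roles from here on.\<close>
      define c where "c = \<rho> ^ k / \<gamma>"
      have c: "c > 0" using assms(9) rho_pos by (simp add: c_def)
      have c_Rats: "c \<in> \<rat>" unfolding c_def using assms(8) by (simp add: rho Rats_divide)
      have ratio: "real u * c * real p ^ (i + k) = real v * real p ^ j"
      proof -
        have "real u * c * real p ^ (i + k) = (real u * real p ^ i) * (real p ^ k * \<rho> ^ k) / \<gamma>"
          by (simp add: c_def power_add)
        also have "real p ^ k * \<rho> ^ k = 1" using p2 by (simp add: rho power_divide)
        finally show ?thesis using assms(9) by (simp flip: split)
      qed
      obtain \<Theta> L n0 w0 where rel: "finite \<Theta>" "w0 \<in> words m n0"
        "\<And>n x. x \<in> words m n \<Longrightarrow> \<exists>w'\<in>words m (n0 + n + L). \<exists>\<theta>\<in>\<Theta>.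
          c * pt w' + t = pt (w0 @ x) + \<rho> ^ (n0 + n) * \<theta>"
        using finitely_many_relative_positions[OF mp c W(1,2), of t] W(3) unfolding c_def by metis
      show False
        by (rule no_relative_positions[OF mp uv(5,4) _ ne uv(2,1) c_Rats ratio rel(1,2)])
          (use uv(3) rel(3) in \<open>auto simp: coprime_commute\<close>)
    qed
  qed
qed

end
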